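(* Let $P$ be a semiorder. The dimension of $P$ is at most $2$ if and only if all of the following hold: (1) $P$ is hereditary; (2) the block structure of $P$ does not require optional elements, i.e. it contains no weak boundary with optional element; (3) if the block structure of $P$ contains a block of type $C$ somewhere other than as the first or last block, then at least one of the blocks adjacent to that block of type $C$ is of type $T_1$.
   Context: All posets are finite and nonempty. The dimension $\dim(P)$ is the least $d$ such that $\le_P$ is the intersection of $d$ linear extensions of $P$. A poset $P=(X,\le_P)$ is an interval order if each $x\in X$ can be assigned a closed bounded real interval $I(x)=[\ell(x),r(x)]$ so that $x<_P y$ iff $r(x)<\ell(y)$; it is a semiorder if this can be done with all intervals of the same length. Degenerate intervals $[i,i]$ are allowed, and distinct elements may get the same interval. Minimal endpoint representation: write $D(x)=\{y: y<_P x\}$, $U(x)=\{y: y>_P x\}$. In an interval order the distinct down sets form a chain $D_0\subsetneq\cdots\subsetneq D_{t-1}$ and the distinct up sets form a chain $U_0\supsetneq\cdots\supsetneq U_{t-1}$ (the same number $t$, a known fact). The minimal endpoint representation assigns to $x$ the interval $[i,j]$ where $D(x)=D_i$ and $U(x)=U_j$. Ascent sequences and $\Psi$: for an integer sequence, $\mathrm{asc}(x_1,\dots,x_i)=|\{1\le j<i: x_j<x_{j+1}\}|$. An ascent sequence is a sequence $(x_1,\dots,x_n)$ of nonnegative integers with $x_1=0$ and $x_i\in[0,1+\mathrm{asc}(x_1,\dots,x_{i-1})]$ for $2\le i\le n$. $\Psi$ is the bijection of Bousquet-Mélou et al. from unlabeled interval orders on $n$ points to ascent sequences of length $n$. Its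 inverse is given recursively (in terms of minimal endpoint representations, as multisets of intervals): $\Psi^{-1}((0))$ has representation $\{[0,0]\}$. Given $Q=\Psi^{-1}((x_1,\dots,x_{n-1}))$, let $\ell(Q)$ be the largest right endpoint in its minimal endpoint representation (it is known that $\ell(Q)=\mathrm{asc}(x_1,\dots,x_{n-1})$) and $\ell^*(Q)$ the smallest left endpoint of an interval with right endpoint $\ell(Q)$. With $i=x_n$, the minimal endpoint representation of $\Psi^{-1}((x_1,\dots,x_n))$ is obtained by: (Move 1) if $i\le \ell^*(Q)$, add the interval $[i,\ell(Q)]$; (Move 2) if $i=\ell(Q)+1$, add $[\ell(Q)+1,\ell(Q)+1]$; (Move 3) if $\ell^*(Q)<i\le \ell(Q)$, simultaneously replace every $[\lambda,\rho]$ with $\lambda<i\le\rho<\ell(Q)$ by $[\lambda,\rho+1]$, every $[\lambda,\rho]$ with $i\le\lambda\le\rho\le \ell(Q)$ by $[\lambda+1,\rho+1]$, and every $[\lambda,\rho]$ with $\lambda<i$, $\rho=\ell(Q)$ by $[\lambda,i]$, and then add $[i,\ell(Q)+1]$. A semiorder $P$ on $n$ points with $\Psi(P)=(x_1,\dots,x_n)$ is hereditary if $\Psi^{-1}((x_1,\dots,x_i))$ is a semiorder for every $1\le i\le n$. Blocks ($b\ge 0$ an integer): $T_0=\{[0,0]\}$ (the trivial block); $T_1^b=\{[b,b],[b+1,b+1]\}$; $W_k^b=\{[b,b],[b+k,b+k]\}\cup\bigcup_{i=0}^{k-1}\{[b+i,b+i+1]\}$ for $k\ge1$; $C_2^b=\{[b,b],[b,b+1],[b,b+2],[b+1,b+2],[b+2,b+2]\}$;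 $U_k^b=\bigcup_{i=0}^{k-1}\{[b,b+i],[b+k-i,b+k]\}$ for $k\ge3$; $C_k^b=\{[b,b+k]\}\cup U_k^b$ for $k\ge 3$. Blocks are said to be of type $T_1$, $W$, $U$ or $C$ (the latter including $C_2$). Block structure: either the single block $T_0$, or a sequence of $r\ge1$ nontrivial blocks $A_1,\dots,A_r$ with subscripts $k_1,\dots,k_r$ and superscripts $b_1=0$, $b_{j+1}=b_j+k_j$, together with a choice, for each $1\le j<r$, of a boundary between $A_j$ and $A_{j+1}$, which is strong, weak, or weak with optional element (optional interval), subject to: a weak boundary is not allowed if $A_j$ or $A_{j+1}$ is of type $T_1$, nor if both are of type $W$; a weak boundary with optional element is allowed only if $A_j$ is of type $C$ or $U$ and $A_{j+1}$ is of type $W$ or is a $C_2$. The interval set of the block structure is the union of all the blocks, with $[b_{j+1},b_{j+1}]$ removed for each $j$ whose boundary is weak or weak with optional element, and with the optional interval $[b_{j+1}-1,b_{j+1}+1]$ added for each $j$ whose boundary is weak with optional element. Every hereditary semiorder $P$ has a unique block structure whose interval set is the set of intervals occurring in the minimal endpoint representation of $P$ (multiplicities disregarded); this is "the block structure of $P$". Conditions (2) and (3) are to be read for $P$ satisfying (1). *)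

theory Defs
  imports Complex_Main "HOL-Library.Multiset"
begin

text \<open>
  A poset is a carrier \<open>X\<close> together with its reflexive order relation \<open>r\<close>, subject to
  \<^const>\<open>partial_order_on\<close>.
\<close>

section \<open>Dimension\<close>

definition linear_extension :: "'a set \<Rightarrow> 'a rel \<Rightarrow> 'a rel \<Rightarrow> bool" where
  "linear_extension X r L \<longleftrightarrow> linear_order_on X L \<and> r \<subseteq> L"

text \<open>Positivity of \<open>d\<close> only fixes the degenerate convention that a one-point poset has
  dimension 1.\<close>

definition order_dim :: "'a set \<Rightarrow> 'a rel \<Rightarrow> nat" where
  "order_dim X r = (LEAST d. 0 < d \<and>
     (\<exists>L :: nat \<Rightarrow> 'a rel. (\<forall>i<d. linear_extension X r (L i)) \<and> r = (\<Inter>i<d. L i)))"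


section \<open>Semiorders and minimal endpoint representations\<close>

definition strictly_below :: "'a rel \<Rightarrow> 'a \<Rightarrow> 'a \<Rightarrow> bool" where
  "strictly_below r x y \<longleftrightarrow> (x, y) \<in> r \<and> x \<noteq> y"

definition interval_representation ::
    "'a set \<Rightarrow> 'a rel \<Rightarrow> ('a \<Rightarrow> real) \<Rightarrow> ('a \<Rightarrow> real) \<Rightarrow> bool" where
  "interval_representation X r lo hi \<longleftrightarrow>
     (\<forall>x\<in>X. lo x \<le> hi x) \<and>
     (\<forall>x\<in>X. \<forall>y\<in>X. strictly_below r x y \<longleftrightarrow> hi x < lo y)"

definition semiorder_on :: "'a set \<Rightarrow> 'a rel \<Rightarrow> bool" where
  "semiorder_on X r \<longleftrightarrow> partial_order_on X r \<and>
     (\<exists>lo hi. interval_representation X r lo hi \<and> (\<exists>c. \<forall>x\<in>X. hi x - lo x = c))"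

definition down_set :: "'a set \<Rightarrow> 'a rel \<Rightarrow> 'a \<Rightarrow> 'a set" where
  "down_set X r x = {y \<in> X. strictly_below r y x}"

definition up_set :: "'a set \<Rightarrow> 'a rel \<Rightarrow> 'a \<Rightarrow> 'a set" where
  "up_set X r x = {y \<in> X. strictly_below r x y}"

text \<open>
  In an interval order the distinct down sets form a chain
  \<open>D\<^sub>0 \<subset> D\<^sub>1 \<subset> \<dots>\<close>, so the index \<open>i\<close> with \<open>down_set X r x = D\<^sub>i\<close> is the number of
  down sets strictly contained in that of \<open>x\<close>. The chain of up sets is indexed in
  decreasing order.
\<close>

definition left_endpoint :: "'a set \<Rightarrow> 'a rel \<Rightarrow> 'a \<Rightarrow> nat" where
  "left_endpoint X r x = card {D \<in> down_set X r ` X. D \<subset> down_set X r x}"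

definition right_endpoint :: "'a set \<Rightarrow> 'a rel \<Rightarrow> 'a \<Rightarrow> nat" where
  "right_endpoint X r x = card {U \<in> up_set X r ` X. up_set X r x \<subset> U}"

text \<open>The pair \<open>(i, j)\<close> stands for the interval with left endpoint \<open>i\<close> and right endpoint
  \<open>j\<close>.\<close>

definition min_endpoint_rep :: "'a set \<Rightarrow> 'a rel \<Rightarrow> (nat \<times> nat) multiset" where
  "min_endpoint_rep X r =
     image_mset (\<lambda>x. (left_endpoint X r x, right_endpoint X r x)) (mset_set X)"

text \<open>
  The interval order presented by a multiset of intervals; the second component of a point
  tells apart the copies of an interval.
\<close>

definition mset_points :: "(nat \<times> nat) multiset \<Rightarrow> ((nat \<times> nat) \<times> nat) set" where
  "mset_points M = {(I, c). c < count M I}"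

definition mset_order :: "(nat \<times> nat) multiset \<Rightarrow> ((nat \<times> nat) \<times> nat) rel" where
  "mset_order M = {(p, q). p \<in> mset_points M \<and> q \<in> mset_points M \<and>
                           (p = q \<or> snd (fst p) < fst (fst q))}"


section \<open>Ascent sequences and the bijection with interval orders\<close>

definition asc :: "nat list \<Rightarrow> nat" where
  "asc xs = card {j. Suc j < length xs \<and> xs ! j < xs ! Suc j}"

definition ascent_sequence :: "nat list \<Rightarrow> bool" where
  "ascent_sequence xs \<longleftrightarrow> xs \<noteq> [] \<and> xs ! 0 = 0 \<and>
     (\<forall>i. 0 < i \<and> i < length xs \<longrightarrow> xs ! i \<le> 1 + asc (take i xs))"

definition ell :: "(nat \<times> nat) multiset \<Rightarrow> nat" where
  "ell Q = Max (snd ` set_mset Q)"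

definition ell_star :: "(nat \<times> nat) multiset \<Rightarrow> nat" where
  "ell_star Q = Min (fst ` {I \<in> set_mset Q. snd I = ell Q})"

fun shift_interval :: "nat \<Rightarrow> nat \<Rightarrow> nat \<times> nat \<Rightarrow> nat \<times> nat" where
  "shift_interval i m (a, b) =
     (if a < i \<and> i \<le> b \<and> b < m then (a, b + 1)
      else if i \<le> a \<and> a \<le> b \<and> b \<le> m then (a + 1, b + 1)
      else if a < i \<and> b = m then (a, i)
      else (a, b))"

text \<open>On ascent sequences \<open>i \<le> ell Q + 1\<close> always holds, so the last case is exactly
  \<open>ell_star Q < i \<le> ell Q\<close>.\<close>

definition add_point :: "(nat \<times> nat) multiset \<Rightarrow> nat \<Rightarrow> (nat \<times> nat) multiset" where
  "add_point Q i =
     (if i \<le> ell_star Q then add_mset (i, ell Q) Q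
      else if i = ell Q + 1 then add_mset (ell Q + 1, ell Q + 1) Q
      else add_mset (i, ell Q + 1) (image_mset (shift_interval i (ell Q)) Q))"

definition Psi_inv :: "nat list \<Rightarrow> (nat \<times> nat) multiset" where
  "Psi_inv xs = foldl add_point {#(0, 0)#} (tl xs)"

text \<open>An unlabeled interval order is identified with the multiset of intervals of its minimal
  endpoint representation; \<^const>\<open>Psi_inv\<close> maps ascent sequences bijectively onto these.\<close>

definition Psi :: "'a set \<Rightarrow> 'a rel \<Rightarrow> nat list" where
  "Psi X r = inv_into {xs. ascent_sequence xs} Psi_inv (min_endpoint_rep X r)"

definition hereditary :: "'a set \<Rightarrow> 'a rel \<Rightarrow> bool" where
  "hereditary X r \<longleftrightarrow> semiorder_on X r \<and>
     (\<forall>i. 1 \<le> i \<and> i \<le> card X \<longrightarrow>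
        (let M = Psi_inv (take i (Psi X r)) in semiorder_on (mset_points M) (mset_order M)))"


section \<open>Block structures\<close>

text \<open>\<open>BT0\<close> and \<open>BT1\<close> are $T_0$ and $T_1$; \<open>BW k\<close>, \<open>BU k\<close>, \<open>BC k\<close> are $W_k$, $U_k$,
  $C_k$. The superscript is not part of a block but determined by its position in a block
  structure.\<close>

datatype block = BT0 | BT1 | is_BW: BW nat | is_BU: BU nat | is_BC: BC nat

datatype boundary = Strong | Weak | Weak_Optional

fun nontrivial_block :: "block \<Rightarrow> bool" where
  "nontrivial_block BT0 \<longleftrightarrow> False"
| "nontrivial_block BT1 \<longleftrightarrow> True"
| "nontrivial_block (BW k) \<longleftrightarrow> 1 \<le> k"
| "nontrivial_block (BU k) \<longleftrightarrow> 3 \<le> k"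
| "nontrivial_block (BC k) \<longleftrightarrow> 2 \<le> k"

fun subscript :: "block \<Rightarrow> nat" where
  "subscript BT0 = 0"
| "subscript BT1 = 1"
| "subscript (BW k) = k"
| "subscript (BU k) = k"
| "subscript (BC k) = k"

text \<open>For \<open>k = 2\<close> the last equation yields
  $\{[b,b],[b,b+1],[b,b+2],[b+1,b+2],[b+2,b+2]\} = C_2^b$.\<close>

fun block_intervals :: "block \<Rightarrow> nat \<Rightarrow> (nat \<times> nat) set" where
  "block_intervals BT0 b = {(0, 0)}"
| "block_intervals BT1 b = {(b, b), (b + 1, b + 1)}"
| "block_intervals (BW k) b = {(b, b), (b + k, b + k)} \<union> (\<Union>i<k. {(b + i, b + i + 1)})"
| "block_intervals (BU k) b = (\<Union>i<k. {(b, b + i), (b + k - i, b + k)})"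
| "block_intervals (BC k) b = {(b, b + k)} \<union> (\<Union>i<k. {(b, b + i), (b + k - i, b + k)})"

fun boundary_allowed :: "block \<Rightarrow> boundary \<Rightarrow> block \<Rightarrow> bool" where
  "boundary_allowed A Strong B \<longleftrightarrow> True"
| "boundary_allowed A Weak B \<longleftrightarrow> A \<noteq> BT1 \<and> B \<noteq> BT1 \<and> \<not> (is_BW A \<and> is_BW B)"
| "boundary_allowed A Weak_Optional B \<longleftrightarrow> (is_BC A \<or> is_BU A) \<and> (is_BW B \<or> B = BC 2)"

text \<open>In a pair \<open>(As, Bs)\<close>, \<open>As\<close> lists the blocks (counted from 0) and \<open>Bs ! j\<close> is the
  boundary between \<open>As ! j\<close> and \<open>As ! Suc j\<close>.\<close>

type_synonym block_struct = "block list \<times> boundary list"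

fun valid_block_struct :: "block_struct \<Rightarrow> bool" where
  "valid_block_struct (As, Bs) \<longleftrightarrow>
     (As = [BT0] \<and> Bs = []) \<or>
     (As \<noteq> [] \<and> (\<forall>A\<in>set As. nontrivial_block A) \<and> length As = Suc (length Bs) \<and>
      (\<forall>j<length Bs. boundary_allowed (As ! j) (Bs ! j) (As ! Suc j)))"

definition superscript :: "block list \<Rightarrow> nat \<Rightarrow> nat" where
  "superscript As j = (\<Sum>i<j. subscript (As ! i))"

fun struct_intervals :: "block_struct \<Rightarrow> (nat \<times> nat) set" where
  "struct_intervals (As, Bs) =
     ((\<Union>j<length As. block_intervals (As ! j) (superscript As j))
        - {(superscript As (Suc j), superscript As (Suc j)) | j. j < length Bs \<and> Bs ! j \<noteq> Strong})
     \<union> {(superscript As (Suc j) - 1, superscript As (Suc j) + 1) | j.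
          j < length Bs \<and> Bs ! j = Weak_Optional}"

text \<open>For a hereditary semiorder there is exactly one such block structure, so the choice below
  selects it; for other posets the value is irrelevant.\<close>

definition block_structure :: "'a set \<Rightarrow> 'a rel \<Rightarrow> block_struct" where
  "block_structure X r =
     (SOME S. valid_block_struct S \<and> struct_intervals S = set_mset (min_endpoint_rep X r))"

definition no_optional_elements :: "block_struct \<Rightarrow> bool" where
  "no_optional_elements S \<longleftrightarrow> Weak_Optional \<notin> set (snd S)"

definition inner_C_next_to_T1 :: "block_struct \<Rightarrow> bool" where
  "inner_C_next_to_T1 S \<longleftrightarrow>
     (\<forall>j. 0 < j \<and> Suc j < length (fst S) \<and> is_BC (fst S ! j) \<longrightarrow>
        fst S ! (j - 1) = BT1 \<or> fst S ! Suc j = BT1)"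

end

theory Submission
  imports Defs
begin

text \<open>
  The minimal endpoint representation of a semiorder, multiplicities disregarded, is a lattice path:
  a chain of pairs \<open>(left, right)\<close> from \<open>(0, 0)\<close> to \<open>(m, m)\<close> with steps \<open>(1, 0)\<close>, \<open>(0, 1)\<close> and
  \<open>(1, 1)\<close>. Undoing the last insertion of the bijection with ascent sequences destroys the chain
  property exactly because of one local pattern of the path, so being hereditary amounts to
  avoiding that pattern, and a path avoiding it can be parsed from left to right into blocks.

  Dimension at most 2 means that the incomparability graph is transitively orientable. The forbidden
  pattern, a weak boundary with optional element, and an inner block of type \<open>C\<close> without a
  neighbour of type \<open>T\<^sub>1\<close> each yield seven points on which the forced orientations are
  contradictory. Otherwise the path can be cut into consecutive segments, each lying in a row or a
  column of the plane, such that points two or more segments apart are comparable. Orienting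
  incomparable pairs from even to odd segments, and each segment linearly, is then transitive.
\<close>

section \<open>Dimension of an interval order\<close>

text \<open>The three obstructions share one reason. If \<open>p\<close> is incomparable to
  \<open>q\<close> and to \<open>s\<close> while \<open>q\<close> lies below \<open>s\<close>, the
  two edges at \<open>p\<close> point both outwards or both inwards. Among the seven points there is
  a cycle of length three or five in the incomparability graph on which such forcings make every
  vertex a source or a sink for its two neighbours. Sources and sinks alternate along a cycle, so an
  odd one is impossible. Conversely, the delicate point of a clustering is the top of a block of
  type \<open>C\<close>, which lies both on the column and on the row of its block. Next to the row
  it is too far from an interval that crosses the start of the block from the left, next to the
  column too far from one that leaves the end of the block to the right. A neighbour
  \<open>BT1\<close> removes the difficulty on its side, and so does the end of the path; this is
  the origin of condition (3). For heredity, of the three moves only Move 3 displaces existing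
  intervals, so only its reversal can destroy the chain property.\<close>

locale interval_poset =
  fixes X :: "'a set" and r :: "'a rel" and l u :: "'a \<Rightarrow> nat"
  assumes fin: "finite X" and ne: "X \<noteq> {}"
    and r_eq: "r = {(x, y) \<in> X \<times> X. x = y \<or> u x < l y}"
    and le: "x \<in> X \<Longrightarrow> l x \<le> u x"
begin

lemma linear_extension_keyI:
  fixes f :: "'a \<Rightarrow> nat"
  assumes "inj_on f X" and "\<And>x y. x \<in> X \<Longrightarrow> y \<in> X \<Longrightarrow> u x < l y \<Longrightarrow> f x \<le> f y"
  shows "linear_extension X r {(x, y) \<in> X \<times> X. f x \<le> f y}"
  unfolding linear_extension_def linear_order_on_def partial_order_on_def preorder_on_def
  using assms
  by (auto simp: refl_on_def trans_def antisym_def total_on_def r_eq inj_on_def)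

text \<open>\<open>order_dim\<close> is a \<open>LEAST\<close>, which means nothing until some
  realizer is exhibited. One extension for each element \<open>y\<close> suffices: it places
  \<open>y\<close> above everything except the strict upper set of \<open>y\<close>.\<close>

lemma ex_realizer:
  "\<exists>d>0. \<exists>L :: nat \<Rightarrow> 'a rel. (\<forall>i<d. linear_extension X r (L i)) \<and> r = (\<Inter>i<d. L i)"
proof -
  define n where "n = card X"
  obtain h where h: "bij_betw h X {0..<n}"
    using fin n_def ex_bij_betw_finite_nat by blast
  have hlt: "h x < n" if "x \<in> X" for x
    using h that by (auto simp: bij_betw_def)
  have hinj: "inj_on h X" using h by (auto simp: bij_betw_def)
  \<comment> \<open>Sorting by right endpoint extends the order, because \<open>u x < l y\<close>
    gives \<open>u x < u y\<close>; the enumeration \<open>h\<close>, with values below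
    \<open>n\<close>, breaks ties.\<close>
  define f where "f x = u x * n + h x" for x
  have f_mono: "f x < f y" if "x \<in> X" "y \<in> X" "u x < u y" for x y
  proof -
    have "f x < u x * n + n" using hlt[OF that(1)] by (simp add: f_def)
    also have "\<dots> = Suc (u x) * n" by simp
    also have "\<dots> \<le> u y * n" using that(3) by (intro mult_right_mono) auto
    finally show ?thesis by (simp add: f_def)
  qed
  have f_inj: "x = y" if "x \<in> X" "y \<in> X" "f x = f y" for x y
  proof -
    have "u x = u y" using f_mono that by (metis less_irrefl linorder_neqE_nat)
    then have "h x = h y" using that by (simp add: f_def)
    then show ?thesis using hinj that by (auto simp: inj_on_def)
  qed
  define B where "B = Suc (Max (f ` X))"
  have fB: "f x < B" if "x \<in> X" for x
    using fin that by (simp add: B_def le_imp_less_Suc)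
  define g where "g y z = (if y = z then B else if u y < l z then B + Suc (f z) else f z)" for y z
  have lin: "linear_extension X r {(a, b) \<in> X \<times> X. g y a \<le> g y b}" if y: "y \<in> X" for y
  proof (rule linear_extension_keyI)
    show "inj_on (g y) X"
    proof (rule inj_onI)
      fix a b assume ab: "a \<in> X" "b \<in> X" "g y a = g y b"
      then show "a = b"
        using f_inj[of a b] fB[of a] fB[of b] by (simp add: g_def split: if_splits)
    qed
    fix a b assume ab: "a \<in> X" "b \<in> X" "u a < l b"
    have "f a < f b" using ab le[of b] by (intro f_mono) auto
    then show "g y a \<le> g y b"
      using ab fB[of a] fB[of b] le[of a] le[of b] by (auto simp: g_def)
  qed
  obtain e where e: "bij_betw e {0..<n} X"
    using fin n_def ex_bij_betw_nat_finite by blast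
  have npos: "0 < n" using fin ne by (simp add: n_def card_gt_0_iff)
  define L where "L i = {(a, b) \<in> X \<times> X. g (e i) a \<le> g (e i) b}" for i
  have "r = (\<Inter>i<n. L i)"
  proof
    show "r \<subseteq> (\<Inter>i<n. L i)"
      using lin e unfolding L_def linear_extension_def bij_betw_def by fastforce
    show "(\<Inter>i<n. L i) \<subseteq> r"
    proof
      fix p assume p: "p \<in> (\<Inter>i<n. L i)"
      obtain a b where ab: "p = (a, b)" by fastforce
      from p npos have X: "a \<in> X" "b \<in> X" by (auto simp: ab L_def)
      then obtain i where i: "i < n" "e i = a" using e by (auto simp: bij_betw_def)
      then have "g a a \<le> g a b" using p by (auto simp: ab L_def)
      then show "p \<in> r" using X fB[of b] by (auto simp: g_def ab r_eq split: if_splits)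
    qed
  qed
  moreover have "\<forall>i<n. linear_extension X r (L i)"
    using lin e by (auto simp: L_def bij_betw_def)
  ultimately show ?thesis using npos by blast
qed

lemma order_dim_le_2_iff:
  "order_dim X r \<le> 2 \<longleftrightarrow>
     (\<exists>L L'. linear_extension X r L \<and> linear_extension X r L' \<and> r = L \<inter> L')"
proof
  let ?P = "\<lambda>d. 0 < d \<and>
     (\<exists>L :: nat \<Rightarrow> 'a rel. (\<forall>i<d. linear_extension X r (L i)) \<and> r = (\<Inter>i<d. L i))"
  assume le2: "order_dim X r \<le> 2"
  have "?P (order_dim X r)"
    unfolding order_dim_def by (rule LeastI_ex) (use ex_realizer in blast)
  then obtain L where L: "0 < order_dim X r" "\<forall>i<order_dim X r. linear_extension X r (L i)"
    "r = (\<Inter>i<order_dim X r. L i)" by blast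
  consider "order_dim X r = 1" | "order_dim X r = 2" using L(1) le2 by linarith
  then show "\<exists>L L'. linear_extension X r L \<and> linear_extension X r L' \<and> r = L \<inter> L'"
  proof cases
    case 1
    then show ?thesis using L by (intro exI[of _ "L 0"]) (auto simp: lessThan_Suc)
  next
    case 2
    have "{..<2} = {0, 1::nat}" by auto
    then have "r = L 0 \<inter> L 1" using L(3) unfolding 2 by simp
    moreover have "linear_extension X r (L 0)" "linear_extension X r (L 1)" using L(2) 2 by simp_all
    ultimately show ?thesis by blast
  qed
next
  assume "\<exists>L L'. linear_extension X r L \<and> linear_extension X r L' \<and> r = L \<inter> L'"
  then obtain L L' where L: "linear_extension X r L" "linear_extension X r L'" "r = L \<inter> L'"
    by blast
  define M where "M i = (if i = (0::nat) then L else L')" for i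
  have "{..<2} = {0, 1::nat}" by auto
  then have "r = (\<Inter>i<2. M i)" using L by (auto simp: M_def)
  moreover have "\<forall>i<2. linear_extension X r (M i)" using L by (auto simp: M_def)
  ultimately show "order_dim X r \<le> 2"
    unfolding order_dim_def by (intro Least_le) auto
qed

end

subsection \<open>Clusterings give dimension two\<close>

text \<open>Three distinct points that pairwise share a coordinate are collinear, so the pairwise
  condition does put each cluster into a single row or column. Intervals sharing an endpoint meet,
  hence a cluster is a clique of the incomparability graph.\<close>

definition clustering :: "(nat \<times> nat \<Rightarrow> nat) \<Rightarrow> (nat \<times> nat) set \<Rightarrow> bool" where
  "clustering \<kappa> F \<longleftrightarrow> (\<forall>p\<in>F. \<forall>q\<in>F.
     (\<kappa> p = \<kappa> q \<longrightarrow> fst p = fst q \<or> snd p = snd q) \<and>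
     (\<kappa> p + 2 \<le> \<kappa> q \<longrightarrow> snd p < fst q))"

lemma clustering_mono: "clustering \<kappa> F \<Longrightarrow> G \<subseteq> F \<Longrightarrow> clustering \<kappa> G"
  unfolding clustering_def by blast

context interval_poset
begin

lemma order_dim_le_2_of_clustering:
  assumes \<kappa>: "clustering \<kappa> ((\<lambda>x. (l x, u x)) ` X)"
  shows "order_dim X r \<le> 2"
proof -
  obtain h :: "'a \<Rightarrow> nat" where h: "inj_on h X"
    using fin finite_imp_inj_to_nat_seg by blast
  define K where "K x = \<kappa> (l x, u x)" for x
  define s where "s x = l x + u x" for x
  have K_eq: "K x = K y \<Longrightarrow> l x = l y \<or> u x = u y"
    and K_far: "K x + 2 \<le> K y \<Longrightarrow> u x < l y" if "x \<in> X" "y \<in> X" for x y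
    using \<kappa> that unfolding clustering_def K_def by auto
  define I where "I x y \<longleftrightarrow> x \<noteq> y \<and> l x \<le> u y \<and> l y \<le> u x" for x y
  \<comment> \<open>Along \<open>C\<close> the intervals shrink in even clusters (\<open>l\<close>
    grows on a row, \<open>u\<close> falls on a column) and grow in odd ones; copies of an interval
    are ordered by \<open>h\<close>. Edges between clusters run from even to odd, so in a
    composition across two clusters the smaller interval is always the middle one, and replacing it
    by the larger one cannot lose the intersection.\<close>
  define C where "C x y \<longleftrightarrow> (if l x = l y \<and> u x = u y then h x < h y
      else if even (K x) = (u x = u y) then s x < s y else s y < s x)" for x y
  define Q where "Q x y \<longleftrightarrow> I x y \<and> (if K x = K y then C x y else even (K x))" for x y
  have clique: "I x y" if "x \<in> X" "y \<in> X" "K x = K y" "x \<noteq> y" for x y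
    using K_eq[OF that(1,2,3)] le[OF that(1)] le[OF that(2)] that(4) by (auto simp: I_def)
  have near: "K x = Suc (K y) \<or> K y = Suc (K x)" if "x \<in> X" "y \<in> X" "K x \<noteq> K y" "I x y" for x y
    using K_far[of x y] K_far[of y x] that by (force simp: I_def)
  have hne: "h x \<noteq> h y" if "x \<in> X" "y \<in> X" "x \<noteq> y" for x y
    using h that by (auto simp: inj_on_def)
  have C_total: "C x y \<or> C y x" and C_asym: "\<not> (C x y \<and> C y x)"
    if "x \<in> X" "y \<in> X" "K x = K y" "x \<noteq> y" for x y
  proof -
    have "l x = l y \<or> u x = u y" using K_eq that by blast
    then consider "l x = l y" "u x = u y" | "l x = l y" "u x \<noteq> u y" | "l x \<noteq> l y" "u x = u y"
      by blast
    then show "C x y \<or> C y x" "\<not> (C x y \<and> C y x)"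
      using hne[OF that(1,2,4)] that(3) by (cases; simp add: C_def s_def; linarith)+
  qed
  have C_trans: "C x z" if X: "x \<in> X" "y \<in> X" "z \<in> X" and K: "K x = K y" "K y = K z"
    and C: "C x y" "C y z" for x y z
  proof -
    have xz: "l x = l z \<or> u x = u z" and xy: "l x = l y \<or> u x = u y" and yz: "l y = l z \<or> u y = u z"
      using K_eq X K by auto
    define e where "e = even (K x)"
    have "even (K y) = e" "even (K x) = e" using K by (auto simp: e_def)
    then show ?thesis using xy yz xz C unfolding C_def s_def by (cases e; simp split: if_splits)
  qed
  have C_even: "u x = u y \<and> l x \<le> l y \<or> l x = l y \<and> u y \<le> u x"
    if "x \<in> X" "y \<in> X" "K x = K y" "C x y" "even (K x)" for x y
    using K_eq[OF that(1-3)] that(4,5) by (simp add: C_def s_def split: if_splits)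
  have C_odd: "u x = u y \<and> l y \<le> l x \<or> l x = l y \<and> u x \<le> u y"
    if "x \<in> X" "y \<in> X" "K x = K y" "C x y" "odd (K x)" for x y
    using K_eq[OF that(1-3)] that(4,5) by (simp add: C_def s_def split: if_splits)
  have Q_total: "Q x y \<or> Q y x" and Q_asym: "\<not> (Q x y \<and> Q y x)"
    if "x \<in> X" "y \<in> X" "I x y" for x y
    using C_total[OF that(1,2)] C_asym[OF that(1,2)] near[OF that(1,2)] that(3)
    by (auto simp: Q_def I_def)
  have Q_trans: "Q x z" if X: "x \<in> X" "y \<in> X" "z \<in> X" and Q: "Q x y" "Q y z" for x y z
  proof (cases "K x = K y")
    case True
    show ?thesis
    proof (cases "K y = K z")
      case T2: True
      have "C x z" using C_trans[OF X True T2] Q True T2 by (auto simp: Q_def)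
      moreover have "x \<noteq> z" using Q_asym[OF X(1,2)] Q by (auto simp: Q_def)
      ultimately show ?thesis using clique[of x z] X True T2 by (auto simp: Q_def)
    next
      case F2: False
      then have ev: "even (K y)" "I y z" "C x y" "I x y" using Q True by (auto simp: Q_def)
      then have "I x z"
        using C_even[OF X(1,2) True] True F2 by (auto simp: I_def)
      then show ?thesis using ev True F2 by (auto simp: Q_def)
    qed
  next
    case False
    then have ev: "even (K x)" "I x y" using Q by (auto simp: Q_def)
    have "K x = Suc (K y) \<or> K y = Suc (K x)" using near[OF X(1,2) False ev(2)] .
    then have "odd (K y)" using ev by auto
    then have T2: "K y = K z" "C y z" "I y z" using Q by (auto simp: Q_def split: if_splits)
    have "x \<noteq> z" using T2(1) False by auto
    then have "I x z"
      using C_odd[OF X(2,3) T2(1,2) \<open>odd (K y)\<close>] ev(2) by (auto simp: I_def)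
    then show ?thesis using ev T2 False by (auto simp: Q_def)
  qed
  \<comment> \<open>Used for \<open>Q\<close> and for its converse; the two extensions disagree on
    every incomparable pair, so their intersection is \<open>r\<close>.\<close>
  have lin: "linear_extension X r {(x, y) \<in> X \<times> X. x = y \<or> u x < l y \<or> R x y}"
    if total: "\<And>x y. x \<in> X \<Longrightarrow> y \<in> X \<Longrightarrow> I x y \<Longrightarrow> R x y \<or> R y x"
      and asym: "\<And>x y. x \<in> X \<Longrightarrow> y \<in> X \<Longrightarrow> R x y \<Longrightarrow> \<not> R y x"
      and I: "\<And>x y. R x y \<Longrightarrow> I x y"
      and trans: "\<And>x y z. x \<in> X \<Longrightarrow> y \<in> X \<Longrightarrow> z \<in> X \<Longrightarrow> R x y \<Longrightarrow> R y z \<Longrightarrow> R x z" for R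
  proof -
    define L where "L x y \<longleftrightarrow> x = y \<or> u x < l y \<or> R x y" for x y
    have L_total: "L x y \<or> L y x" if "x \<in> X" "y \<in> X" for x y
      using total[OF that] by (force simp: L_def I_def)
    have L_asym: "x = y" if "x \<in> X" "y \<in> X" "L x y" "L y x" for x y
      using asym[OF that(1,2)] I[of x y] I[of y x] le[OF that(1)] le[OF that(2)] that(3,4)
      by (auto simp: L_def I_def)
    have L_trans: "L x z" if X: "x \<in> X" "y \<in> X" "z \<in> X" and L: "L x y" "L y z" for x y z
    proof (rule ccontr)
      \<comment> \<open>By totality a failure closes a cyclic triple. Each of its edges is an order
        relation or an \<open>R\<close> edge; transitivity and asymmetry of \<open>R\<close>
        together with the endpoint inequalities exclude every combination.\<close>
      assume n: "\<not> L x z"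
      then have zx: "L z x" and "x \<noteq> z" using L_total[OF X(1,3)] by (auto simp: L_def)
      moreover have "x \<noteq> y" "y \<noteq> z" using n L by auto
      ultimately have "u z < l x \<or> R z x" "u x < l y \<or> R x y" "u y < l z \<or> R y z"
        using L by (auto simp: L_def)
      moreover have "u x < l y \<Longrightarrow> \<not> (R y z \<and> R z x)" "u y < l z \<Longrightarrow> \<not> (R z x \<and> R x y)"
        "u z < l x \<Longrightarrow> \<not> (R x y \<and> R y z)"
        using I[OF trans[OF X(2,3,1)]] I[OF trans[OF X(3,1,2)]] I[OF trans[OF X(1,2,3)]]
        by (auto simp: I_def)
      moreover have "\<not> (R x y \<and> R y z \<and> R z x)"
        using trans[OF X] asym[OF X(1,3)] by blast
      moreover have "R x y \<Longrightarrow> l x \<le> u y" "R y z \<Longrightarrow> l y \<le> u z" "R z x \<Longrightarrow> l z \<le> u x"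
        "R x y \<Longrightarrow> l y \<le> u x" "R y z \<Longrightarrow> l z \<le> u y" "R z x \<Longrightarrow> l x \<le> u z"
        using I[of x y] I[of y z] I[of z x] by (auto simp: I_def)
      ultimately show False
        using le[OF X(1)] le[OF X(2)] le[OF X(3)] by linarith
    qed
    show ?thesis
      unfolding linear_extension_def linear_order_on_def partial_order_on_def preorder_on_def
        L_def[symmetric]
    proof (intro conjI)
      show "refl_on X {(x, y) \<in> X \<times> X. L x y}" by (auto simp: refl_on_def L_def)
      show "trans {(x, y) \<in> X \<times> X. L x y}" using L_trans by (auto simp: trans_def)
      show "antisym {(x, y) \<in> X \<times> X. L x y}" using L_asym by (auto simp: antisym_def)
      show "total_on X {(x, y) \<in> X \<times> X. L x y}" using L_total by (auto simp: total_on_def)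
      show "r \<subseteq> {(x, y) \<in> X \<times> X. L x y}" by (auto simp: r_eq L_def)
    qed auto
  qed
  have Q_I: "Q x y \<Longrightarrow> I x y" for x y by (simp add: Q_def)
  have Q_not: "Q x y \<Longrightarrow> Q y x \<Longrightarrow> x \<in> X \<Longrightarrow> y \<in> X \<Longrightarrow> False" for x y
    using Q_asym Q_I by blast
  have I_sym: "I x y \<Longrightarrow> I y x" for x y by (auto simp: I_def)
  have "linear_extension X r {(x, y) \<in> X \<times> X. x = y \<or> u x < l y \<or> Q x y}"
    by (rule lin) (use Q_total Q_asym Q_trans Q_I in blast)+
  moreover have "linear_extension X r {(x, y) \<in> X \<times> X. x = y \<or> u x < l y \<or> Q y x}"
    by (rule lin) (use Q_total Q_asym Q_trans Q_I I_sym in blast)+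
  moreover have "r = {(x, y) \<in> X \<times> X. x = y \<or> u x < l y \<or> Q x y} \<inter>
      {(x, y) \<in> X \<times> X. x = y \<or> u x < l y \<or> Q y x}"
    using Q_not by (auto simp: r_eq)
  ultimately show ?thesis unfolding order_dim_le_2_iff by blast
qed

end

section \<open>Obstructions to dimension two\<close>

definition meets :: "nat \<times> nat \<Rightarrow> nat \<times> nat \<Rightarrow> bool" where
  "meets p q \<longleftrightarrow> p \<noteq> q \<and> fst p \<le> snd q \<and> fst q \<le> snd p"

text \<open>A poset has dimension at most 2 iff its incomparability graph has a transitive orientation.
  Only the forcing rule for pairs of edges at \<open>p\<close> whose other ends are comparable is needed.\<close>

definition orientable :: "(nat \<times> nat) set \<Rightarrow> bool" where
  "orientable P \<longleftrightarrow> (\<exists>Q.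
     (\<forall>p\<in>P. \<forall>q\<in>P. meets p q \<longrightarrow> (Q p q \<longleftrightarrow> \<not> Q q p)) \<and>
     (\<forall>p\<in>P. \<forall>q\<in>P. \<forall>s\<in>P. meets p q \<and> meets p s \<and> snd q < fst s \<longrightarrow> (Q p q \<longleftrightarrow> Q p s)))"

lemma orientableE:
  assumes "orientable P"
  obtains Q where "\<And>p q. p \<in> P \<Longrightarrow> q \<in> P \<Longrightarrow> meets p q \<Longrightarrow> Q p q \<longleftrightarrow> \<not> Q q p"
    and "\<And>p q s. p \<in> P \<Longrightarrow> q \<in> P \<Longrightarrow> s \<in> P \<Longrightarrow> meets p q \<Longrightarrow> meets p s \<Longrightarrow> snd q < fst s \<Longrightarrow>
      Q p q \<longleftrightarrow> Q p s"
proof -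
  from assms obtain Q where Q: "\<forall>p\<in>P. \<forall>q\<in>P. meets p q \<longrightarrow> (Q p q \<longleftrightarrow> \<not> Q q p)"
     "\<forall>p\<in>P. \<forall>q\<in>P. \<forall>s\<in>P. meets p q \<and> meets p s \<and> snd q < fst s \<longrightarrow> (Q p q \<longleftrightarrow> Q p s)"
    unfolding orientable_def by (elim exE conjE)
  show thesis using Q by (intro that[of Q]) blast+
qed

text \<open>Two extensions realizing \<open>r\<close> list incomparable elements in opposite orders,
  and the first of them serves as the orientation. Its transitivity gives one direction of the
  forcing rule, transitivity of the second extension gives the other.\<close>

lemma (in interval_poset) orientable_of_order_dim_le_2:
  assumes "order_dim X r \<le> 2"
  shows "orientable ((\<lambda>x. (l x, u x)) ` X)"
proof -
  let ?P = "(\<lambda>x. (l x, u x)) ` X"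
  obtain L L' where L: "linear_extension X r L" "linear_extension X r L'" "r = L \<inter> L'"
    using assms unfolding order_dim_le_2_iff by blast
  have lin: "total_on X M" "refl_on X M" "trans M" "antisym M" if "linear_extension X r M" for M
    using that
    unfolding linear_extension_def linear_order_on_def partial_order_on_def preorder_on_def
    by simp_all
  have total: "(x, y) \<in> L \<or> (y, x) \<in> L" "(x, y) \<in> L' \<or> (y, x) \<in> L'" if "x \<in> X" "y \<in> X" for x y
    using lin(1,2)[OF L(1)] lin(1,2)[OF L(2)] that unfolding total_on_def refl_on_def
    by (cases "x = y"; simp)+
  note trans = transD[OF lin(3)[OF L(1)]] transD[OF lin(3)[OF L(2)]]
  note antisym = antisymD[OF lin(4)[OF L(1)]] antisymD[OF lin(4)[OF L(2)]]
  have below: "(x, y) \<in> L" "(x, y) \<in> L'" if "x \<in> X" "y \<in> X" "u x < l y" for x y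
  proof -
    have "(x, y) \<in> r" using that by (simp add: r_eq)
    then show "(x, y) \<in> L" "(x, y) \<in> L'" using L(3) by blast+
  qed
  have incomp: "(x, y) \<in> L \<longleftrightarrow> (y, x) \<in> L'" if "x \<in> X" "y \<in> X" "x \<noteq> y" "l x \<le> u y" "l y \<le> u x" for x y
  proof -
    have "(x, y) \<notin> r" "(y, x) \<notin> r" using that by (auto simp: r_eq)
    then show ?thesis using total[OF that(1,2)] antisym L(3) that(3) by blast
  qed
  have ex: "\<exists>x. x \<in> X \<and> (l x, u x) = p" if "p \<in> ?P" for p using that by auto
  \<comment> \<open>Copies of an interval collapse to one point of the path, so each point gets a
    representative.\<close>
  define f where "f p = (SOME x. x \<in> X \<and> (l x, u x) = p)" for p
  have f: "f p \<in> X" "(l (f p), u (f p)) = p" if "p \<in> ?P" for p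
    using someI_ex[OF ex[OF that]] unfolding f_def by auto
  have f_inc: "(f p, f q) \<in> L \<longleftrightarrow> (f q, f p) \<in> L'" "f p \<noteq> f q" if "p \<in> ?P" "q \<in> ?P" "meets p q" for p q
  proof -
    have e: "l (f p) = fst p" "u (f p) = snd p" "l (f q) = fst q" "u (f q) = snd q"
      using f(2)[OF that(1)] f(2)[OF that(2)] by (metis fst_conv snd_conv)+
    then show "f p \<noteq> f q" using that(3) by (auto simp: meets_def prod_eq_iff)
    then show "(f p, f q) \<in> L \<longleftrightarrow> (f q, f p) \<in> L'"
      using incomp[OF f(1)[OF that(1)] f(1)[OF that(2)]] e that(3) by (auto simp: meets_def)
  qed
  have f_below: "(f p, f q) \<in> L" "(f p, f q) \<in> L'" if "p \<in> ?P" "q \<in> ?P" "snd p < fst q" for p q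
  proof -
    have "u (f p) < l (f q)"
      using f(2)[OF that(1)] f(2)[OF that(2)] that(3) by (metis fst_conv snd_conv)
    then show "(f p, f q) \<in> L" "(f p, f q) \<in> L'" using below f(1) that(1,2) by blast+
  qed
  show ?thesis
    unfolding orientable_def
  proof (intro exI[of _ "\<lambda>p q. (f p, f q) \<in> L"] conjI ballI impI)
    fix p q assume pq: "p \<in> ?P" "q \<in> ?P" "meets p q"
    show "((f p, f q) \<in> L) = ((f q, f p) \<notin> L)"
      using f_inc(2)[OF pq] antisym(1) total(1) f(1) pq by metis
  next
    fix p q s assume pqs: "p \<in> ?P" "q \<in> ?P" "s \<in> ?P" and m: "meets p q \<and> meets p s \<and> snd q < fst s"
    have m': "meets q p" "meets s p" using m by (auto simp: meets_def)
    have qs: "(f q, f s) \<in> L" "(f q, f s) \<in> L'" using f_below[OF pqs(2,3)] m by auto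
    show "((f p, f q) \<in> L) = ((f p, f s) \<in> L)"
    proof
      assume "(f p, f q) \<in> L" then show "(f p, f s) \<in> L" using trans(1) qs(1) by blast
    next
      assume "(f p, f s) \<in> L"
      then have "(f s, f p) \<in> L'" using f_inc(1) pqs m by blast
      then have "(f q, f p) \<in> L'" using trans(2) qs(2) by blast
      then show "(f p, f q) \<in> L" using f_inc(1) pqs m by blast
    qed
  qed
qed

text \<open>The minimal endpoint representations of semiorders are lattice paths from \<open>(0, 0)\<close> to
  \<open>(m, m)\<close> with steps \<open>(1, 0)\<close>, \<open>(0, 1)\<close>, \<open>(1, 1)\<close>: the points are a chain in the product
  order, and both coordinates take all values up to \<open>m\<close>.\<close>

definition full :: "(nat \<times> nat) set \<Rightarrow> nat \<Rightarrow> bool" where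
  "full P m \<longleftrightarrow> (\<forall>p\<in>P. fst p \<le> snd p) \<and> fst ` P = {..m} \<and> snd ` P = {..m}"

definition chain :: "(nat \<times> nat) set \<Rightarrow> bool" where
  "chain P \<longleftrightarrow> (\<forall>p\<in>P. \<forall>q\<in>P. fst p < fst q \<longrightarrow> snd p \<le> snd q)"

lemma fullD:
  assumes "full P m" "(a, b) \<in> P"
  shows "a \<le> b" "b \<le> m"
  using assms unfolding full_def by force+

lemma full_column:
  assumes "full P m" "a \<le> m"
  shows "\<exists>b. (a, b) \<in> P \<and> a \<le> b \<and> b \<le> m"
proof -
  have "a \<in> fst ` P" using assms by (simp add: full_def)
  then show ?thesis using fullD[OF assms(1)] by force
qed

lemma full_row:
  assumes "full P m" "b \<le> m"
  shows "\<exists>a. (a, b) \<in> P \<and> a \<le> b"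
proof -
  have "b \<in> snd ` P" using assms by (simp add: full_def)
  then show ?thesis using fullD[OF assms(1)] by force
qed

lemma chainD:
  assumes "chain P" "(a, b) \<in> P" "(a', b') \<in> P" "a < a'"
  shows "b \<le> b'"
  using assms unfolding chain_def by force

text \<open>The pattern whose absence characterizes hereditary semiorders: the path leaves column \<open>a\<close>
  above height 1 other than by a step \<open>(1, 0)\<close>, although row \<open>a + 1\<close> starts before column \<open>a\<close>.\<close>

definition bad :: "(nat \<times> nat) set \<Rightarrow> bool" where
  "bad P \<longleftrightarrow> (\<exists>c a b. c < a \<and> a + 2 \<le> b \<and> (c, a + 1) \<in> P \<and> (a, b) \<in> P \<and>
     (\<forall>d. (a + 1, d) \<in> P \<longrightarrow> b < d))"

section \<open>Odd cycles of sources and sinks on lattice paths\<close>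

text \<open>\<open>?x\<close>, \<open>?y\<close>, \<open>?z\<close> meet pairwise and each is a
  source or a sink for the other two: at \<open>?x\<close> because \<open>?v\<close> lies below both
  others, at \<open>?z\<close> because \<open>?s\<close> lies above both, at \<open>?y\<close>
  through the comparabilities linking \<open>?z\<close>, \<open>?w\<close>, \<open>?t\<close>,
  \<open>?x\<close> in turn. Two of the three are then of the same kind although adjacent.\<close>

lemma bad_not_orientable:
  assumes P: "full P m" "chain P" and bad: "bad P"
  shows "\<not> orientable P"
proof (rule notI, erule orientableE)
  fix Q assume flip: "\<And>p q. p \<in> P \<Longrightarrow> q \<in> P \<Longrightarrow> meets p q \<Longrightarrow> Q p q \<longleftrightarrow> \<not> Q q p"
    and force: "\<And>p q s. p \<in> P \<Longrightarrow> q \<in> P \<Longrightarrow> s \<in> P \<Longrightarrow> meets p q \<Longrightarrow> meets p s \<Longrightarrow> snd q < fst s \<Longrightarrow>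
      Q p q \<longleftrightarrow> Q p s"
  obtain c a b where x: "c < a" "a + 2 \<le> b" "(c, a + 1) \<in> P" "(a, b) \<in> P"
    and d: "\<And>d. (a + 1, d) \<in> P \<Longrightarrow> b < d"
    using bad unfolding bad_def by blast
  have "b \<le> m" using fullD P x(4) by blast
  then have am: "a - 1 \<le> m" "a \<le> m" "a + 1 \<le> m" "a + 2 \<le> m" using x(2) by auto
  then obtain d where z: "(a + 1, d) \<in> P" "d \<le> m" using full_column[OF P(1) am(3)] by blast
  have "b < d" using d z by blast
  obtain v where v: "(v, a - 1) \<in> P" "v \<le> a - 1"
    using full_row[OF P(1) am(1)] by blast
  obtain w where w: "(w, a) \<in> P" using full_row[OF P(1) am(2)] by blast
  have "w \<le> c" using chainD[OF P(2) x(3) w] by (cases "c < w") auto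
  obtain t where t: "(a + 2, t) \<in> P" "a + 2 \<le> t"
    using full_column[OF P(1) am(4)] by blast
  have "d \<le> t" using chainD[OF P(2) z(1) t(1)] by simp
  obtain s where s: "(b + 1, s) \<in> P" "b + 1 \<le> s"
    using full_column[OF P(1), of "b + 1"] \<open>b < d\<close> z(2) by auto
  let ?v = "(v, a - 1)" let ?w = "(w, a)" let ?x = "(c, a + 1)" let ?y = "(a, b)"
  let ?z = "(a + 1, d)" let ?t = "(a + 2, t)" let ?s = "(b + 1, s)"
  note ins = v(1) w x(3,4) z(1) t(1) s(1)
  have m: "meets ?x ?v" "meets ?x ?y" "meets ?x ?z" "meets ?y ?x" "meets ?z ?x" "meets ?z ?y"
    "meets ?z ?s" "meets ?y ?w" "meets ?y ?z" "meets ?y ?t"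
    using x v \<open>w \<le> c\<close> \<open>d \<le> t\<close> \<open>b < d\<close> s(2) by (auto simp: meets_def)
  have "Q ?x ?v = Q ?x ?y" "Q ?x ?v = Q ?x ?z"
    by (rule force; use ins m x in simp)+
  moreover have "Q ?z ?x = Q ?z ?s" "Q ?z ?y = Q ?z ?s"
    by (rule force; use ins m x in simp)+
  moreover have "Q ?y ?w = Q ?y ?z" "Q ?y ?w = Q ?y ?t" "Q ?y ?x = Q ?y ?t"
    by (rule force; use ins m x in simp)+
  moreover have "Q ?x ?z = (\<not> Q ?z ?x)" "Q ?x ?y = (\<not> Q ?y ?x)" "Q ?y ?z = (\<not> Q ?z ?y)"
    by (rule flip; use ins m in simp)+
  ultimately show False by blast
qed

text \<open>The odd cycle is \<open>?x\<close>, \<open>?z\<close>, \<open>?w\<close>,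
  \<open>?y\<close>, \<open>?s\<close>. The low point \<open>?v\<close> compares the two neighbours
  of \<open>?x\<close> and of \<open>?w\<close>, the high point \<open>?t\<close> those of
  \<open>?z\<close> and of \<open>?s\<close>, and the neighbours of \<open>?y\<close> are comparable
  themselves. The three given points surround a weak boundary with optional element at
  \<open>a + 2\<close>.\<close>

lemma valley_not_orientable:
  assumes P: "full P m" "chain P"
    and x: "(a, a + 2) \<in> P" and y: "(a + 1, a + 2) \<in> P" and z: "(a + 1, a + 3) \<in> P"
  shows "\<not> orientable P"
proof (rule notI, erule orientableE)
  fix Q assume flip: "\<And>p q. p \<in> P \<Longrightarrow> q \<in> P \<Longrightarrow> meets p q \<Longrightarrow> Q p q \<longleftrightarrow> \<not> Q q p"
    and force: "\<And>p q s. p \<in> P \<Longrightarrow> q \<in> P \<Longrightarrow> s \<in> P \<Longrightarrow> meets p q \<Longrightarrow> meets p s \<Longrightarrow> snd q < fst s \<Longrightarrow>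
      Q p q \<longleftrightarrow> Q p s"
  have "a + 3 \<le> m" using fullD P z by blast
  obtain v where v: "(v, a) \<in> P" "v \<le> a"
    using full_row[OF P(1), of a] \<open>a + 3 \<le> m\<close> by auto
  obtain w where w: "(w, a + 1) \<in> P" using full_row[OF P(1), of "a + 1"] \<open>a + 3 \<le> m\<close> by auto
  have "w \<le> a" using chainD[OF P(2) x w] by (cases "a < w") auto
  obtain s where s: "(a + 2, s) \<in> P" using full_column[OF P(1), of "a + 2"] \<open>a + 3 \<le> m\<close> by auto
  have "a + 3 \<le> s" using chainD[OF P(2) z s] by simp
  obtain t where t: "(a + 3, t) \<in> P" "a + 3 \<le> t" using full_column[OF P(1), of "a + 3"] \<open>a + 3 \<le> m\<close> by auto
  let ?v = "(v, a)" let ?w = "(w, a + 1)" let ?x = "(a, a + 2)" let ?y = "(a + 1, a + 2)"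
  let ?z = "(a + 1, a + 3)" let ?t = "(a + 3, t)" let ?s = "(a + 2, s)"
  note ins = v(1) w x y z t(1) s
  have m: "meets ?x ?v" "meets ?x ?z" "meets ?x ?s" "meets ?z ?x" "meets ?z ?w" "meets ?z ?t"
    "meets ?w ?v" "meets ?w ?y" "meets ?w ?z" "meets ?y ?w" "meets ?y ?s"
    "meets ?s ?x" "meets ?s ?y" "meets ?s ?t"
    using v(2) \<open>w \<le> a\<close> \<open>a + 3 \<le> s\<close> t(2) by (auto simp: meets_def)
  have "Q ?x ?v = Q ?x ?z" "Q ?x ?v = Q ?x ?s"
    by (rule force; use ins m in simp)+
  moreover have "Q ?z ?x = Q ?z ?t" "Q ?z ?w = Q ?z ?t"
    by (rule force; use ins m in simp)+
  moreover have "Q ?w ?v = Q ?w ?z" "Q ?w ?v = Q ?w ?y" "Q ?y ?w = Q ?y ?s"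
    by (rule force; use ins m in simp)+
  moreover have "Q ?s ?x = Q ?s ?t" "Q ?s ?y = Q ?s ?t"
    by (rule force; use ins m in simp)+
  moreover have "Q ?x ?z = (\<not> Q ?z ?x)" "Q ?w ?z = (\<not> Q ?z ?w)" "Q ?w ?y = (\<not> Q ?y ?w)"
    "Q ?y ?s = (\<not> Q ?s ?y)" "Q ?x ?s = (\<not> Q ?s ?x)"
    by (rule flip; use ins m in simp)+
  ultimately show False by blast
qed

text \<open>The odd cycle is \<open>?p\<close>, \<open>?q\<close>, \<open>?t\<close>,
  \<open>?d\<close>, \<open>?c\<close>. Here \<open>?q\<close> is the top of a block of type
  \<open>C\<close> starting at \<open>Suc b\<close>, \<open>?c\<close> and \<open>?d\<close> are its
  neighbours on the column and on the row, and \<open>?p\<close> and \<open>?t\<close> come from the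
  adjacent blocks. Only \<open>?p\<close> and \<open>?t\<close> need help from outside the cycle, by
  \<open>?v\<close> and \<open>?s\<close>.\<close>

lemma inner_C_not_orientable:
  assumes P: "full P m"
    and p: "(b, Suc b) \<in> P" and c: "(Suc b, b + k) \<in> P" and q: "(Suc b, Suc b + k) \<in> P"
    and d: "(b + 2, Suc b + k) \<in> P" and t: "(Suc b + k, b + k + 2) \<in> P" and k: "2 \<le> k"
  shows "\<not> orientable P"
proof (rule notI, erule orientableE)
  fix Q assume flip: "\<And>p q. p \<in> P \<Longrightarrow> q \<in> P \<Longrightarrow> meets p q \<Longrightarrow> Q p q \<longleftrightarrow> \<not> Q q p"
    and force: "\<And>p q s. p \<in> P \<Longrightarrow> q \<in> P \<Longrightarrow> s \<in> P \<Longrightarrow> meets p q \<Longrightarrow> meets p s \<Longrightarrow> snd q < fst s \<Longrightarrow>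
      Q p q \<longleftrightarrow> Q p s"
  have "b + k + 2 \<le> m" using fullD P t by blast
  obtain v where v: "(v, b) \<in> P" "v \<le> b"
    using full_row[OF P(1), of b] \<open>b + k + 2 \<le> m\<close> by auto
  obtain s where s: "(b + k + 2, s) \<in> P" "b + k + 2 \<le> s"
    using full_column[OF P(1), of "b + k + 2"] \<open>b + k + 2 \<le> m\<close> by auto
  let ?v = "(v, b)" let ?p = "(b, Suc b)" let ?c = "(Suc b, b + k)" let ?q = "(Suc b, Suc b + k)"
  let ?d = "(b + 2, Suc b + k)" let ?t = "(Suc b + k, b + k + 2)" let ?s = "(b + k + 2, s)"
  note ins = v(1) p c q d t s(1)
  have m: "meets ?p ?v" "meets ?p ?c" "meets ?p ?q" "meets ?q ?p" "meets ?q ?t" "meets ?t ?q"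
    "meets ?t ?s" "meets ?t ?d" "meets ?c ?p" "meets ?c ?d" "meets ?d ?c" "meets ?d ?t"
    using v(2) k s(2) by (auto simp: meets_def)
  have "Q ?p ?v = Q ?p ?c" "Q ?p ?v = Q ?p ?q"
    by (rule force; use ins m in simp)+
  moreover have "Q ?q ?p = Q ?q ?t"
    by (rule force; use ins m k in simp)
  moreover have "Q ?t ?q = Q ?t ?s" "Q ?t ?d = Q ?t ?s"
    by (rule force; use ins m in simp)+
  moreover have "Q ?c ?p = Q ?c ?d" "Q ?d ?c = Q ?d ?t"
    by (rule force; use ins m in simp)+
  moreover have "Q ?p ?q = (\<not> Q ?q ?p)" "Q ?p ?c = (\<not> Q ?c ?p)" "Q ?c ?d = (\<not> Q ?d ?c)"
    "Q ?t ?d = (\<not> Q ?d ?t)" "Q ?q ?t = (\<not> Q ?t ?q)"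
    by (rule flip; use ins m in simp)+
  ultimately show False by blast
qed

section \<open>Minimal endpoint representations\<close>

lemma chain_index:
  fixes C :: "'b set set"
  assumes fin: "finite C" and chain: "\<And>A B. A \<in> C \<Longrightarrow> B \<in> C \<Longrightarrow> A \<subseteq> B \<or> B \<subseteq> A"
  defines "idx \<equiv> \<lambda>A. card {D \<in> C. D \<subset> A}"
  shows "A \<in> C \<Longrightarrow> B \<in> C \<Longrightarrow> idx A < idx B \<longleftrightarrow> A \<subset> B"
    and "idx ` C = {..<card C}"
proof -
  have mono: "idx A < idx B" if "A \<in> C" "A \<subset> B" for A B
    unfolding idx_def by (rule psubset_card_mono) (use fin that in auto)
  show less: "idx A < idx B \<longleftrightarrow> A \<subset> B" if AB: "A \<in> C" "B \<in> C" for A B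
  proof
    assume lt: "idx A < idx B"
    have "\<not> B \<subseteq> A"
    proof
      assume "B \<subseteq> A"
      then have "idx B \<le> idx A"
        unfolding idx_def by (intro card_mono) (use fin in auto)
      then show False using lt by simp
    qed
    then show "A \<subset> B" using chain[OF AB] by blast
  qed (use mono AB in blast)
  have "inj_on idx C"
    by (rule inj_onI) (metis chain less less_irrefl psubsetI)
  then have "card (idx ` C) = card {..<card C}" by (simp add: card_image)
  moreover have "idx ` C \<subseteq> {..<card C}"
    unfolding idx_def using fin by (auto intro!: psubset_card_mono)
  ultimately show "idx ` C = {..<card C}" by (intro card_subset_eq) auto
qed

text \<open>\<open>E z\<close>, the largest down set without \<open>z\<close>, links the two chains:
  \<open>z\<close> is below \<open>w\<close> iff \<open>E z\<close> is strictly inside the down set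
  of \<open>w\<close>, so the up set of \<open>z\<close> is the image of \<open>E z\<close> under
  the order-reversing injection \<open>V\<close>. As \<open>E\<close> is onto the down sets, both
  chains have the same length, and the right endpoint of \<open>z\<close> is the rank of
  \<open>E z\<close>.\<close>

lemma
  assumes fin: "finite X" and rep: "interval_representation X r lo hi"
  shows strictly_below_iff_endpoints: "x \<in> X \<Longrightarrow> y \<in> X \<Longrightarrow>
      strictly_below r x y \<longleftrightarrow> right_endpoint X r x < left_endpoint X r y"
    and left_endpoint_le_right: "x \<in> X \<Longrightarrow> left_endpoint X r x \<le> right_endpoint X r x"
    and left_endpoints: "left_endpoint X r ` X = {..<card (down_set X r ` X)}"
    and right_endpoints: "right_endpoint X r ` X = {..<card (down_set X r ` X)}"
proof -
  let ?D = "down_set X r" and ?U = "up_set X r"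
  define S where "S = ?D ` X"
  have sb: "strictly_below r x y \<longleftrightarrow> hi x < lo y" if "x \<in> X" "y \<in> X" for x y
    using rep that by (simp add: interval_representation_def)
  have lohi: "lo x \<le> hi x" if "x \<in> X" for x
    using rep that by (simp add: interval_representation_def)
  have mem_D: "y \<in> ?D x \<longleftrightarrow> y \<in> X \<and> hi y < lo x" if "x \<in> X" for x y
    using sb that by (auto simp: down_set_def)
  have D_mono: "?D x \<subseteq> ?D y" if "x \<in> X" "y \<in> X" "lo x \<le> lo y" for x y
    using that mem_D by fastforce
  have finS: "finite S" using fin by (simp add: S_def)
  have chainS: "A \<subseteq> B \<or> B \<subseteq> A" if "A \<in> S" "B \<in> S" for A B
  proof -
    obtain x y where "x \<in> X" "A = ?D x" "y \<in> X" "B = ?D y"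
      using \<open>A \<in> S\<close> \<open>B \<in> S\<close> by (auto simp: S_def)
    then show ?thesis using D_mono by (cases "lo x \<le> lo y") auto
  qed
  define V where "V A = {w \<in> X. A \<subset> ?D w}" for A
  have V_less: "V B \<subset> V A \<longleftrightarrow> A \<subset> B" if AB: "A \<in> S" "B \<in> S" for A B
  proof -
    have *: "V B' \<subset> V A'" if "A' \<in> S" "B' \<in> S" "A' \<subset> B'" for A' B'
    proof -
      obtain y where "y \<in> X" "B' = ?D y" using \<open>B' \<in> S\<close> by (auto simp: S_def)
      then have "y \<in> V A'" "y \<notin> V B'" using that by (auto simp: V_def)
      then show ?thesis using that by (auto simp: V_def)
    qed
    show ?thesis using *[OF AB] *[OF AB(2,1)] chainS[OF AB] by blast
  qed
  have V_inj: "inj_on V S"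
    by (rule inj_onI) (metis V_less chainS psubsetI less_irrefl)
  define E where "E z = \<Union>{A \<in> S. z \<notin> A}" for z
  have E_mem: "E z \<in> S" "z \<notin> E z" "?D z \<subseteq> E z" if z: "z \<in> X" for z
  proof -
    have Dz: "?D z \<in> {A \<in> S. z \<notin> A}" using z lohi[OF z] mem_D[OF z] by (auto simp: S_def)
    then show "?D z \<subseteq> E z" "z \<notin> E z" by (auto simp: E_def)
    have "E z \<in> {A \<in> S. z \<notin> A}"
      unfolding E_def
    proof (rule finite_Sup_in)
      show "finite {A \<in> S. z \<notin> A}" using finS by simp
      show "{A \<in> S. z \<notin> A} \<noteq> {}" using Dz by blast
      fix A B assume AB: "A \<in> {A \<in> S. z \<notin> A}" "B \<in> {A \<in> S. z \<notin> A}"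
      then have "A \<union> B = A \<or> A \<union> B = B" using chainS[of A B] by (auto simp: Un_absorb1 Un_absorb2)
      then show "A \<union> B \<in> {A \<in> S. z \<notin> A}" using AB by metis
    qed
    then show "E z \<in> S" by simp
  qed
  have E_max: "A \<subseteq> E z" if "A \<in> S" "z \<notin> A" for A z
    using that by (auto simp: E_def)
  have less_iff: "strictly_below r z w \<longleftrightarrow> E z \<subset> ?D w" if X: "z \<in> X" "w \<in> X" for z w
  proof -
    have Dw: "?D w \<in> S" using X by (simp add: S_def)
    have "strictly_below r z w \<longleftrightarrow> z \<in> ?D w" using X by (auto simp: down_set_def)
    also have "\<dots> \<longleftrightarrow> E z \<subset> ?D w"
      using E_mem[OF X(1)] E_max[OF Dw] chainS[OF Dw E_mem(1)[OF X(1)]] by blast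
    finally show ?thesis .
  qed
  have U_eq: "?U z = V (E z)" if "z \<in> X" for z
    using less_iff[OF that] by (auto simp: up_set_def V_def)
  have E_image: "E ` X = S"
  proof
    show "E ` X \<subseteq> S" using E_mem by auto
    show "S \<subseteq> E ` X"
    proof
      fix A assume A: "A \<in> S"
      then obtain y where y: "y \<in> X" "A = ?D y" by (auto simp: S_def)
      \<comment> \<open>For \<open>E z = A\<close> the element \<open>z\<close> has to avoid
        \<open>A\<close> but belong to every larger down set. Unless \<open>A\<close> is the largest
        one, it is found in the next larger down set, that of a \<open>w0\<close> with least
        \<open>lo\<close>.\<close>
      have "\<exists>z\<in>X. z \<notin> A \<and> (\<forall>w\<in>X. A \<subset> ?D w \<longrightarrow> z \<in> ?D w)"
      proof (cases "V A = {}")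
        case True
        have "y \<notin> A" using y lohi[OF y(1)] mem_D[OF y(1)] by auto
        then show ?thesis using True y(1) by (auto simp: V_def)
      next
        case False
        define w0 where "w0 = arg_min_on lo (V A)"
        have finV: "finite (V A)" using fin by (simp add: V_def)
        have w0: "w0 \<in> V A" "\<And>w. w \<in> V A \<Longrightarrow> lo w0 \<le> lo w"
          using arg_min_if_finite[OF finV False, of lo] by (auto simp: w0_def not_less[symmetric])
        then obtain z where z: "z \<in> ?D w0" "z \<notin> A" by (auto simp: V_def)
        have "z \<in> ?D w" if "w \<in> X" "A \<subset> ?D w" for w
          using w0(2)[of w] D_mono[of w0 w] w0(1) z(1) that by (auto simp: V_def)
        then show ?thesis using z by (auto simp: down_set_def)
      qed
      then obtain z where z: "z \<in> X" "z \<notin> A" "\<And>w. w \<in> X \<Longrightarrow> A \<subset> ?D w \<Longrightarrow> z \<in> ?D w" by blast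
      have "E z \<subseteq> A"
      proof (rule ccontr)
        assume "\<not> E z \<subseteq> A"
        then have "A \<subset> E z" using chainS[OF A E_mem(1)[OF z(1)]] by blast
        moreover obtain w where "w \<in> X" "E z = ?D w" using E_mem(1)[OF z(1)] by (auto simp: S_def)
        ultimately show False using z(3)[of w] E_mem(2)[OF z(1)] by simp
      qed
      then show "A \<in> E ` X" using E_max[OF A z(2)] z(1) by blast
    qed
  qed
  define idx where "idx A = card {D \<in> S. D \<subset> A}" for A
  have idx_less: "idx A < idx B \<longleftrightarrow> A \<subset> B" if "A \<in> S" "B \<in> S" for A B
    unfolding idx_def by (rule chain_index(1)) (use finS chainS that in simp_all)
  have idx_image: "idx ` S = {..<card S}"
    unfolding idx_def by (rule chain_index(2)) (use finS chainS in simp_all)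
  have left: "left_endpoint X r x = idx (?D x)" for x
    by (simp add: left_endpoint_def idx_def S_def)
  have right: "right_endpoint X r x = idx (E x)" if "x \<in> X" for x
  proof -
    have "?U ` X = V ` S" using U_eq E_image by (metis (no_types, lifting) image_cong image_image)
    then have "{U \<in> ?U ` X. ?U x \<subset> U} = V ` {A \<in> S. V (E x) \<subset> V A}"
      by (simp only: U_eq[OF that] Compr_image_eq)
    also have "{A \<in> S. V (E x) \<subset> V A} = {A \<in> S. A \<subset> E x}"
      using V_less E_mem(1)[OF that] by (intro Collect_cong conj_cong) auto
    finally have "{U \<in> ?U ` X. ?U x \<subset> U} = V ` {A \<in> S. A \<subset> E x}" .
    then show ?thesis
      unfolding right_endpoint_def idx_def
      by (metis (no_types, lifting) V_inj card_image inj_on_subset mem_Collect_eq subsetI)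
  qed
  show "strictly_below r x y \<longleftrightarrow> right_endpoint X r x < left_endpoint X r y"
    if "x \<in> X" "y \<in> X" for x y
    using less_iff[OF that] idx_less[OF E_mem(1)[OF that(1)], of "?D y"] that
    by (simp add: left right S_def)
  show "left_endpoint X r x \<le> right_endpoint X r x" if "x \<in> X" for x
    using idx_less[OF E_mem(1)[OF that], of "?D x"] E_mem(3)[OF that] that
    by (simp add: left right S_def not_less[symmetric] psubset_eq)
  show "left_endpoint X r ` X = {..<card (?D ` X)}"
    using idx_image by (simp add: left[abs_def] S_def image_image)
  show "right_endpoint X r ` X = {..<card (?D ` X)}"
    using idx_image E_image right S_def by (metis (no_types, lifting) image_cong image_image)
qed

lemma (in interval_poset) strictly_below_iff:
  assumes "x \<in> X" "y \<in> X"
  shows "strictly_below r x y \<longleftrightarrow> u x < l y"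
  using assms le by (force simp: strictly_below_def r_eq)

section \<open>Semiorders and chains of intervals\<close>

text \<open>Fullness provides \<open>w\<close> ending just before \<open>y\<close> starts and
  \<open>v\<close> starting just after \<open>y\<close> ends. If \<open>y\<close> were strictly
  inside \<open>x\<close>, then \<open>x\<close> would be incomparable to the whole chain
  \<open>w\<close>, \<open>y\<close>, \<open>v\<close>, and any real interval for \<open>x\<close>
  would be longer than the one for \<open>y\<close>.\<close>

lemma (in interval_poset) chain_of_semiorder:
  assumes full: "full ((\<lambda>x. (l x, u x)) ` X) m" and semi: "semiorder_on X r"
  shows "chain ((\<lambda>x. (l x, u x)) ` X)"
proof -
  obtain lo hi c where rep: "interval_representation X r lo hi" and c: "\<And>x. x \<in> X \<Longrightarrow> hi x - lo x = c"
    using semi unfolding semiorder_on_def by blast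
  have sb: "u x < l y \<longleftrightarrow> hi x < lo y" if "x \<in> X" "y \<in> X" for x y
    using rep that strictly_below_iff by (simp add: interval_representation_def)
  have "u x \<le> u y" if X: "x \<in> X" "y \<in> X" and lt: "l x < l y" for x y
  proof (rule ccontr)
    assume "\<not> u x \<le> u y"
    then have gt: "u y < u x" by simp
    have m: "l y - 1 \<le> m" "u y + 1 \<le> m" using fullD[OF full, of "l x" "u x"]
        fullD[OF full, of "l y" "u y"] X gt by auto
    obtain w where w: "w \<in> X" "u w = l y - 1" using full_row[OF full m(1)] by auto
    obtain v where v: "v \<in> X" "l v = u y + 1" using full_column[OF full m(2)] by auto
    have "hi w < lo y" "\<not> hi w < lo x" "hi y < lo v" "\<not> hi x < lo v"
      using sb[OF w(1) X(2)] sb[OF w(1) X(1)] sb[OF X(2) v(1)] sb[OF X(1) v(1)] w v lt gt by auto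
    then show False using c[OF X(1)] c[OF X(2)] by linarith
  qed
  then show ?thesis by (auto simp: chain_def)
qed

lemma finite_sets_separate:
  fixes A B :: "real set"
  assumes "finite A" "finite B" "\<And>a b. a \<in> A \<Longrightarrow> b \<in> B \<Longrightarrow> a < b"
  obtains v where "\<And>a. a \<in> A \<Longrightarrow> a < v" "\<And>b. b \<in> B \<Longrightarrow> v < b"
proof (cases "A = {} \<or> B = {}")
  case True
  then show thesis
  proof
    assume "A = {}"
    obtain x where "\<And>b. b \<in> B \<Longrightarrow> x < b" using assms(2)
      by (metis Min_gr_iff finite.emptyI lt_ex ex_in_conv)
    then show thesis using that[of x] \<open>A = {}\<close> by blast
  next
    assume "B = {}"
    obtain x where "\<And>a. a \<in> A \<Longrightarrow> a < x" using assms(1)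
      by (metis Max_less_iff finite.emptyI gt_ex ex_in_conv)
    then show thesis using that[of x] \<open>B = {}\<close> by blast
  qed
next
  case False
  then have "Max A < Min B" using assms by simp
  then obtain v where "Max A < v" "v < Min B" using dense by blast
  then show thesis using that[of v] assms(1,2) False by simp
qed

text \<open>Scott--Suppes: the points are placed on the line in increasing order, each one strictly
  between the forced lower and upper bounds.\<close>

lemma chain_unit_placement:
  assumes "finite P" "chain P" "\<And>p. p \<in> P \<Longrightarrow> fst p \<le> snd p"
  shows "\<exists>g :: nat \<times> nat \<Rightarrow> real. \<forall>p\<in>P. \<forall>q\<in>P.
    (snd p < fst q \<longleftrightarrow> g p + 1 < g q) \<and> g q \<noteq> g p + 1 \<and> (fst p + snd p < fst q + snd q \<longrightarrow> g p < g q)"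
  using assms
proof (induction P rule: finite_ranking_induct[where f = "\<lambda>p. fst p + snd p"])
  case empty
  show ?case by simp
next
  case (insert y P)
  show ?case
  proof (cases "y \<in> P")
    case True
    then show ?thesis using insert by (simp add: insert_absorb)
  next
    case False
    have "chain P" using insert.prems(1) by (auto simp: chain_def)
    then have "\<exists>g :: nat \<times> nat \<Rightarrow> real. \<forall>p\<in>P. \<forall>q\<in>P. (snd p < fst q \<longleftrightarrow> g p + 1 < g q) \<and>
        g q \<noteq> g p + 1 \<and> (fst p + snd p < fst q + snd q \<longrightarrow> g p < g q)"
      using insert.IH insert.prems(2) by simp
    then obtain g :: "nat \<times> nat \<Rightarrow> real" where G: "\<forall>p\<in>P. \<forall>q\<in>P. (snd p < fst q \<longleftrightarrow> g p + 1 < g q) \<and>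
        g q \<noteq> g p + 1 \<and> (fst p + snd p < fst q + snd q \<longrightarrow> g p < g q)"
      by (elim exE)
    have g: "\<And>p q. p \<in> P \<Longrightarrow> q \<in> P \<Longrightarrow> snd p < fst q \<longleftrightarrow> g p + 1 < g q"
      "\<And>p q. p \<in> P \<Longrightarrow> q \<in> P \<Longrightarrow> g q \<noteq> g p + 1"
      "\<And>p q. p \<in> P \<Longrightarrow> q \<in> P \<Longrightarrow> fst p + snd p < fst q + snd q \<Longrightarrow> g p < g q"
      by (simp_all add: G)
    have ord: "p = q \<or> (fst p \<le> fst q \<and> snd p \<le> snd q \<and> fst p + snd p < fst q + snd q)"
      if "p \<in> insert y P" "q \<in> insert y P" "fst p + snd p \<le> fst q + snd q" for p q
    proof -
      have "\<not> fst p < fst q \<or> snd p \<le> snd q" "\<not> fst q < fst p \<or> snd q \<le> snd p"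
        using insert.prems(1) that unfolding chain_def by blast+
      then show ?thesis using that(3) by (auto simp: prod_eq_iff)
    qed
    have y: "fst p \<le> fst y" "snd p \<le> snd y" "fst p + snd p < fst y + snd y" if "p \<in> P" for p
      using ord[of p y] insert.hyps(2)[OF that] that False by auto
    define A where "A = {p \<in> P. snd p < fst y}"
    have finA: "finite ((\<lambda>p. g p + 1) ` A \<union> g ` P)" "finite ((\<lambda>p. g p + 1) ` (P - A))"
      using insert.hyps(1) by (auto simp: A_def)
    have sep: "a < b" if a: "a \<in> (\<lambda>p. g p + 1) ` A \<union> g ` P" and b: "b \<in> (\<lambda>p. g p + 1) ` (P - A)" for a b
    proof -
      obtain q where "q \<in> P - A" "b = g q + 1" using b by blast
      then have q: "q \<in> P" "fst y \<le> snd q" "b = g q + 1" by (simp_all add: A_def not_less)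
      consider p where "p \<in> P" "snd p < fst y" "a = g p + 1" | p where "p \<in> P" "a = g p"
        using a by (auto simp: A_def)
      then show ?thesis
      proof cases
        case 1
        then have "\<not> fst q + snd q \<le> fst p + snd p"
          using ord[of q p] q by auto
        then show ?thesis using g(3)[of p q] 1 q by simp
      next
        case 2
        \<comment> \<open>The clause \<open>g q \<noteq> g p + 1\<close> of the invariant makes this
          bound strict, which leaves room for \<open>v\<close>.\<close>
        then have "\<not> g q + 1 < g p" "g p \<noteq> g q + 1"
          using g(1)[of q p] g(2)[of q p] y(1)[of p] q by auto
        then show ?thesis using 2 q by simp
      qed
    qed
    obtain v where v: "\<And>a. a \<in> (\<lambda>p. g p + 1) ` A \<union> g ` P \<Longrightarrow> a < v"
      "\<And>b. b \<in> (\<lambda>p. g p + 1) ` (P - A) \<Longrightarrow> v < b"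
      using finite_sets_separate[OF finA sep] by blast
    have vP: "g p < v" "snd p < fst y \<longleftrightarrow> g p + 1 < v" "v \<noteq> g p + 1" if "p \<in> P" for p
    proof -
      show "g p < v" using v(1) that by blast
      have "g p + 1 < v" if "snd p < fst y" using v(1) \<open>p \<in> P\<close> that by (simp add: A_def)
      moreover have "v < g p + 1" if "\<not> snd p < fst y" using v(2) \<open>p \<in> P\<close> that by (simp add: A_def)
      ultimately show "snd p < fst y \<longleftrightarrow> g p + 1 < v" "v \<noteq> g p + 1" by force+
    qed
    have yy: "fst y \<le> snd y" using insert.prems(2) by simp
    have ne: "p \<noteq> y" if "p \<in> P" for p using that False by auto
    have yP: "\<not> snd y < fst p" if "p \<in> P" for p using y(1)[OF that] yy by simp
    show ?thesis
    proof (intro exI[of _ "g(y := v)"] ballI)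
      fix p q assume pq: "p \<in> insert y P" "q \<in> insert y P"
      let ?h = "g(y := v)"
      consider "p \<in> P" "q \<in> P" | "p \<in> P" "q = y" | "p = y" "q \<in> P" | "p = y" "q = y" using pq by blast
      then show "(snd p < fst q \<longleftrightarrow> ?h p + 1 < ?h q) \<and> ?h q \<noteq> ?h p + 1 \<and>
          (fst p + snd p < fst q + snd q \<longrightarrow> ?h p < ?h q)"
      proof cases
        case 1 then show ?thesis using g ne by simp
      next
        case 2 then show ?thesis using vP[of p] ne by simp
      next
        case 3 then show ?thesis using vP[of q] ne yP[of q] y(3)[of q] by simp
      next
        case 4 then show ?thesis using yy by simp
      qed
    qed
  qed
qed

lemma (in interval_poset) semiorder_of_chain:
  assumes "chain ((\<lambda>x. (l x, u x)) ` X)"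
  shows "semiorder_on X r"
proof -
  have "\<exists>g :: nat \<times> nat \<Rightarrow> real. \<forall>p\<in>(\<lambda>x. (l x, u x)) ` X. \<forall>q\<in>(\<lambda>x. (l x, u x)) ` X.
      (snd p < fst q \<longleftrightarrow> g p + 1 < g q) \<and> g q \<noteq> g p + 1 \<and>
      (fst p + snd p < fst q + snd q \<longrightarrow> g p < g q)"
    by (rule chain_unit_placement) (use fin le assms in auto)
  then obtain g :: "nat \<times> nat \<Rightarrow> real" where g: "\<And>x y. x \<in> X \<Longrightarrow> y \<in> X \<Longrightarrow>
      u x < l y \<longleftrightarrow> g (l x, u x) + 1 < g (l y, u y)"
    by auto
  have "interval_representation X r (\<lambda>x. g (l x, u x)) (\<lambda>x. g (l x, u x) + 1)"
    using g strictly_below_iff by (simp add: interval_representation_def)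
  moreover have "partial_order_on X r"
    unfolding partial_order_on_def preorder_on_def
  proof (intro conjI)
    show "trans r"
    proof (rule transI)
      fix x y z assume "(x, y) \<in> r" "(y, z) \<in> r"
      then show "(x, z) \<in> r" using le[of y] by (auto simp: r_eq)
    qed
    show "antisym r"
    proof (rule antisymI)
      fix x y assume "(x, y) \<in> r" "(y, x) \<in> r"
      then show "x = y" using le[of x] le[of y] by (auto simp: r_eq)
    qed
  qed (auto simp: r_eq refl_on_def)
  ultimately show ?thesis
    unfolding semiorder_on_def by (intro conjI exI) auto
qed

section \<open>The bijection with ascent sequences\<close>

lemma full_diag:
  assumes "full P m"
  shows "(m, m) \<in> P"
proof -
  obtain b where "(m, b) \<in> P" "m \<le> b" "b \<le> m" using full_column[OF assms, of m] by auto
  then show ?thesis by simp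
qed

lemma ell_eq: "full (set_mset Q) m \<Longrightarrow> ell Q = m"
  by (simp add: ell_def full_def Max_eq_iff)

lemma
  assumes "full (set_mset Q) m"
  shows ell_star_mem: "(ell_star Q, m) \<in># Q"
    and ell_star_le: "(a, m) \<in># Q \<Longrightarrow> ell_star Q \<le> a"
    and ell_star_le_ell: "ell_star Q \<le> m"
proof -
  let ?A = "fst ` {I \<in> set_mset Q. snd I = m}"
  have fin: "finite ?A" by simp
  have ne: "m \<in> ?A" using full_diag[OF assms] by force
  have e: "ell_star Q = Min ?A" by (simp add: ell_star_def ell_eq[OF assms])
  show "(ell_star Q, m) \<in># Q" using Min_in[OF fin] ne unfolding e by fastforce
  show "ell_star Q \<le> a" if "(a, m) \<in># Q" for a
    unfolding e by (rule Min_le[OF fin]) (use that in force)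
  show "ell_star Q \<le> m" unfolding e using ne fin by (rule Min_le[rotated])
qed

lemma ell_star_eqI:
  assumes "full (set_mset Q) m" "(i, m) \<in># Q" "\<And>a. (a, m) \<in># Q \<Longrightarrow> i \<le> a"
  shows "ell_star Q = i"
  using assms(2,3) ell_star_mem[OF assms(1)] ell_star_le[OF assms(1)] by (meson le_antisym)

section \<open>Inverting one insertion\<close>

text \<open>After Move 3 an interval that starts before \<open>i\<close> ends at \<open>i\<close>
  only if it was cut there, so this endpoint identifies the intervals that used to reach the top.
  Here \<open>m\<close> is the top after the insertion, whereas \<open>shift_interval\<close> takes
  the top before it.\<close>

fun unshift_interval :: "nat \<Rightarrow> nat \<Rightarrow> nat \<times> nat \<Rightarrow> nat \<times> nat" where
  "unshift_interval i m (a, b) =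
     (if i < a then (a - 1, b - 1)
      else if b = i then (a, m - 1)
      else if i < b then (a, b - 1)
      else (a, b))"

text \<open>The inverse of \<^const>\<open>add_point\<close>: the sequence entry is recovered as \<^const>\<open>ell_star\<close>, and
  Move 3 was applied iff that entry is a left endpoint of no other interval.\<close>

definition remove_point :: "(nat \<times> nat) multiset \<Rightarrow> (nat \<times> nat) multiset" where
  "remove_point M =
     (let i = ell_star M; m = ell M; M' = M - {#(i, m)#}
      in if i \<in> fst ` set_mset M' \<or> i = m then M' else image_mset (unshift_interval i m) M')"

lemma fullI:
  assumes "\<And>a b. (a, b) \<in> P \<Longrightarrow> a \<le> b" "\<And>a b. (a, b) \<in> P \<Longrightarrow> b \<le> m"
    and "\<And>a. a \<le> m \<Longrightarrow> \<exists>b. (a, b) \<in> P" "\<And>b. b \<le> m \<Longrightarrow> \<exists>a. (a, b) \<in> P"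
  shows "full P m"
proof -
  have "fst ` P = {..m}"
  proof
    show "fst ` P \<subseteq> {..m}" using order_trans[OF assms(1,2)] by auto
    show "{..m} \<subseteq> fst ` P" using assms(3) by force
  qed
  moreover have "snd ` P = {..m}"
  proof
    show "snd ` P \<subseteq> {..m}" using assms(2) by auto
    show "{..m} \<subseteq> snd ` P" using assms(4) by force
  qed
  ultimately show ?thesis using assms(1) by (auto simp: full_def)
qed

lemma shift_unshift:
  assumes "a \<le> b" "b \<le> m"
  shows "unshift_interval i (m + 1) (shift_interval i m (a, b)) = (a, b)"
  using assms by auto

lemma unshift_shift:
  assumes "a \<le> b" "b \<le> m" "a \<noteq> i" "i < m" "b = m \<Longrightarrow> i < a"
  shows "shift_interval i (m - 1) (unshift_interval i m (a, b)) = (a, b)"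
proof -
  consider "i < a" | "a < i" "b < i" | "a < i" "b = i" | "a < i" "i < b" "b < m"
    using assms by linarith
  then show ?thesis
    by cases (use assms(1,2,4) in \<open>cases a; cases b; cases m; simp\<close>)+
qed

text \<open>The result reveals which move was made: Move 1 adds to an occupied column
  \<open>i\<close>, Move 2 makes \<open>i\<close> the new top, and Move 3 empties column
  \<open>i\<close> before using it. In each case the new interval is the leftmost one reaching the
  top, which is why \<open>ell_star\<close> returns \<open>i\<close>.\<close>

lemma add_point:
  assumes Q: "full (set_mset Q) m" and i: "i \<le> m + 1"
  shows "full (set_mset (add_point Q i)) (if i \<le> ell_star Q then m else m + 1) \<and>
    ell_star (add_point Q i) = i \<and> remove_point (add_point Q i) = Q"
proof -
  note D = fullD[OF Q] and col = full_column[OF Q] and row = full_row[OF Q]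
  note e = ell_star_mem[OF Q] ell_star_le[OF Q] ell_star_le_ell[OF Q]
  consider "i \<le> ell_star Q" | "ell_star Q < i" "i = m + 1" | "ell_star Q < i" "i \<le> m"
    using i by linarith
  then show ?thesis
  proof cases
    case 1
    have A: "add_point Q i = add_mset (i, m) Q" using 1 by (simp add: add_point_def ell_eq[OF Q])
    have f: "full (set_mset (add_point Q i)) m"
    proof (rule fullI)
      fix a b assume "(a, b) \<in># add_point Q i"
      then show "a \<le> b" "b \<le> m" using D 1 e(3) by (auto simp: A)
    next
      fix a assume "a \<le> m"
      then show "\<exists>b. (a, b) \<in># add_point Q i" "\<exists>b. (b, a) \<in># add_point Q i"
        using col[of a] row[of a] by (auto simp: A)
    qed
    have s: "ell_star (add_point Q i) = i"
      by (rule ell_star_eqI[OF f]) (use 1 e(2) order_trans[OF 1 e(2)] in \<open>auto simp: A\<close>)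
    have "i \<in> fst ` set_mset Q" using Q 1 e(3) by (simp add: full_def)
    then have "remove_point (add_point Q i) = Q"
      unfolding remove_point_def Let_def s ell_eq[OF f] by (simp add: A)
    then show ?thesis using f s 1 by simp
  next
    case 2
    have A: "add_point Q i = add_mset (i, i) Q"
      using 2 by (simp add: add_point_def ell_eq[OF Q])
    have f: "full (set_mset (add_point Q i)) (m + 1)"
    proof (rule fullI)
      fix a b assume "(a, b) \<in># add_point Q i"
      then consider "a = i" "b = i" | "(a, b) \<in># Q" by (auto simp: A)
      then show "a \<le> b" "b \<le> m + 1" using D[of a b] 2 by (cases; simp)+
    next
      fix a assume "a \<le> m + 1"
      then consider "a = i" | "a \<le> m" using 2 by linarith
      then show "\<exists>b. (a, b) \<in># add_point Q i" "\<exists>b. (b, a) \<in># add_point Q i"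
        using col[of a] row[of a] by (cases; auto simp: A)+
    qed
    have s: "ell_star (add_point Q i) = i"
    proof (rule ell_star_eqI[OF f])
      show "(i, m + 1) \<in># add_point Q i" unfolding A using 2(2) by simp
      fix a assume "(a, m + 1) \<in># add_point Q i"
      then show "i \<le> a" using D(2)[of a "m + 1"] by (auto simp: A)
    qed
    have "remove_point (add_point Q i) = Q"
      unfolding remove_point_def Let_def s ell_eq[OF f] unfolding A using 2 by simp
    then show ?thesis using f s 2 by simp
  next
    case 3
    let ?S = "shift_interval i m"
    have A: "add_point Q i = add_mset (i, m + 1) (image_mset ?S Q)"
      using 3 by (simp add: add_point_def ell_eq[OF Q])
    have im: "fst (?S (a, b)) \<noteq> i" "fst (?S (a, b)) \<le> snd (?S (a, b))" "snd (?S (a, b)) \<le> m + 1"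
      "snd (?S (a, b)) = m + 1 \<Longrightarrow> i < fst (?S (a, b))"
      if "(a, b) \<in># Q" for a b
    proof -
      consider "a < i" "b < i" | "a < i" "i \<le> b" "b < m" | "a < i" "b = m" | "i \<le> a" "i \<le> b"
        using D[OF \<open>(a, b) \<in># Q\<close>] by linarith
      then show "fst (?S (a, b)) \<noteq> i" "fst (?S (a, b)) \<le> snd (?S (a, b))" "snd (?S (a, b)) \<le> m + 1"
        "snd (?S (a, b)) = m + 1 \<Longrightarrow> i < fst (?S (a, b))"
        by (cases; use D[OF that] 3 in simp)+
    qed
    have f: "full (set_mset (add_point Q i)) (m + 1)"
    proof (rule fullI)
      fix a b assume "(a, b) \<in># add_point Q i"
      then consider "a = i" "b = m + 1" | a' b' where "(a', b') \<in># Q" "(a, b) = ?S (a', b')"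
        by (auto simp: A simp del: shift_interval.simps)
      then show "a \<le> b" "b \<le> m + 1"
        using im[of _ _] 3 by (cases; metis fst_conv snd_conv le_Suc_eq add.commute plus_1_eq_Suc order_refl)+
    next
      fix a assume a: "a \<le> m + 1"
      have *: "\<exists>b. (a, b) \<in># add_point Q i" if "(a', b') \<in># Q" "fst (?S (a', b')) = a" for a' b'
        using that by (auto simp: A image_iff simp del: shift_interval.simps intro!: exI[of _ "snd (?S (a', b'))"] bexI[of _ "(a', b')"])
      consider "a < i" | "a = i" | "i < a" by linarith
      then show "\<exists>b. (a, b) \<in># add_point Q i"
      proof cases
        case 1
        then obtain b where "(a, b) \<in># Q" using col[of a] 3 by auto
        then show ?thesis using 1 by (intro *[of a b]) auto
      next
        case 2
        then show ?thesis by (auto simp: A)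
      next
        case 3
        have "a - 1 \<le> m" using a by simp
        then obtain b where "(a - 1, b) \<in># Q" "a - 1 \<le> b" "b \<le> m" using col by blast
        then show ?thesis using 3 by (intro *[of "a - 1" b]) auto
      qed
    next
      fix b assume b: "b \<le> m + 1"
      have *: "\<exists>a. (a, b) \<in># add_point Q i" if "(a', b') \<in># Q" "snd (?S (a', b')) = b" for a' b'
        using that by (auto simp: A image_iff simp del: shift_interval.simps intro!: exI[of _ "fst (?S (a', b'))"] bexI[of _ "(a', b')"])
      consider "b < i" | "b = i" | "i < b" "b \<le> m" | "b = m + 1" using b by linarith
      then show "\<exists>a. (a, b) \<in># add_point Q i"
      proof cases
        case 1
        then obtain a where "(a, b) \<in># Q" "a \<le> b" using row[of b] 3 by auto
        then show ?thesis using 1 3 by (intro *[of a b]) auto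
      next
        case 2
        \<comment> \<open>Row \<open>i\<close> of the result comes from the intervals cut by the
          move; \<open>ell_star Q < i\<close> guarantees that there is one.\<close>
        then show ?thesis using 3 e(1) by (intro *[of "ell_star Q" m]) auto
      next
        case 3
        have "b - 1 \<le> m" using b by simp
        then obtain a where "(a, b - 1) \<in># Q" "a \<le> b - 1" using row by blast
        then show ?thesis using 3 by (intro *[of a "b - 1"]) auto
      next
        case 4
        then show ?thesis by (auto simp: A)
      qed
    qed
    have s: "ell_star (add_point Q i) = i"
    proof (rule ell_star_eqI[OF f])
      show "(i, m + 1) \<in># add_point Q i" by (simp add: A)
      fix a assume "(a, m + 1) \<in># add_point Q i"
      then consider "a = i" | a' b' where "(a', b') \<in># Q" "(a, m + 1) = ?S (a', b')"
        by (auto simp: A simp del: shift_interval.simps)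
      then show "i \<le> a"
      proof cases
        case 2
        then show ?thesis using im(4)[OF 2(1)] by (metis fst_conv snd_conv less_imp_le)
      qed simp
    qed
    have "image_mset (unshift_interval i (m + 1)) (image_mset ?S Q) = image_mset id Q"
      unfolding multiset.map_comp
      by (rule image_mset_cong) (use D shift_unshift in \<open>auto simp del: shift_interval.simps unshift_interval.simps\<close>)
    then have "image_mset (unshift_interval i (m + 1)) (image_mset ?S Q) = Q" by simp
    moreover have "i \<notin> fst ` set_mset (image_mset ?S Q)"
    proof
      assume "i \<in> fst ` set_mset (image_mset ?S Q)"
      then obtain p where "p \<in># Q" "i = fst (?S p)"
        unfolding set_image_mset image_image by blast
      then show False using im(1)[of "fst p" "snd p"] by (simp del: shift_interval.simps)
    qed
    ultimately have "remove_point (add_point Q i) = Q"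
      unfolding remove_point_def Let_def s ell_eq[OF f] using 3
      by (simp add: A del: shift_interval.simps unshift_interval.simps)
    then show ?thesis using f s 3 by simp
  qed
qed

lemma size_add_point [simp]: "size (add_point Q i) = Suc (size Q)"
  by (simp add: add_point_def)

text \<open>This is the peeling step for surjectivity of \<open>Psi_inv\<close>. The bound on
  \<open>ell_star M\<close> makes the recovered entry admissible in an ascent sequence, because the
  top \<open>k\<close> is the number of ascents.\<close>

lemma remove_point:
  assumes M: "full (set_mset M) m" and sz: "2 \<le> size M"
  shows "\<exists>k. full (set_mset (remove_point M)) k \<and> ell_star M \<le> k + 1 \<and>
    add_point (remove_point M) (ell_star M) = M"
proof -
  note D = fullD[OF M] and col = full_column[OF M] and row = full_row[OF M]
  note e = ell_star_mem[OF M] ell_star_le[OF M] ell_star_le_ell[OF M]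
  define i where "i = ell_star M"
  define M' where "M' = M - {#(i, m)#}"
  have MM': "M = add_mset (i, m) M'" using e(1) by (simp add: M'_def i_def)
  have R: "remove_point M = (if i \<in> fst ` set_mset M' \<or> i = m then M' else image_mset (unshift_interval i m) M')"
    by (simp add: remove_point_def Let_def i_def M'_def ell_eq[OF M] del: unshift_interval.simps)
  have i_le: "i \<le> a" if "(a, m) \<in># M'" for a
    using e(2)[of a, folded i_def] that by (simp add: MM')
  have D': "a \<le> b" "b \<le> m" if "(a, b) \<in># M'" for a b using D that by (auto simp: MM')
  consider "i \<in> fst ` set_mset M'" | "i \<notin> fst ` set_mset M'" "i = m" | "i \<notin> fst ` set_mset M'" "i < m"
    using e(3) i_def by linarith
  then show ?thesis
  proof cases
    case 1
    then have r: "remove_point M = M'" by (simp add: R)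
    obtain b where b: "(i, b) \<in># M'" using 1 by auto
    \<comment> \<open>The top level has to survive the removal. If \<open>i = m\<close>, the other
      interval starting at \<open>i\<close> is a second copy of \<open>(m, m)\<close>.\<close>
    have mm: "(m, m) \<in># M'"
    proof (cases "i = m")
      case True
      then show ?thesis using b D'[OF b] by simp
    next
      case False
      then show ?thesis using full_diag[OF M] by (simp add: MM')
    qed
    have f: "full (set_mset M') m"
    proof (rule fullI)
      fix a assume "a \<le> m"
      then show "\<exists>b. (a, b) \<in># M'" "\<exists>b. (b, a) \<in># M'"
        using col[of a] row[of a] mm b by (auto simp: MM')
    qed (use D' in auto)
    have "i \<le> ell_star M'" using i_le ell_star_mem[OF f] by blast
    then have "add_point M' i = M" by (simp add: add_point_def ell_eq[OF f] MM')
    then show ?thesis using f e(3) by (auto simp: r i_def[symmetric])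
  next
    case 2
    then have r: "remove_point M = M'" by (simp add: R)
    \<comment> \<open>Intervals reaching the top start at \<open>i = m\<close> or later, and none is
      left there, so the whole top level disappears.\<close>
    have lt: "b < m" if "(a, b) \<in># M'" for a b
    proof (rule ccontr)
      assume "\<not> b < m"
      then have b: "b = m" using D'(2)[OF that] by simp
      then have "a = i" using D'(1)[OF that] i_le that 2(2) by fastforce
      then show False using that 2(1) by force
    qed
    have "M' \<noteq> {#}" using sz by (auto simp: MM')
    then obtain a b where "(a, b) \<in># M'" by auto
    then have m: "0 < m" using lt by fastforce
    have f: "full (set_mset M') (m - 1)"
    proof (rule fullI)
      fix a assume "a \<le> m - 1"
      then have "a \<le> m" "a \<noteq> m" using m by auto
      then show "\<exists>b. (a, b) \<in># M'" "\<exists>b. (b, a) \<in># M'"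
        using col[of a] row[of a] 2 by (auto simp: MM')
    next
      fix a b assume ab: "(a, b) \<in># M'"
      show "a \<le> b" "b \<le> m - 1" using D'(1)[OF ab] lt[OF ab] by auto
    qed
    have "ell_star M' < m" using lt[OF ell_star_mem[OF f]] ell_star_le_ell[OF f] m by linarith
    then have "add_point M' i = M" using m 2 by (simp add: add_point_def ell_eq[OF f] MM')
    then show ?thesis using f m 2 by (auto simp: r i_def[symmetric])
  next
    case 3
    let ?U = "unshift_interval i m"
    have r: "remove_point M = image_mset ?U M'" using 3 by (simp add: R)
    have ne: "a \<noteq> i" if "(a, b) \<in># M'" for a b using 3(1) that by force
    have im: "fst (?U (a, b)) \<le> snd (?U (a, b))" "snd (?U (a, b)) \<le> m - 1"
      if "(a, b) \<in># M'" for a b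
    proof -
      have "b = m \<Longrightarrow> i \<le> a" using i_le that by blast
      then consider "a < i" "b < i" | "a < i" "b = i" | "a < i" "i < b" "b < m" | "i < a" "i < b"
        using D'[OF \<open>(a, b) \<in># M'\<close>] ne[OF \<open>(a, b) \<in># M'\<close>] by linarith
      then show "fst (?U (a, b)) \<le> snd (?U (a, b))" "snd (?U (a, b)) \<le> m - 1"
        by (cases; use D'[OF that] 3 in \<open>simp; linarith?\<close>)+
    qed
    have f: "full (set_mset (image_mset ?U M')) (m - 1)"
    proof (rule fullI)
      fix a b assume "(a, b) \<in># image_mset ?U M'"
      then obtain a' b' where "(a', b') \<in># M'" "(a, b) = ?U (a', b')"
        by (auto simp del: unshift_interval.simps)
      then show "a \<le> b" "b \<le> m - 1" using im by (metis fst_conv snd_conv)+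
    next
      fix a assume a: "a \<le> m - 1"
      have *: "\<exists>b. (a, b) \<in># image_mset ?U M'" if "(a', b') \<in># M'" "fst (?U (a', b')) = a" for a' b'
        using that by (auto simp: image_iff simp del: unshift_interval.simps intro!: exI[of _ "snd (?U (a', b'))"] bexI[of _ "(a', b')"])
      show "\<exists>b. (a, b) \<in># image_mset ?U M'"
      proof (cases "a < i")
        case True
        then obtain b where "(a, b) \<in># M'" using col[of a] 3 by (auto simp: MM')
        then show ?thesis using True by (intro *[of a b]) auto
      next
        case False
        have "a + 1 \<le> m" using a 3(2) by linarith
        then obtain b where "(a + 1, b) \<in># M'" using col[of "a + 1"] False by (auto simp: MM')
        then show ?thesis using False by (intro *[of "a + 1" b]) auto
      qed
    next
      fix b assume b: "b \<le> m - 1"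
      have *: "\<exists>a. (a, b) \<in># image_mset ?U M'" if "(a', b') \<in># M'" "snd (?U (a', b')) = b" for a' b'
        using that by (auto simp: image_iff simp del: unshift_interval.simps intro!: exI[of _ "fst (?U (a', b'))"] bexI[of _ "(a', b')"])
      show "\<exists>a. (a, b) \<in># image_mset ?U M'"
      proof (cases "b < i")
        case True
        then obtain a where "(a, b) \<in># M'" "a \<le> b" using row[of b] 3 by (auto simp: MM')
        then show ?thesis using True by (intro *[of a b]) auto
      next
        case False
        have "(m, m) \<in># M'" using full_diag[OF M] 3 by (auto simp: MM')
        moreover have "b + 1 \<le> m" using b 3(2) by linarith
        ultimately obtain a where a: "(a, b + 1) \<in># M'"
          using row[of "b + 1"] by (cases "b + 1 = m") (auto simp: MM')
        then show ?thesis using False by (intro *[OF a]) auto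
      qed
    qed
    \<comment> \<open>An interval ending at \<open>i\<close> goes back to the top, so
      \<open>ell_star\<close> lies below \<open>i\<close> and \<open>add_point\<close> chooses Move
      3.\<close>
    obtain c where c: "(c, i) \<in># M'" "c \<le> i" using row[of i] 3 by (auto simp: MM')
    then have "c < i" using ne by fastforce
    then have "(c, m - 1) \<in># image_mset ?U M'" using c(1) by force
    then have "ell_star (image_mset ?U M') < i"
      using ell_star_le[OF f] \<open>c < i\<close> by fastforce
    then have "add_point (image_mset ?U M') i =
        add_mset (i, m) (image_mset (shift_interval i (m - 1)) (image_mset ?U M'))"
      using 3 by (simp add: add_point_def ell_eq[OF f])
    also have "image_mset (shift_interval i (m - 1)) (image_mset ?U M') = image_mset id M'"
      unfolding multiset.map_comp
    proof (rule image_mset_cong)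
      fix p assume p: "p \<in># M'"
      obtain a b where ab: "p = (a, b)" by fastforce
      have "i < a" if "b = m" using i_le ne p ab that by (metis le_neq_implies_less)
      then show "(shift_interval i (m - 1) \<circ> ?U) p = id p"
        using unshift_shift[of a b m i] D' ne 3 p ab
        by (simp del: shift_interval.simps unshift_interval.simps)
    qed
    finally have "add_point (image_mset ?U M') i = M" by (simp add: MM')
    then show ?thesis using f 3 by (auto simp: r i_def[symmetric] simp del: unshift_interval.simps)
  qed
qed

section \<open>Ascent sequences and full multisets of intervals\<close>

lemma Psi_inv_snoc: "xs \<noteq> [] \<Longrightarrow> Psi_inv (xs @ [i]) = add_point (Psi_inv xs) i"
  by (simp add: Psi_inv_def)

lemma asc_snoc: "xs \<noteq> [] \<Longrightarrow> asc (xs @ [i]) = asc xs + (if last xs < i then 1 else 0)"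
proof -
  assume ne: "xs \<noteq> []"
  let ?A = "{j. Suc j < length xs \<and> xs ! j < xs ! Suc j}"
  let ?B = "{j. Suc j < length (xs @ [i]) \<and> (xs @ [i]) ! j < (xs @ [i]) ! Suc j}"
  have "?B = ?A \<union> (if last xs < i then {length xs - 1} else {})"
  proof (rule set_eqI)
    fix j
    consider "Suc j < length xs" | "Suc j = length xs" | "length xs < Suc j" by linarith
    then show "j \<in> ?B \<longleftrightarrow> j \<in> ?A \<union> (if last xs < i then {length xs - 1} else {})"
    proof cases
      case 1
      then have "j \<noteq> length xs - 1" by linarith
      then show ?thesis using 1 by (simp add: nth_append)
    next
      case 2
      then have "last xs = xs ! j" using ne by (simp add: last_conv_nth flip: 2)
      then show ?thesis using 2 by (auto simp: nth_append)
    next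
      case 3
      then have "j \<noteq> length xs - 1" using ne by (cases xs) auto
      then show ?thesis using 3 by simp
    qed
  qed
  moreover have "length xs - 1 \<notin> ?A" using ne by auto
  moreover have "finite ?A" by (rule finite_subset[of _ "{..<length xs}"]) auto
  ultimately show ?thesis unfolding asc_def by simp
qed

lemma ascent_sequence_snoc:
  "xs \<noteq> [] \<Longrightarrow> ascent_sequence (xs @ [i]) \<longleftrightarrow> ascent_sequence xs \<and> i \<le> 1 + asc xs"
  unfolding ascent_sequence_def by (auto simp: nth_append less_Suc_eq)

lemma ascent_sequence_single: "ascent_sequence [x] \<longleftrightarrow> x = 0"
  by (auto simp: ascent_sequence_def)

text \<open>Since \<open>ell_star\<close> is the previous entry, the moves that raise the top by one
  happen exactly at the ascents.\<close>

lemma Psi_inv_full: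
  "ascent_sequence xs \<Longrightarrow> full (set_mset (Psi_inv xs)) (asc xs) \<and> ell_star (Psi_inv xs) = last xs \<and>
     size (Psi_inv xs) = length xs"
proof (induction xs rule: rev_induct)
  case Nil
  then show ?case by (simp add: ascent_sequence_def)
next
  case (snoc i xs)
  show ?case
  proof (cases "xs = []")
    case True
    then have i: "i = 0" using snoc by (simp add: ascent_sequence_single)
    have P: "Psi_inv [0] = {#(0, 0)#}" by (simp add: Psi_inv_def)
    have f: "full (set_mset (Psi_inv [0])) 0" by (auto simp: P full_def)
    have "ell_star (Psi_inv [0]) = 0" by (rule ell_star_eqI[OF f]) (auto simp: P)
    then show ?thesis using f by (simp add: True i P asc_def)
  next
    case False
    then have IH: "full (set_mset (Psi_inv xs)) (asc xs)" "ell_star (Psi_inv xs) = last xs"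
      "size (Psi_inv xs) = length xs" "i \<le> asc xs + 1"
      using snoc by (simp_all add: ascent_sequence_snoc)
    show ?thesis
      using add_point[OF IH(1,4)] IH(2,3) False
      by (auto simp: Psi_inv_snoc asc_snoc split: if_splits)
  qed
qed

lemma remove_point_Psi_inv:
  assumes "ascent_sequence (xs @ [i])" "xs \<noteq> []"
  shows "remove_point (Psi_inv (xs @ [i])) = Psi_inv xs"
  using add_point[of "Psi_inv xs" "asc xs" i] Psi_inv_full[of xs] assms
  by (simp add: ascent_sequence_snoc Psi_inv_snoc)

lemma Psi_inv_surj:
  "full (set_mset M) m \<Longrightarrow> \<exists>xs. ascent_sequence xs \<and> Psi_inv xs = M"
proof (induction "size M" arbitrary: M m rule: less_induct)
  case less
  show ?case
  proof (cases "2 \<le> size M")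
    case False
    have "M \<noteq> {#}" using full_diag[OF less.prems] by auto
    then have "size M = 1" using False by (cases "size M") auto
    then obtain p where p: "M = {#p#}" using size_1_singleton_mset by blast
    have "m = 0" using full_row[OF less.prems, of 0] full_diag[OF less.prems] by (auto simp: p)
    then have "M = Psi_inv [0]" using full_diag[OF less.prems] by (auto simp: p Psi_inv_def)
    then show ?thesis using ascent_sequence_single by blast
  next
    case True
    obtain k where k: "full (set_mset (remove_point M)) k" "ell_star M \<le> k + 1"
      "add_point (remove_point M) (ell_star M) = M"
      using remove_point[OF less.prems True] by blast
    have "size M = Suc (size (remove_point M))"
      by (subst k(3)[symmetric]) simp
    then obtain xs where xs: "ascent_sequence xs" "Psi_inv xs = remove_point M"
      using less.hyps[OF _ k(1)] by auto
    have "xs \<noteq> []" using xs(1) by (auto simp: ascent_sequence_def)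
    moreover have "asc xs = k" using Psi_inv_full[OF xs(1)] ell_eq k(1) xs(2) by metis
    ultimately have "ascent_sequence (xs @ [ell_star M])" "Psi_inv (xs @ [ell_star M]) = M"
      using xs k by (simp_all add: ascent_sequence_snoc Psi_inv_snoc)
    then show ?thesis by blast
  qed
qed

section \<open>Hereditary semiorders\<close>

text \<open>In a full path the two points named in \<open>bad\<close> lie below row
  \<open>m\<close>, because column \<open>a + 1\<close> contains a higher point; so the removed
  point is neither of them. The hypothesis on \<open>i\<close> prevents the condition on column
  \<open>a + 1\<close> from becoming vacuous after the removal.\<close>

lemma bad_insert_last:
  assumes M: "full P m" and T: "P = insert (i, m) T" and "i = m \<or> i \<in> fst ` T"
  shows "bad P \<longleftrightarrow> bad T"
proof -
  note D = fullD[OF M]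
  show ?thesis
  proof
    assume "bad P"
    then obtain c a b where x: "c < a" "a + 2 \<le> b" "(c, a + 1) \<in> P" "(a, b) \<in> P"
      and d: "\<And>d. (a + 1, d) \<in> P \<Longrightarrow> b < d"
      unfolding bad_def by blast
    have "b \<le> m" using D x(4) by blast
    then obtain e where "(a + 1, e) \<in> P" "e \<le> m" using full_column[OF M, of "a + 1"] x(2) by auto
    then have "b < m" using d by fastforce
    then have "(c, a + 1) \<in> T" "(a, b) \<in> T" using x T by auto
    then show "bad T" unfolding bad_def using x(1,2) d T by blast
  next
    assume "bad T"
    then obtain c a b where x: "c < a" "a + 2 \<le> b" "(c, a + 1) \<in> T" "(a, b) \<in> T"
      and d: "\<And>d. (a + 1, d) \<in> T \<Longrightarrow> b < d"
      unfolding bad_def by blast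
    have "b \<le> m" using D x(4) T by blast
    have "b < m" if "a + 1 = i"
    proof -
      have "i \<in> fst ` T" using assms(3) that x(2) \<open>b \<le> m\<close> by auto
      then obtain e where "(a + 1, e) \<in> T" using \<open>a + 1 = i\<close> by auto
      then show ?thesis using d[of e] D(2)[of "a + 1" e] T by auto
    qed
    then have "\<And>d. (a + 1, d) \<in> P \<Longrightarrow> b < d" using d T by auto
    then show "bad P" unfolding bad_def using x T by blast
  qed
qed

text \<open>Reversing Moves 1 and 2 only drops a point. Reversing Move 3 rearranges the path near
  column \<open>i - 1\<close>: either that place shows the pattern and the chain breaks, or the path
  is unchanged before column \<open>i\<close> and any pattern lies entirely in that unchanged
  part.\<close>

lemma step_remove_point:
  assumes M: "full (set_mset M) m" and chain: "chain (set_mset M)"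
  shows "\<not> bad (set_mset M) \<longleftrightarrow>
    chain (set_mset (remove_point M)) \<and> \<not> bad (set_mset (remove_point M))"
proof -
  note D = fullD[OF M] and col = full_column[OF M] and row = full_row[OF M]
  note e = ell_star_mem[OF M] ell_star_le[OF M] ell_star_le_ell[OF M]
  note C = chainD[OF chain]
  define i where "i = ell_star M"
  define M' where "M' = M - {#(i, m)#}"
  have MM': "M = add_mset (i, m) M'" using e(1) by (simp add: M'_def i_def)
  define P T where "P = set_mset M" and "T = set_mset M'"
  have PT: "P = insert (i, m) T" unfolding P_def T_def by (subst MM') simp
  note M = M[folded P_def] and D = D[folded P_def] and col = col[folded P_def]
    and row = row[folded P_def] and C = C[folded P_def]
  have i_le: "i \<le> a" if "(a, m) \<in> P" for a using e(2)[of a] that by (simp add: i_def P_def)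
  have im: "i \<le> m" using e(3) by (simp add: i_def)
  have R: "remove_point M = (if i \<in> fst ` T \<or> i = m then M' else image_mset (unshift_interval i m) M')"
    by (simp add: remove_point_def Let_def i_def M'_def T_def ell_eq[OF M[unfolded P_def]] del: unshift_interval.simps)
  show ?thesis
  proof (cases "i \<in> fst ` T \<or> i = m")
    case True
    then have "set_mset (remove_point M) = T" by (simp add: R T_def)
    moreover have "chain T" using chain PT unfolding P_def chain_def by blast
    moreover have "bad P \<longleftrightarrow> bad T" using bad_insert_last[OF M PT] True by blast
    ultimately show ?thesis by (simp add: P_def)
  next
    case False
    then have i: "i \<notin> fst ` T" "i < m" using im by auto
    let ?U = "unshift_interval i m"
    have V: "set_mset (remove_point M) = ?U ` T"
      using False by (simp add: R T_def del: unshift_interval.simps)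
    have col_i: "b = m" if "(i, b) \<in> P" for b using that i(1) PT by force
    \<comment> \<open>The removed point was alone in column \<open>i\<close>, so the path is in row
      \<open>m\<close> there and stays in it.\<close>
    have right: "b = m" if "(a, b) \<in> P" "i \<le> a" for a b
    proof (cases "a = i")
      case True then show ?thesis using col_i that by simp
    next
      case False
      then have "m \<le> b" using C[of i m a b] that PT by simp
      then show ?thesis using D(2)[OF that(1)] by simp
    qed
    have left: "a < i" if "(a, b) \<in> P" "b < m" for a b
      using right[OF that(1)] that(2) by (cases "i \<le> a") auto
    have right_mem: "(a, m) \<in> P" if "i \<le> a" "a \<le> m" for a
      using col[OF that(2)] right that(1) by blast
    have i0: "0 < i"
    proof (rule ccontr)
      assume "\<not> 0 < i"
      then have "i = 0" by simp
      moreover obtain a where "(a, 0) \<in> P" "a \<le> 0" using row[of 0] by auto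
      ultimately show False using col_i i(2) by auto
    qed
    have last: "(i - 1, m - 1) \<in> P"
    proof -
      have "m - 1 \<le> m" by simp
      then obtain a where a: "(a, m - 1) \<in> P" using row by blast
      have "a < i" using left[OF a] i(2) by simp
      show ?thesis
      proof (cases "a = i - 1")
        case False
        then have lt: "a < i - 1" using \<open>a < i\<close> by simp
        have "i - 1 \<le> m" using i(2) by simp
        then obtain d where d: "(i - 1, d) \<in> P" using col by blast
        have "m - 1 \<le> d" using C[OF a d lt] .
        moreover have "d \<noteq> m" using i_le[of "i - 1"] d i0 by auto
        ultimately have "d = m - 1" using D(2)[OF d] by simp
        then show ?thesis using d by simp
      qed (use a in simp)
    qed
    \<comment> \<open>This is the pattern with \<open>a = i - 1\<close> and
      \<open>b = m - 1\<close>. Reversing the move lifts \<open>(c, i)\<close> to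
      \<open>(c, m - 1)\<close> but lowers \<open>(i - 1, m - 1)\<close> to
      \<open>(i - 1, m - 2)\<close>, which breaks the chain.\<close>
    define B where "B \<longleftrightarrow> m - 1 \<noteq> i \<and> (\<exists>c<i - 1. (c, i) \<in> P)"
    show ?thesis
    proof (cases B)
      case True
      then obtain c where c: "c < i - 1" "(c, i) \<in> P" and ne: "m - 1 \<noteq> i" by (auto simp: B_def)
      have "i + 1 \<le> m - 1" using ne i by simp
      have "bad P" unfolding bad_def
      proof (intro exI conjI allI impI)
        show "c < i - 1" by fact
        show "i - 1 + 2 \<le> m - 1" using \<open>i + 1 \<le> m - 1\<close> i0 by simp
        show "(c, i - 1 + 1) \<in> P" using c i0 by simp
        show "(i - 1, m - 1) \<in> P" by fact
        show "m - 1 < d" if "(i - 1 + 1, d) \<in> P" for d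
          using col_i[of d] that i0 i(2) by simp
      qed
      moreover have "\<not> chain (?U ` T)"
      proof
        assume ch: "chain (?U ` T)"
        have U1: "?U (c, i) = (c, m - 1)" using c(1) by simp
        have U2: "?U (i - 1, m - 1) = (i - 1, m - 2)" using \<open>i + 1 \<le> m - 1\<close> by auto
        have "(c, i) \<in> T" "(i - 1, m - 1) \<in> T" using c last PT i0 by auto
        then have "?U (c, i) \<in> ?U ` T" "?U (i - 1, m - 1) \<in> ?U ` T" by blast+
        then have "(c, m - 1) \<in> ?U ` T" "(i - 1, m - 2) \<in> ?U ` T"
          unfolding U1 U2 by simp_all
        then show False using chainD[OF ch, of c "m - 1" "i - 1" "m - 2"] c(1) \<open>i + 1 \<le> m - 1\<close> by auto
      qed
      ultimately show ?thesis by (simp add: V P_def)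
    next
      case False
      have low: "a = i - 1" if "(a, b) \<in> P" "a < i" "i \<le> b" "m - 1 \<noteq> i" for a b
      proof (rule ccontr)
        assume "a \<noteq> i - 1"
        then have lt: "a < i - 1" using that(2) by simp
        obtain c where c: "(c, i) \<in> P" using row[OF im] by blast
        have "c < i" using left[OF c] i(2) by simp
        then have "c = i - 1" using False c that(4) by (metis B_def Suc_pred' i0 less_antisym Suc_eq_plus1 add.commute plus_1_eq_Suc)
        then have "b \<le> i" using C[OF that(1) c] lt by simp
        then have "(a, i) \<in> P" using that by simp
        then show False using False lt that(4) by (auto simp: B_def)
      qed
      have fillcol: "(i - 1, b) \<in> P" if "i \<le> b" "b \<le> m - 1" "m - 1 \<noteq> i" for b
      proof -
        have "b \<le> m" using that by simp
        then obtain a where a: "(a, b) \<in> P" using row by blast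
        have "a < i" using left[OF a] that i(2) by simp
        then show ?thesis using low[OF a _ that(1,3)] a by simp
      qed
      have TP: "(a, b) \<in> T \<longleftrightarrow> (a, b) \<in> P \<and> a \<noteq> i" for a b
        using PT i(1) by force
      \<comment> \<open>Without \<open>B\<close>, rows \<open>i\<close> to \<open>m - 1\<close> of
        column \<open>i - 1\<close> are permuted cyclically: the lowest point becomes the highest
        and the others descend by one. If \<open>m - 1 = i\<close>, points left of column
        \<open>i\<close> stay fixed. As a set, only the part from column \<open>i\<close> on
        changes, losing one column and one row.\<close>
      have U: "(a, b) \<in> ?U ` T \<longleftrightarrow> (a < i \<and> (a, b) \<in> P) \<or> (i \<le> a \<and> a \<le> m - 1 \<and> b = m - 1)" for a b
      proof
        assume "(a, b) \<in> ?U ` T"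
        then obtain a' b' where ab: "(a', b') \<in> P" "a' \<noteq> i" "(a, b) = ?U (a', b')"
          using TP by (elim imageE) (metis surj_pair)
        consider "i < a'" | "a' < i" "b' < i" | "a' < i" "b' = i" | "a' < i" "i < b'"
          using ab(2) by linarith
        then show "(a < i \<and> (a, b) \<in> P) \<or> (i \<le> a \<and> a \<le> m - 1 \<and> b = m - 1)"
        proof cases
          case 1
          then have "b' = m" using right ab by simp
          then show ?thesis using 1 ab D[OF ab(1)] by auto
        next
          case 2
          then show ?thesis using ab by simp
        next
          case 3
          then have a: "a = a'" "b = m - 1" using ab by simp_all
          show ?thesis
          proof (cases "m - 1 = i")
            case True then show ?thesis using a ab 3 by simp
          next
            case False
            then show ?thesis using a low[OF ab(1) 3(1)] 3 last by simp
          qed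
        next
          case 4
          then have a: "a = a'" "b = b' - 1" using ab by simp_all
          have "b' \<noteq> m" using i_le ab(1) 4 by fastforce
          then have b': "b' \<le> m - 1" using D(2)[OF ab(1)] by simp
          then have "m - 1 \<noteq> i" using 4 by simp
          then show ?thesis using a low[OF ab(1)] fillcol[of b] 4 b' by simp
        qed
      next
        have im': "?U (a', b') \<in> ?U ` T" if "(a', b') \<in> P" "a' \<noteq> i" for a' b'
          using that TP by blast
        assume "(a < i \<and> (a, b) \<in> P) \<or> (i \<le> a \<and> a \<le> m - 1 \<and> b = m - 1)"
        then show "(a, b) \<in> ?U ` T"
        proof (elim disjE conjE)
          assume ab: "a < i" "(a, b) \<in> P"
          have "b \<noteq> m" using i_le[of a] ab by auto
          then have b: "b \<le> m - 1" using D(2)[OF ab(2)] by simp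
          consider "b < i" | "i \<le> b" "m - 1 = i" | "i \<le> b" "m - 1 \<noteq> i" "b < m - 1" | "i \<le> b" "m - 1 \<noteq> i" "b = m - 1"
            using b by linarith
          then show ?thesis
          proof cases
            case 1
            then show ?thesis using im'[OF ab(2)] ab by simp
          next
            case 2
            then have "b = i" using b by simp
            then show ?thesis using im'[OF ab(2)] ab 2 by simp
          next
            case 3
            then have a: "a = i - 1" using low ab by blast
            have "(i - 1, b + 1) \<in> P" using fillcol[of "b + 1"] 3 by simp
            then have "?U (i - 1, b + 1) \<in> ?U ` T" using i0 by (intro im') auto
            moreover have "?U (i - 1, b + 1) = (i - 1, b)" using 3(1) by auto
            ultimately show ?thesis unfolding a by simp
          next
            case 4
            then have a: "a = i - 1" using low ab by blast
            have "(i - 1, i) \<in> P" using fillcol[of i] 4 by simp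
            then have "?U (i - 1, i) \<in> ?U ` T" using i0 by (intro im') auto
            moreover have "?U (i - 1, i) = (i - 1, m - 1)" by auto
            ultimately show ?thesis unfolding a 4(3) by simp
          qed
        next
          assume ab: "i \<le> a" "a \<le> m - 1" "b = m - 1"
          then have "(a + 1, m) \<in> P" using right_mem i(2) by simp
          then have "?U (a + 1, m) \<in> ?U ` T" using ab by (intro im') auto
          moreover have "?U (a + 1, m) = (a, b)" using ab by auto
          ultimately show ?thesis by simp
        qed
      qed
      have "chain (?U ` T)"
        unfolding chain_def
      proof (intro ballI impI)
        fix p q assume pq: "p \<in> ?U ` T" "q \<in> ?U ` T" "fst p < fst q"
        obtain a b c d where p: "p = (a, b)" "q = (c, d)" by (metis surj_pair)
        have b: "b \<le> m - 1"
        proof (cases "a < i")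
          case True
          then have ab: "(a, b) \<in> P" using pq U by (auto simp: p)
          then have "b \<noteq> m" using i_le[of a] True by auto
          then show ?thesis using D(2)[OF ab] by simp
        next
          case False then show ?thesis using pq U p by auto
        qed
        show "snd p \<le> snd q"
          using pq U[of a b] U[of c d] C[of a b c d] b by (auto simp: p simp del: unshift_interval.simps)
      qed
      moreover have "bad P \<longleftrightarrow> bad (?U ` T)"
      proof
        assume "bad P"
        then obtain c a b where x: "c < a" "a + 2 \<le> b" "(c, a + 1) \<in> P" "(a, b) \<in> P"
          and d: "\<And>d. (a + 1, d) \<in> P \<Longrightarrow> b < d"
          unfolding bad_def by blast
        have bm: "b \<le> m" using D x(4) by blast
        have "a < i"
        proof (rule ccontr)
          assume "\<not> a < i"
          then have "b = m" "(a + 1, m) \<in> P" using right[OF x(4)] right_mem[of "a + 1"] x(2) bm by auto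
          then show False using d by blast
        qed
        moreover have "a \<noteq> i - 1"
        proof
          assume a: "a = i - 1"
          have "b \<noteq> m" using i_le[of a] x(4) a i0 by auto
          then have "m - 1 \<noteq> i" using a x(2) bm i0 by auto
          then show False using False x(1,3) a i0 by (auto simp: B_def)
        qed
        ultimately have "a + 1 < i" by simp
        then have "(c, a + 1) \<in> ?U ` T" "(a, b) \<in> ?U ` T" "\<And>d. (a + 1, d) \<in> ?U ` T \<Longrightarrow> b < d"
          using U x d by (simp_all del: unshift_interval.simps)
        then show "bad (?U ` T)" unfolding bad_def using x(1,2) by blast
      next
        assume "bad (?U ` T)"
        then obtain c a b where x: "c < a" "a + 2 \<le> b" "(c, a + 1) \<in> ?U ` T" "(a, b) \<in> ?U ` T"
          and d: "\<And>d. (a + 1, d) \<in> ?U ` T \<Longrightarrow> b < d"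
          unfolding bad_def by blast
        have "a + 1 < i"
        proof (rule ccontr)
          assume n: "\<not> a + 1 < i"
          have "b \<le> m - 1"
          proof (cases "a < i")
            case True
            then have ab: "(a, b) \<in> P" using x U by (auto simp del: unshift_interval.simps)
            then have "b \<noteq> m" using i_le[of a] True by auto
            then show ?thesis using D(2)[OF ab] by simp
          next
            case False then show ?thesis using x U by (auto simp del: unshift_interval.simps)
          qed
          then have "(a + 1, m - 1) \<in> ?U ` T" using n x(2) U[of "a + 1" "m - 1"] by auto
          then have b: "b < m - 1" by (rule d)
          show False
          proof (cases "a < i")
            case True
            then have a: "a = i - 1" using n by simp
            then have "(c, i) \<in> P" using x(1,3) U i0 by (auto simp del: unshift_interval.simps)
            moreover have "m - 1 \<noteq> i" using a b x(2) i0 by simp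
            ultimately show False using \<open>\<not> B\<close> x(1) a by (auto simp: B_def)
          next
            case False
            then show False using x(4) U b by (auto simp del: unshift_interval.simps)
          qed
        qed
        then have "(c, a + 1) \<in> P" "(a, b) \<in> P" "\<And>d. (a + 1, d) \<in> P \<Longrightarrow> b < d"
          using U x d by (simp_all del: unshift_interval.simps)
        then show "bad P" unfolding bad_def using x(1,2) by blast
      qed
      ultimately show ?thesis by (simp add: V P_def del: unshift_interval.simps)
    qed
  qed
qed

text \<open>Removing the last inserted point from a bad chain either breaks the chain or leaves it
  bad. A single point is not bad, so the chain must break at some prefix.\<close>

lemma Psi_inv_prefixes_chain_iff:
  assumes "ascent_sequence xs"
  shows "(\<forall>i. 1 \<le> i \<and> i \<le> length xs \<longrightarrow> chain (set_mset (Psi_inv (take i xs)))) \<longleftrightarrow>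
    chain (set_mset (Psi_inv xs)) \<and> \<not> bad (set_mset (Psi_inv xs))"
  using assms
proof (induction xs rule: rev_induct)
  case Nil
  then show ?case by (simp add: ascent_sequence_def)
next
  case (snoc x xs)
  let ?S = "\<lambda>xs. set_mset (Psi_inv xs)"
  show ?case
  proof (cases "xs = []")
    case True
    then have "x = 0" using snoc.prems by (simp add: ascent_sequence_single)
    then have "?S (xs @ [x]) = {(0, 0)}" by (simp add: True Psi_inv_def)
    moreover have "take i (xs @ [x]) = xs @ [x]" if "1 \<le> i" for i using that by (simp add: True)
    moreover have "chain {(0, 0)}" "\<not> bad {(0, 0)}" by (auto simp: chain_def bad_def)
    ultimately show ?thesis by (auto simp: True)
  next
    case False
    then have IH: "(\<forall>i. 1 \<le> i \<and> i \<le> length xs \<longrightarrow> chain (?S (take i xs))) \<longleftrightarrow>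
        chain (?S xs) \<and> \<not> bad (?S xs)"
      using snoc by (simp add: ascent_sequence_snoc)
    have "(\<forall>i. 1 \<le> i \<and> i \<le> length (xs @ [x]) \<longrightarrow> chain (?S (take i (xs @ [x])))) \<longleftrightarrow>
        (\<forall>i. 1 \<le> i \<and> i \<le> length xs \<longrightarrow> chain (?S (take i xs))) \<and> chain (?S (xs @ [x]))"
      by (auto simp: le_Suc_eq)
    also have "\<dots> \<longleftrightarrow> chain (?S (xs @ [x])) \<and> \<not> bad (?S (xs @ [x]))"
      unfolding IH
      using step_remove_point[of "Psi_inv (xs @ [x])" "asc (xs @ [x])"] Psi_inv_full[OF snoc.prems]
        remove_point_Psi_inv[OF snoc.prems False] by auto
    finally show ?thesis .
  qed
qed

section \<open>From multisets of intervals back to posets\<close>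

lemma semiorder_mset_order_iff:
  assumes "full (set_mset M) m"
  shows "semiorder_on (mset_points M) (mset_order M) \<longleftrightarrow> chain (set_mset M)"
proof -
  have pts: "mset_points M = Sigma (set_mset M) (\<lambda>I. {..<count M I})"
    by (auto simp: mset_points_def) (metis count_eq_zero_iff not_less_zero)
  have im: "(\<lambda>p. (fst (fst p), snd (fst p))) ` mset_points M = set_mset M"
  proof
    show "set_mset M \<subseteq> (\<lambda>p. (fst (fst p), snd (fst p))) ` mset_points M"
    proof
      fix I assume "I \<in># M"
      then have "(I, 0) \<in> mset_points M" by (simp add: pts)
      then show "I \<in> (\<lambda>p. (fst (fst p), snd (fst p))) ` mset_points M" by force
    qed
  qed (auto simp: pts)
  interpret interval_poset "mset_points M" "mset_order M" "\<lambda>p. fst (fst p)" "\<lambda>p. snd (fst p)"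
  proof
    show "finite (mset_points M)" unfolding pts by (intro finite_SigmaI) auto
    show "mset_points M \<noteq> {}" using im full_diag[OF assms] by auto
    show "mset_order M = {(x, y). (x, y) \<in> mset_points M \<times> mset_points M \<and> (x = y \<or> snd (fst x) < fst (fst y))}"
      by (auto simp: mset_order_def)
    show "fst (fst x) \<le> snd (fst x)" if "x \<in> mset_points M" for x
      using that assms by (auto simp: pts full_def)
  qed
  show ?thesis using chain_of_semiorder[of m] semiorder_of_chain assms unfolding im by blast
qed

lemma set_min_endpoint_rep:
  "finite X \<Longrightarrow> set_mset (min_endpoint_rep X r) = (\<lambda>x. (left_endpoint X r x, right_endpoint X r x)) ` X"
  by (simp add: min_endpoint_rep_def)

lemma semiorder_min_endpoint_rep:
  assumes fin: "finite X" and ne: "X \<noteq> {}" and semi: "semiorder_on X r"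
  shows "interval_poset X r (left_endpoint X r) (right_endpoint X r)"
    and "\<exists>m. full (set_mset (min_endpoint_rep X r)) m"
    and "chain (set_mset (min_endpoint_rep X r))"
proof -
  obtain lo hi where rep: "interval_representation X r lo hi"
    using semi unfolding semiorder_on_def by blast
  have po: "r \<subseteq> X \<times> X" "\<And>x. x \<in> X \<Longrightarrow> (x, x) \<in> r"
    using semi unfolding semiorder_on_def partial_order_on_def preorder_on_def refl_on_def by auto
  show ip: "interval_poset X r (left_endpoint X r) (right_endpoint X r)"
  proof
    have "(x, y) \<in> r \<longleftrightarrow> x = y \<or> right_endpoint X r x < left_endpoint X r y" if "x \<in> X" "y \<in> X" for x y
      using strictly_below_iff_endpoints[OF fin rep that] left_endpoint_le_right[OF fin rep that(1)] po(2)[OF that(1)]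
      by (auto simp: strictly_below_def)
    then show "r = {(x, y). (x, y) \<in> X \<times> X \<and> (x = y \<or> right_endpoint X r x < left_endpoint X r y)}"
      using po(1) by auto
  qed (use fin ne left_endpoint_le_right[OF fin rep] in auto)
  define t where "t = card (down_set X r ` X)"
  have t: "0 < t" using fin ne by (simp add: t_def card_gt_0_iff)
  then have "{..<t} = {..t - 1}" by auto
  then have full: "full (set_mset (min_endpoint_rep X r)) (t - 1)"
    using left_endpoints[OF fin rep] right_endpoints[OF fin rep] left_endpoint_le_right[OF fin rep]
    unfolding full_def set_min_endpoint_rep[OF fin] image_image by (auto simp: t_def)
  then show "\<exists>m. full (set_mset (min_endpoint_rep X r)) m" by blast
  show "chain (set_mset (min_endpoint_rep X r))"
    using interval_poset.chain_of_semiorder[OF ip _ semi] full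
    unfolding set_min_endpoint_rep[OF fin] by blast
qed

lemma hereditary_iff_not_bad:
  assumes fin: "finite X" and ne: "X \<noteq> {}" and semi: "semiorder_on X r"
  shows "hereditary X r \<longleftrightarrow> \<not> bad (set_mset (min_endpoint_rep X r))"
proof -
  let ?M = "min_endpoint_rep X r"
  obtain m where m: "full (set_mset ?M) m" using semiorder_min_endpoint_rep[OF assms] by blast
  \<comment> \<open>The representation is in the range of \<open>Psi_inv\<close>, so the
    \<open>inv_into\<close> in \<open>Psi\<close> returns a genuine preimage.\<close>
  have M: "?M \<in> Psi_inv ` {xs. ascent_sequence xs}" using Psi_inv_surj[OF m] by (metis imageI mem_Collect_eq)
  have xs: "ascent_sequence (Psi X r)" "Psi_inv (Psi X r) = ?M"
    unfolding Psi_def using inv_into_into[OF M] f_inv_into_f[OF M] by simp_all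
  have len: "length (Psi X r) = card X"
    using Psi_inv_full[OF xs(1)] xs(2) by (simp add: min_endpoint_rep_def)
  have asc: "ascent_sequence (take i (Psi X r))" if "1 \<le> i" "i \<le> card X" for i
    using xs(1) that len unfolding ascent_sequence_def by auto
  have "hereditary X r \<longleftrightarrow> (\<forall>i. 1 \<le> i \<and> i \<le> length (Psi X r) \<longrightarrow> chain (set_mset (Psi_inv (take i (Psi X r)))))"
    unfolding hereditary_def Let_def len
    using semi semiorder_mset_order_iff[OF conjunct1[OF Psi_inv_full[OF asc]]] by simp
  also have "\<dots> \<longleftrightarrow> \<not> bad (set_mset ?M)"
    using Psi_inv_prefixes_chain_iff[OF xs(1)] xs(2) semiorder_min_endpoint_rep(3)[OF assms] by simp
  finally show ?thesis .
qed

section \<open>Block structures\<close>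

text \<open>Each corner \<open>(b, b)\<close> shared by two blocks is attributed to the block starting there.\<close>

definition open_block :: "block \<Rightarrow> nat \<Rightarrow> (nat \<times> nat) set" where
  "open_block A b = block_intervals A b - {(b + subscript A, b + subscript A)}"

lemma open_block_BT1: "(x, y) \<in> open_block BT1 b \<longleftrightarrow> x = b \<and> y = b"
  by (auto simp: open_block_def)

lemma open_block_BW:
  "1 \<le> k \<Longrightarrow> (x, y) \<in> open_block (BW k) b \<longleftrightarrow> (x = b \<and> y = b) \<or> (y = x + 1 \<and> b \<le> x \<and> x < b + k)"
  by (auto simp: open_block_def intro!: bexI[of _ "x - b"])

lemma U_intervals:
  fixes b k x y :: nat
  assumes "2 \<le> k"
  shows "(x, y) \<in> (\<Union>i<k. {(b, b + i), (b + k - i, b + k)}) \<longleftrightarrow>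
    (x = b \<and> b \<le> y \<and> y < b + k) \<or> (y = b + k \<and> b < x \<and> x \<le> b + k)"
proof -
  have "(x = b \<and> b \<le> y \<and> y < b + k) \<longleftrightarrow> (\<exists>i<k. x = b \<and> y = b + i)"
    by (auto intro!: exI[of _ "y - b"])
  moreover have "(y = b + k \<and> b < x \<and> x \<le> b + k) \<longleftrightarrow> (\<exists>i<k. x = b + k - i \<and> y = b + k)"
    by (auto intro!: exI[of _ "b + k - x"])
  ultimately show ?thesis by auto
qed

lemma open_block_BU:
  "3 \<le> k \<Longrightarrow> (x, y) \<in> open_block (BU k) b \<longleftrightarrow>
    (x = b \<and> b \<le> y \<and> y < b + k) \<or> (y = b + k \<and> b < x \<and> x < b + k)"
  unfolding open_block_def block_intervals.simps Diff_iff by (subst U_intervals) auto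

lemma open_block_BC:
  "2 \<le> k \<Longrightarrow> (x, y) \<in> open_block (BC k) b \<longleftrightarrow>
    (x = b \<and> b \<le> y \<and> y \<le> b + k) \<or> (y = b + k \<and> b < x \<and> x < b + k)"
  unfolding open_block_def block_intervals.simps Diff_iff Un_iff by (subst U_intervals) auto

lemmas open_block_iff = open_block_BT1 open_block_BW open_block_BU open_block_BC

lemma subscript_pos: "nontrivial_block A \<Longrightarrow> 0 < subscript A"
  by (cases A) auto

lemma
  assumes "nontrivial_block A" "(x, y) \<in> open_block A b"
  shows open_block_bounds: "b \<le> x" "x < b + subscript A" "x \<le> y"
    and open_block_diag: "x = y \<Longrightarrow> x = b"
  using assms by (cases A; simp add: open_block_iff; auto)+

lemma open_block_start: "nontrivial_block A \<Longrightarrow> (b, b) \<in> open_block A b"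
  by (cases A) (auto simp: open_block_iff)

lemma block_intervals_eq:
  "nontrivial_block A \<Longrightarrow>
     block_intervals A b = insert (b + subscript A, b + subscript A) (open_block A b)"
proof -
  assume "nontrivial_block A"
  then have "(b + subscript A, b + subscript A) \<in> block_intervals A b"
    by (cases A) (auto intro!: bexI[of _ 0])
  then show ?thesis by (auto simp: open_block_def)
qed

lemma block_intervals_ends:
  assumes "nontrivial_block A" "A \<noteq> BT1"
  shows "(b, Suc b) \<in> block_intervals A b"
    and "(b + subscript A - 1, b + subscript A) \<in> block_intervals A b"
  using assms by (cases A; auto simp: block_intervals_eq open_block_iff simp del: block_intervals.simps)+

lemma superscript_0 [simp]: "superscript As 0 = 0"
  by (simp add: superscript_def)

lemma superscript_Suc [simp]: "superscript As (Suc j) = superscript As j + subscript (As ! j)"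
  by (simp add: superscript_def)

lemma superscript_Cons_Suc: "superscript (A # As) (Suc j) = subscript A + superscript As j"
  by (induction j) auto

lemma superscript_strict_mono:
  assumes "\<forall>A\<in>set As. nontrivial_block A" "i < j" "j \<le> length As"
  shows "superscript As i < superscript As j"
  using assms(2,3)
proof (induction j)
  case (Suc j)
  have "0 < subscript (As ! j)" using assms(1) Suc.prems by (intro subscript_pos) auto
  then show ?case using Suc by (cases "i = j") auto
qed simp

subsection \<open>Clusterings of block structures\<close>

text \<open>Every boundary is treated as strong. Weak boundaries only delete corners, and a
  clustering restricts to subsets, so it is enough to cluster this larger set.\<close>

fun blocks_from :: "nat \<Rightarrow> block list \<Rightarrow> (nat \<times> nat) set" where
  "blocks_from b [] = {(b, b)}"
| "blocks_from b (A # As) = open_block A b \<union> blocks_from (b + subscript A) As"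

lemma blocks_from_bounds:
  "\<forall>A\<in>set As. nontrivial_block A \<Longrightarrow> p \<in> blocks_from b As \<Longrightarrow> b \<le> fst p \<and> fst p \<le> snd p"
proof (induction As arbitrary: b)
  case (Cons A As)
  show ?case
  proof (cases "p \<in> open_block A b")
    case True
    then show ?thesis using open_block_bounds[of A "fst p" "snd p" b] Cons.prems(1) by simp
  next
    case False
    then show ?thesis using Cons.IH[of "b + subscript A"] Cons.prems by auto
  qed
qed simp

lemma blocks_from_start: "\<forall>A\<in>set As. nontrivial_block A \<Longrightarrow> (b, b) \<in> blocks_from b As"
  by (cases As) (auto simp: open_block_start)

lemma blocks_subset_blocks_from:
  "\<forall>A\<in>set As. nontrivial_block A \<Longrightarrow> j < length As \<Longrightarrow>
     block_intervals (As ! j) (b + superscript As j) \<subseteq> blocks_from b As"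
proof (induction As arbitrary: b j)
  case (Cons A As)
  show ?case
  proof (cases j)
    case 0
    then show ?thesis
      using Cons.prems(1) blocks_from_start[of As] by (auto simp: block_intervals_eq)
  next
    case (Suc i)
    then show ?thesis
      using Cons.IH[of i "b + subscript A"] Cons.prems
      by (auto simp: superscript_Cons_Suc add.assoc simp del: superscript_Suc)
  qed
qed simp

text \<open>The flag tells whether an initial block of type \<open>C\<close> is unconstrained, being the first
  block or preceded by \<open>BT1\<close>.\<close>

fun C_ok :: "bool \<Rightarrow> block list \<Rightarrow> bool" where
  "C_ok f [] \<longleftrightarrow> True"
| "C_ok f (A # As) \<longleftrightarrow> (is_BC A \<and> \<not> f \<longrightarrow> As = [] \<or> hd As = BT1) \<and> C_ok (A = BT1) As"

lemma C_okI:
  assumes "\<And>j. j < length As \<Longrightarrow> is_BC (As ! j) \<Longrightarrow> (j = 0 \<and> f) \<or> (0 < j \<and> As ! (j - 1) = BT1) \<or>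
    Suc j = length As \<or> As ! Suc j = BT1"
  shows "C_ok f As"
  using assms
proof (induction As arbitrary: f)
  case (Cons A As)
  have "C_ok (A = BT1) As"
  proof (rule Cons.IH)
    fix j assume "j < length As" "is_BC (As ! j)"
    then show "(j = 0 \<and> A = BT1) \<or> (0 < j \<and> As ! (j - 1) = BT1) \<or> Suc j = length As \<or> As ! Suc j = BT1"
      using Cons.prems[of "Suc j"] by (cases j) auto
  qed
  moreover have "is_BC A \<and> \<not> f \<Longrightarrow> As = [] \<or> hd As = BT1"
    using Cons.prems[of 0] by (cases As) auto
  ultimately show ?case by simp
qed simp

text \<open>\<open>O'\<close> and \<open>F\<close> have no column in common, so a cluster reaching
  into both must be a row. The offset \<open>c\<close> may be smaller than the number of clusters in
  \<open>O'\<close>, which is how a cluster gets shared.\<close>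

lemma clustering_append:
  assumes O: "\<And>p. p \<in> O' \<Longrightarrow> fst p < e" and F: "\<And>p. p \<in> F \<Longrightarrow> e \<le> fst p"
    and "clustering \<mu> O'" and "clustering \<kappa> F"
    and cross: "\<And>p q. p \<in> O' \<Longrightarrow> q \<in> F \<Longrightarrow> \<mu> p < \<kappa> q + c + 2 \<and>
      (\<mu> p = \<kappa> q + c \<longrightarrow> snd p = snd q) \<and> (\<mu> p + 2 \<le> \<kappa> q + c \<longrightarrow> snd p < fst q)"
  shows "clustering (\<lambda>p. if fst p < e then \<mu> p else \<kappa> p + c) (O' \<union> F)"
  unfolding clustering_def
proof (intro ballI)
  let ?\<kappa> = "\<lambda>p. if fst p < e then \<mu> p else \<kappa> p + c"
  fix p q assume "p \<in> O' \<union> F" "q \<in> O' \<union> F"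
  then consider "p \<in> O'" "q \<in> O'" | "p \<in> O'" "q \<in> F" | "p \<in> F" "q \<in> O'" | "p \<in> F" "q \<in> F" by blast
  then show "(?\<kappa> p = ?\<kappa> q \<longrightarrow> fst p = fst q \<or> snd p = snd q) \<and> (?\<kappa> p + 2 \<le> ?\<kappa> q \<longrightarrow> snd p < fst q)"
  proof cases
    case 1
    then show ?thesis using O assms(3) by (simp add: clustering_def)
  next
    case 2
    then have "?\<kappa> p = \<mu> p" "?\<kappa> q = \<kappa> q + c" using O F[of q] by auto
    then show ?thesis using cross[OF 2] by auto
  next
    case 3
    then have "?\<kappa> q = \<mu> q" "?\<kappa> p = \<kappa> p + c" using O F[of p] by auto
    then show ?thesis using cross[OF 3(2,1)] by auto
  next
    case 4
    then have "?\<kappa> p = \<kappa> p + c" "?\<kappa> q = \<kappa> q + c" using F[of p] F[of q] by auto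
    then show ?thesis using assms(4) 4 by (simp add: clustering_def)
  qed
qed

lemma clustering_binary:
  assumes "\<And>p q. p \<in> P \<Longrightarrow> q \<in> P \<Longrightarrow> Q p \<longleftrightarrow> Q q \<Longrightarrow> fst p = fst q \<or> snd p = snd q"
  shows "clustering (\<lambda>p. if Q p then 0 else 1) P"
  unfolding clustering_def
proof (intro ballI)
  fix p q assume "p \<in> P" "q \<in> P"
  then show "((if Q p then 0 else 1) = (if Q q then 0 else 1 :: nat) \<longrightarrow> fst p = fst q \<or> snd p = snd q) \<and>
      ((if Q p then 0 else 1) + 2 \<le> (if Q q then 0 else 1 :: nat) \<longrightarrow> snd p < fst q)"
    using assms[of p q] by auto
qed

text \<open>Clusters are columns, except that the descending side of a block of type \<open>U\<close> or \<open>C\<close> is a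
  row cluster. The top of a block of type \<open>C\<close> joins its column if nothing incomparable to it
  follows, and its row if nothing incomparable to it precedes.\<close>

lemma ex_clustering:
  assumes "\<forall>A\<in>set As. nontrivial_block A" "C_ok f As"
  shows "\<exists>\<kappa>. clustering \<kappa> (blocks_from b As) \<and>
    (\<not> f \<longrightarrow> (\<forall>p\<in>blocks_from b As. \<kappa> p = 0 \<longleftrightarrow> fst p = b))"
  using assms
proof (induction As arbitrary: b f)
  case Nil
  show ?case by (rule exI[of _ "\<lambda>_. 0"]) (simp add: clustering_def)
next
  case (Cons A As)
  define e where "e = b + subscript A"
  let ?O = "open_block A b" and ?F = "blocks_from e As"
  have nt: "nontrivial_block A" "\<forall>A\<in>set As. nontrivial_block A" using Cons.prems by auto
  \<comment> \<open>Unless \<open>A\<close> is \<open>BT1\<close>, cluster 0 of the rest is exactly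
    column \<open>e\<close>. All its other clusters begin beyond \<open>e\<close>, hence are
    comparable with everything in \<open>A\<close> that ends by \<open>e\<close>.\<close>
  obtain \<kappa> where \<kappa>: "clustering \<kappa> ?F"
    and \<kappa>0: "A \<noteq> BT1 \<Longrightarrow> p \<in> ?F \<Longrightarrow> \<kappa> p = 0 \<longleftrightarrow> fst p = e" for p
    using Cons.IH[of "A = BT1" e] Cons.prems by auto
  have O_less: "p \<in> ?O \<Longrightarrow> fst p < e" for p
    using open_block_bounds[OF nt(1), of "fst p" "snd p" b] by (simp add: e_def)
  have F_ge: "p \<in> ?F \<Longrightarrow> e \<le> fst p" for p using blocks_from_bounds[OF nt(2)] by blast
  have e: "b < e" using subscript_pos[OF nt(1)] by (simp add: e_def)
  have goal: ?case if "clustering \<kappa>1 ?O"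
    and "\<And>p q. p \<in> ?O \<Longrightarrow> q \<in> ?F \<Longrightarrow> \<kappa>1 p < \<kappa> q + c + 2 \<and>
      (\<kappa>1 p = \<kappa> q + c \<longrightarrow> snd p = snd q) \<and> (\<kappa>1 p + 2 \<le> \<kappa> q + c \<longrightarrow> snd p < fst q)"
    and "\<And>p. p \<in> ?O \<Longrightarrow> \<kappa>1 p = 0 \<longleftrightarrow> fst p = b" "0 < c" for \<kappa>1 c
  proof (intro exI conjI impI ballI)
    show "clustering (\<lambda>p. if fst p < e then \<kappa>1 p else \<kappa> p + c) (blocks_from b (A # As))"
      using clustering_append[OF O_less F_ge that(1) \<kappa> that(2)] by (simp add: e_def)
    fix p assume "p \<in> blocks_from b (A # As)"
    then consider "p \<in> ?O" | "p \<in> ?F" by (auto simp: e_def)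
    then show "(if fst p < e then \<kappa>1 p else \<kappa> p + c) = 0 \<longleftrightarrow> fst p = b"
    proof cases
      case 1 then show ?thesis using that(3) O_less by simp
    next
      case 2 then show ?thesis using F_ge[of p] that(4) e by simp
    qed
  qed
  show ?case
  proof (cases A)
    case BT0
    then show ?thesis using nt by simp
  next
    case BT1
    have O: "fst p = b \<and> snd p = b" if "p \<in> ?O" for p
      using that open_block_BT1[of "fst p" "snd p" b] by (simp add: BT1)
    show ?thesis
    proof (rule goal[of "\<lambda>_. 0" 1])
      show "clustering (\<lambda>_. 0) ?O" unfolding clustering_def using O by simp
      show "0 < \<kappa> q + 1 + 2 \<and> (0 = \<kappa> q + 1 \<longrightarrow> snd p = snd q) \<and> (0 + 2 \<le> \<kappa> q + 1 \<longrightarrow> snd p < fst q)"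
        if "p \<in> ?O" "q \<in> ?F" for p q
        using O[OF that(1)] F_ge[OF that(2)] e by simp
    qed (use O in simp_all)
  next
    case (BW k)
    then have k: "1 \<le> k" "e = b + k" using nt by (auto simp: e_def)
    have O: "(fst p = b \<and> snd p = b) \<or> (snd p = fst p + 1 \<and> b \<le> fst p \<and> fst p < b + k)" if "p \<in> ?O" for p
      using that open_block_BW[OF k(1), of "fst p" "snd p" b] by (simp add: BW)
    show ?thesis
    proof (rule goal[of "\<lambda>p. fst p - b" k])
      show "clustering (\<lambda>p. fst p - b) ?O" unfolding clustering_def
      proof (intro ballI)
        fix p q assume "p \<in> ?O" "q \<in> ?O"
        then show "(fst p - b = fst q - b \<longrightarrow> fst p = fst q \<or> snd p = snd q) \<and>
            (fst p - b + 2 \<le> fst q - b \<longrightarrow> snd p < fst q)"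
          using O[of p] O[of q] by auto
      qed
      show "fst p - b < \<kappa> q + k + 2 \<and> (fst p - b = \<kappa> q + k \<longrightarrow> snd p = snd q) \<and>
          (fst p - b + 2 \<le> \<kappa> q + k \<longrightarrow> snd p < fst q)" if "p \<in> ?O" "q \<in> ?F" for p q
        using O[OF that(1)] F_ge[OF that(2)] \<kappa>0[OF _ that(2)] k by (cases "\<kappa> q = 0") (auto simp: BW)
      show "fst p - b = 0 \<longleftrightarrow> fst p = b" if "p \<in> ?O" for p using O[OF that] by auto
      show "0 < k" using k by simp
    qed
  next
    case (BU k)
    then have k: "3 \<le> k" "e = b + k" using nt by (auto simp: e_def)
    have O: "(fst p = b \<and> snd p < b + k) \<or> (fst p \<noteq> b \<and> snd p = b + k)" if "p \<in> ?O" for p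
      using that open_block_BU[OF k(1), of "fst p" "snd p" b] by (auto simp: BU)
    show ?thesis
    proof (rule goal[of "\<lambda>p. if fst p = b then 0 else 1" 2])
      show "clustering (\<lambda>p. if fst p = b then 0 else 1) ?O"
      proof (rule clustering_binary)
        fix p q assume "p \<in> ?O" "q \<in> ?O" "(fst p = b) = (fst q = b)"
        then show "fst p = fst q \<or> snd p = snd q" using O[of p] O[of q] by auto
      qed
      show "(if fst p = b then 0 else 1) < \<kappa> q + 2 + 2 \<and>
          ((if fst p = b then 0 else 1) = \<kappa> q + 2 \<longrightarrow> snd p = snd q) \<and>
          ((if fst p = b then 0 else 1) + 2 \<le> \<kappa> q + 2 \<longrightarrow> snd p < fst q)" if "p \<in> ?O" "q \<in> ?F" for p q
        using O[OF that(1)] F_ge[OF that(2)] \<kappa>0[OF _ that(2)] k by (cases "\<kappa> q = 0") (auto simp: BU)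
    qed auto
  next
    case (BC k)
    then have k: "2 \<le> k" "e = b + k" using nt by (auto simp: e_def)
    have O: "(fst p = b \<and> snd p \<le> b + k) \<or> (fst p \<noteq> b \<and> snd p = b + k)" if "p \<in> ?O" for p
      using that open_block_BC[OF k(1), of "fst p" "snd p" b] by (auto simp: BC)
    show ?thesis
    proof (cases f)
      case True
      let ?\<kappa>1 = "\<lambda>p. if fst p = b \<and> snd p < b + k then 0 else 1 :: nat"
      have c1: "clustering ?\<kappa>1 ?O"
      proof (rule clustering_binary)
        fix p q assume "p \<in> ?O" "q \<in> ?O" "(fst p = b \<and> snd p < b + k) = (fst q = b \<and> snd q < b + k)"
        then show "fst p = fst q \<or> snd p = snd q" using O[of p] O[of q] by auto
      qed
      have c2: "?\<kappa>1 p < \<kappa> q + 2 + 2 \<and> (?\<kappa>1 p = \<kappa> q + 2 \<longrightarrow> snd p = snd q) \<and>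
          (?\<kappa>1 p + 2 \<le> \<kappa> q + 2 \<longrightarrow> snd p < fst q)" if "p \<in> ?O" "q \<in> ?F" for p q
        using O[OF that(1)] F_ge[OF that(2)] \<kappa>0[OF _ that(2)] k by (cases "\<kappa> q = 0") (auto simp: BC)
      have "clustering (\<lambda>p. if fst p < e then ?\<kappa>1 p else \<kappa> p + 2) (?O \<union> ?F)"
        by (rule clustering_append[OF O_less F_ge c1 \<kappa> c2])
      then show ?thesis using True by (auto simp: e_def)
    next
      case False
      \<comment> \<open>Column \<open>e\<close> holds only \<open>(e, e)\<close>, which therefore
        joins the row cluster of the block. This makes the offset 1; with offset 2 the top
        \<open>(b, e)\<close> in cluster 0 would meet \<open>(e, e)\<close> in cluster 2.\<close>
      have F_start: "snd q = e" if q: "q \<in> ?F" "fst q = e" for q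
      proof (cases As)
        case Nil
        then show ?thesis using q by simp
      next
        case (Cons B Bs)
        then have B: "B = BT1" using Cons.prems(2) False BC by simp
        show ?thesis
        proof (cases "q \<in> open_block BT1 e")
          case True
          then show ?thesis using open_block_BT1[of "fst q" "snd q" e] by simp
        next
          case False
          then show ?thesis
            using blocks_from_bounds[of Bs q "e + 1"] q nt(2) Cons B by simp
        qed
      qed
      show ?thesis
      proof (rule goal[of "\<lambda>p. if fst p = b then 0 else 1" 1])
        show "clustering (\<lambda>p. if fst p = b then 0 else 1) ?O"
      proof (rule clustering_binary)
        fix p q assume "p \<in> ?O" "q \<in> ?O" "(fst p = b) = (fst q = b)"
        then show "fst p = fst q \<or> snd p = snd q" using O[of p] O[of q] by auto
      qed
        show "(if fst p = b then 0 else 1) < \<kappa> q + 1 + 2 \<and>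
            ((if fst p = b then 0 else 1) = \<kappa> q + 1 \<longrightarrow> snd p = snd q) \<and>
            ((if fst p = b then 0 else 1) + 2 \<le> \<kappa> q + 1 \<longrightarrow> snd p < fst q)" if "p \<in> ?O" "q \<in> ?F" for p q
          using O[OF that(1)] F_ge[OF that(2)] \<kappa>0[OF _ that(2)] k F_start[OF that(2)]
          by (cases "\<kappa> q = 0") (auto simp: BC)
      qed auto
    qed
  qed
qed

subsection \<open>Obstructions in block structures\<close>

lemma struct_intervals_nondiag:
  "(x, y) \<in> block_intervals (As ! j) (superscript As j) \<Longrightarrow> x \<noteq> y \<Longrightarrow> j < length As \<Longrightarrow>
     (x, y) \<in> struct_intervals (As, Bs)"
  by auto

text \<open>If the block before the boundary ends at \<open>e\<close>, its type gives
  \<open>(e - 2, e)\<close> and \<open>(e - 1, e)\<close>; for \<open>BC 2\<close> the former is the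
  top. With the optional \<open>(e - 1, e + 1)\<close> these are the three points of
  \<open>valley_not_orientable\<close>.\<close>

lemma optional_not_orientable:
  assumes P: "full (struct_intervals S) m" "chain (struct_intervals S)"
    and S: "valid_block_struct S" "\<not> no_optional_elements S"
  shows "\<not> orientable (struct_intervals S)"
proof -
  obtain As Bs where S': "S = (As, Bs)" by fastforce
  obtain j where j: "j < length Bs" "Bs ! j = Weak_Optional"
    using S(2) by (auto simp: S' no_optional_elements_def in_set_conv_nth)
  then have v: "\<forall>A\<in>set As. nontrivial_block A" "j < length As"
    "boundary_allowed (As ! j) (Bs ! j) (As ! Suc j)"
    using S(1) by (auto simp: S')
  define k c where "k = subscript (As ! j)" and "c = superscript As j"
  have A: "(As ! j = BC k \<and> 2 \<le> k) \<or> (As ! j = BU k \<and> 3 \<le> k)"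
    using v j(2) nth_mem[OF v(2)] by (cases "As ! j") (auto simp: k_def)
  have "(c + k - 2, c + k) \<in> block_intervals (As ! j) c" "(c + k - 1, c + k) \<in> block_intervals (As ! j) c"
    using A by (auto simp: block_intervals_eq open_block_iff simp del: block_intervals.simps)
  then have "(c + k - 2, c + k) \<in> struct_intervals S" "(c + k - 1, c + k) \<in> struct_intervals S"
    unfolding S' using A v(2) by (auto intro!: struct_intervals_nondiag simp: c_def simp del: struct_intervals.simps)
  moreover have "(c + k - 1, c + k + 1) \<in> struct_intervals S"
    using j by (auto simp: S' c_def k_def)
  moreover obtain i where "k = i + 2" using A by (metis add.commute le_Suc_ex Suc_leD numeral_3_eq_3 numeral_2_eq_2)
  ultimately show ?thesis using valley_not_orientable[OF P, of "c + i"] by (simp add: numeral_eq_Suc)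
qed

text \<open>Neighbours other than \<open>BT1\<close> supply the intervals of length 1 on either side
  of the block. All five points taken from the blocks are off the diagonal, so no weak boundary has
  deleted them.\<close>

lemma inner_C_struct_not_orientable:
  assumes P: "full (struct_intervals S) m"
    and S: "valid_block_struct S" "\<not> inner_C_next_to_T1 S"
  shows "\<not> orientable (struct_intervals S)"
proof -
  obtain As Bs where S': "S = (As, Bs)" by fastforce
  obtain j where j: "0 < j" "Suc j < length As" "is_BC (As ! j)" "As ! (j - 1) \<noteq> BT1" "As ! Suc j \<noteq> BT1"
    using S(2) by (auto simp: S' inner_C_next_to_T1_def)
  then have "As \<noteq> [BT0]" by auto
  then have nt: "nontrivial_block (As ! i)" if "i < length As" for i
    using S(1) that by (auto simp: S')
  obtain i where i: "j = Suc i" using j(1) by (cases j) auto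
  obtain k where k: "As ! j = BC k" using j(3) by (cases "As ! j") auto
  have k2: "2 \<le> k" using nt[of j] j k by simp
  have len: "i < length As" "j < length As" "Suc j < length As" using j i by auto
  define b where "b = superscript As j - 1"
  have sub: "0 < subscript (As ! i)" using subscript_pos nt len by blast
  then have b: "superscript As j = Suc b" by (simp add: b_def i)
  have nondiag: "(x, y) \<in> struct_intervals S"
    if "(x, y) \<in> block_intervals (As ! t) (superscript As t)" "x \<noteq> y" "t < length As" for x y t
    using struct_intervals_nondiag[OF that] by (simp add: S' del: struct_intervals.simps)
  have "(b, Suc b) \<in> struct_intervals S"
    using block_intervals_ends(2)[OF nt[OF len(1)], of "superscript As i"] j(4) b sub len
    by (intro nondiag[of _ _ i]) (auto simp: i)
  moreover have "(Suc b, b + k) \<in> struct_intervals S" "(Suc b, Suc b + k) \<in> struct_intervals S"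
    "(b + 2, Suc b + k) \<in> struct_intervals S"
    using len k2 nt[OF len(2)]
    by (auto intro!: nondiag[of _ _ j] simp: b k block_intervals_eq open_block_iff simp del: block_intervals.simps)
  moreover have "(Suc b + k, b + k + 2) \<in> struct_intervals S"
    using block_intervals_ends(1)[OF nt[OF len(3)], of "superscript As (Suc j)"] j(5) len
    by (intro nondiag[of _ _ "Suc j"]) (auto simp: b k)
  ultimately show ?thesis using inner_C_not_orientable[OF P _ _ _ _ _ k2] by blast
qed

subsection \<open>Parsing a lattice path into blocks\<close>

text \<open>A block structure as a list of blocks, each paired with the boundary before it; the first
  boundary is \<open>Strong\<close>.\<close>

fun struct_from :: "nat \<Rightarrow> (boundary \<times> block) list \<Rightarrow> (nat \<times> nat) set" where
  "struct_from b [] = {(b, b)}"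
| "struct_from b ((\<beta>, A) # zs) =
     (open_block A b - (if \<beta> = Strong then {} else {(b, b)})) \<union>
     (if \<beta> = Weak_Optional then {(b - 1, b + 1)} else {}) \<union> struct_from (b + subscript A) zs"

abbreviation linked :: "(boundary \<times> block) list \<Rightarrow> bool" where
  "linked \<equiv> successively (\<lambda>x y. boundary_allowed (snd x) (fst y) (snd y))"

lemma struct_from_iff:
  "p \<in> struct_from b zs \<longleftrightarrow>
     (\<exists>j<length zs. let s = b + superscript (map snd zs) j in
        p \<in> open_block (snd (zs ! j)) s \<and> (fst (zs ! j) \<noteq> Strong \<longrightarrow> p \<noteq> (s, s)) \<or>
        fst (zs ! j) = Weak_Optional \<and> p = (s - 1, s + 1)) \<or>
     p = (b + superscript (map snd zs) (length zs), b + superscript (map snd zs) (length zs))"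
proof (induction zs arbitrary: b)
  case (Cons z zs)
  obtain \<beta> A where z: "z = (\<beta>, A)" by fastforce
  show ?case
    unfolding z struct_from.simps Un_iff Cons.IH length_Cons Ex_less_Suc2 nth_Cons_0 nth_Cons_Suc list.map
      superscript_Cons_Suc superscript_0 Let_def snd_conv fst_conv add.assoc[symmetric]
    by auto
qed simp

text \<open>A deleted corner belongs to two closed blocks but to only one open block, the one
  starting there. Superscripts strictly increase, so deleting a corner never hits the diagonal point
  of another open block.\<close>

lemma struct_intervals_eq_struct_from:
  assumes nt: "\<forall>z\<in>set zs. nontrivial_block (snd z)" and ne: "zs \<noteq> []" and hd: "fst (hd zs) = Strong"
  shows "struct_intervals (map snd zs, map fst (tl zs)) = struct_from 0 zs"
proof -
  define As s where "As = map snd zs" and "s = superscript As"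
  have ntA: "\<forall>A\<in>set As. nontrivial_block A" using nt by (auto simp: As_def)
  have lenA: "length As = length zs" by (simp add: As_def)
  have mono: "i < j \<Longrightarrow> j \<le> length zs \<Longrightarrow> s i < s j" for i j
    using superscript_strict_mono[OF ntA, of i j] by (simp add: lenA s_def)
  have s_inj: "s i = s j \<Longrightarrow> i \<le> length zs \<Longrightarrow> j \<le> length zs \<Longrightarrow> i = j" for i j
    using mono[of i j] mono[of j i] by (cases i j rule: linorder_cases) auto
  have nth: "As ! j = snd (zs ! j)" "nontrivial_block (snd (zs ! j))" if "j < length zs" for j
    using that nt by (auto simp: As_def)
  have Suc: "s (Suc j) = s j + subscript (snd (zs ! j))" if "j < length zs" for j
    using nth[OF that] by (simp add: s_def)
  have tl_nth: "map fst (tl zs) ! j = fst (zs ! Suc j)" if "Suc j < length zs" for j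
    using that by (simp add: nth_tl)
  have lt: "j < length (map fst (tl zs)) \<longleftrightarrow> Suc j < length zs" for j by auto
  have first: "fst (zs ! 0) = Strong" using hd ne by (simp add: hd_conv_nth)
  have L: "p \<in> struct_intervals (As, map fst (tl zs)) \<longleftrightarrow>
      (\<exists>j<length zs. p \<in> block_intervals (snd (zs ! j)) (s j)) \<and>
      \<not> (\<exists>j. Suc j < length zs \<and> fst (zs ! Suc j) \<noteq> Strong \<and> p = (s (Suc j), s (Suc j))) \<or>
      (\<exists>j. Suc j < length zs \<and> fst (zs ! Suc j) = Weak_Optional \<and> p = (s (Suc j) - 1, s (Suc j) + 1))" for p
    unfolding struct_intervals.simps s_def[symmetric] lt Un_iff Diff_iff lenA
    using tl_nth nth by (auto simp del: block_intervals.simps)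
  have R: "p \<in> struct_from 0 zs \<longleftrightarrow>
     (\<exists>j<length zs. p \<in> open_block (snd (zs ! j)) (s j) \<and> (fst (zs ! j) \<noteq> Strong \<longrightarrow> p \<noteq> (s j, s j)) \<or>
        fst (zs ! j) = Weak_Optional \<and> p = (s j - 1, s j + 1)) \<or>
     p = (s (length zs), s (length zs))" for p
    unfolding struct_from_iff[of p 0] Let_def by (simp add: s_def As_def)
  have opt: "(\<exists>j. Suc j < length zs \<and> fst (zs ! Suc j) = Weak_Optional \<and> p = (s (Suc j) - 1, s (Suc j) + 1)) \<longleftrightarrow>
      (\<exists>j<length zs. fst (zs ! j) = Weak_Optional \<and> p = (s j - 1, s j + 1))" for p
    using first by (metis Suc_lessD boundary.distinct(3) not0_implies_Suc)
  have core: "(\<exists>j<length zs. p \<in> block_intervals (snd (zs ! j)) (s j)) \<and>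
      \<not> (\<exists>j. Suc j < length zs \<and> fst (zs ! Suc j) \<noteq> Strong \<and> p = (s (Suc j), s (Suc j))) \<longleftrightarrow>
      (\<exists>j<length zs. p \<in> open_block (snd (zs ! j)) (s j) \<and> (fst (zs ! j) \<noteq> Strong \<longrightarrow> p \<noteq> (s j, s j))) \<or>
      p = (s (length zs), s (length zs))" for p
  proof
    assume l: "(\<exists>j<length zs. p \<in> block_intervals (snd (zs ! j)) (s j)) \<and>
      \<not> (\<exists>j. Suc j < length zs \<and> fst (zs ! Suc j) \<noteq> Strong \<and> p = (s (Suc j), s (Suc j)))"
    then obtain j where j: "j < length zs" "p \<in> block_intervals (snd (zs ! j)) (s j)" by blast
    consider "p \<in> open_block (snd (zs ! j)) (s j)" | "p = (s (Suc j), s (Suc j))"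
      using j(2) Suc[OF j(1)] by (auto simp: block_intervals_eq[OF nth(2)[OF j(1)]])
    then show "(\<exists>j<length zs. p \<in> open_block (snd (zs ! j)) (s j) \<and> (fst (zs ! j) \<noteq> Strong \<longrightarrow> p \<noteq> (s j, s j))) \<or>
      p = (s (length zs), s (length zs))"
    proof cases
      case 1
      have "p \<noteq> (s j, s j)" if "fst (zs ! j) \<noteq> Strong"
      proof -
        obtain i where "j = Suc i" using \<open>fst (zs ! j) \<noteq> Strong\<close> first by (cases j) auto
        then show ?thesis using l that j(1) by auto
      qed
      then show ?thesis using 1 j(1) by blast
    next
      case 2
      show ?thesis
      proof (cases "Suc j = length zs")
        case True
        then show ?thesis using 2 by simp
      next
        case False
        then have lt: "Suc j < length zs" using j(1) by simp
        then have "fst (zs ! Suc j) = Strong" using l 2 by blast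
        then show ?thesis using lt 2 open_block_start[OF nth(2)[OF lt]] by blast
      qed
    qed
  next
    assume "(\<exists>j<length zs. p \<in> open_block (snd (zs ! j)) (s j) \<and> (fst (zs ! j) \<noteq> Strong \<longrightarrow> p \<noteq> (s j, s j))) \<or>
      p = (s (length zs), s (length zs))"
    then consider j where "j < length zs" "p \<in> open_block (snd (zs ! j)) (s j)"
        "fst (zs ! j) \<noteq> Strong \<longrightarrow> p \<noteq> (s j, s j)"
      | "p = (s (length zs), s (length zs))" by blast
    then show "(\<exists>j<length zs. p \<in> block_intervals (snd (zs ! j)) (s j)) \<and>
      \<not> (\<exists>j. Suc j < length zs \<and> fst (zs ! Suc j) \<noteq> Strong \<and> p = (s (Suc j), s (Suc j)))"
    proof cases
      case 1
      have "\<not> (Suc i < length zs \<and> fst (zs ! Suc i) \<noteq> Strong \<and> p = (s (Suc i), s (Suc i)))" for i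
      proof
        assume i: "Suc i < length zs \<and> fst (zs ! Suc i) \<noteq> Strong \<and> p = (s (Suc i), s (Suc i))"
        then have "s (Suc i) = s j" using open_block_diag[OF nth(2)[OF 1(1)]] 1(2) by blast
        then have "Suc i = j" using s_inj i 1(1) by simp
        then show False using i 1(3) by auto
      qed
      moreover have "p \<in> block_intervals (snd (zs ! j)) (s j)" using 1(2) by (simp add: open_block_def)
      ultimately show ?thesis using 1(1) by blast
    next
      case 2
      obtain n where n: "length zs = Suc n" using ne by (cases zs) auto
      then have "p \<in> block_intervals (snd (zs ! n)) (s n)"
        using 2 Suc[of n] block_intervals_eq[OF nth(2)[of n]] by simp
      moreover have "s (Suc i) \<noteq> s (length zs)" if "Suc i < length zs" for i
        using mono[of "Suc i" "length zs"] that by simp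
      then have "\<not> (\<exists>i. Suc i < length zs \<and> fst (zs ! Suc i) \<noteq> Strong \<and> p = (s (Suc i), s (Suc i)))"
        using 2 by fastforce
      moreover have "n < length zs" using n by simp
      ultimately show ?thesis by blast
    qed
  qed
  show ?thesis unfolding As_def[symmetric]
  proof (rule set_eqI)
    fix p
    show "p \<in> struct_intervals (As, map fst (tl zs)) \<longleftrightarrow> p \<in> struct_from 0 zs"
      unfolding L R core opt by blast
  qed
qed

section \<open>Reading off one block at a time\<close>

text \<open>The kind of a boundary is visible in the path near \<open>(b, b)\<close>: the path
  visits the corner, bypasses it by the diagonal step from \<open>(b - 1, b)\<close> to
  \<open>(b, b + 1)\<close>, or makes a detour through \<open>(b - 1, b + 1)\<close>.\<close>

definition boundary_at :: "(nat \<times> nat) set \<Rightarrow> boundary \<Rightarrow> nat \<Rightarrow> bool" where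
  "boundary_at P \<beta> b \<longleftrightarrow> (case \<beta> of
      Strong \<Rightarrow> (b, b) \<in> P
    | Weak \<Rightarrow> 1 \<le> b \<and> (b, b) \<notin> P \<and> (b - 1, b + 1) \<notin> P \<and> (b - 1, b) \<in> P \<and> (b, b + 1) \<in> P
    | Weak_Optional \<Rightarrow> 1 \<le> b \<and> (b, b) \<notin> P \<and> (b - 1, b + 1) \<in> P \<and> (b - 1, b) \<in> P \<and> (b, b + 1) \<in> P)"

lemma boundary_at_simps:
  "boundary_at P Strong b \<longleftrightarrow> (b, b) \<in> P"
  "boundary_at P Weak b \<longleftrightarrow> 1 \<le> b \<and> (b, b) \<notin> P \<and> (b - 1, b + 1) \<notin> P \<and> (b - 1, b) \<in> P \<and> (b, b + 1) \<in> P"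
  "boundary_at P Weak_Optional b \<longleftrightarrow> 1 \<le> b \<and> (b, b) \<notin> P \<and> (b - 1, b + 1) \<in> P \<and> (b - 1, b) \<in> P \<and> (b, b + 1) \<in> P"
  by (simp_all add: boundary_at_def)

context
  fixes P :: "(nat \<times> nat) set" and m :: nat
  assumes full: "full P m" and chain: "chain P" and not_bad: "\<not> bad P"
begin

text \<open>A jump of more than one row into column \<open>a + 1\<close> would skip row
  \<open>b + 1\<close>, which by the chain property can be met only in column \<open>a\<close> or
  \<open>a + 1\<close>.\<close>

lemma path_step:
  assumes "(a, b) \<in> P" "a < m"
  shows "(a, b + 1) \<in> P \<or> (a + 1, b) \<in> P \<or> (a + 1, b + 1) \<in> P"
proof -
  have "a + 1 \<le> m" using assms by simp
  then obtain c where c: "(a + 1, c) \<in> P" using full_column[OF full] by blast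
  have "b \<le> c" using chainD[OF chain assms(1) c] by simp
  show ?thesis
  proof (cases "c \<le> b + 1")
    case True
    then show ?thesis using c \<open>b \<le> c\<close> by (cases "c = b") (auto simp: le_Suc_eq)
  next
    case False
    then have "b + 1 \<le> m" using fullD(2)[OF full c] by simp
    then obtain d where d: "(d, b + 1) \<in> P" using full_row[OF full] by blast
    have "\<not> d < a" using chainD[OF chain d assms(1)] by auto
    moreover have "\<not> a + 1 < d" using chainD[OF chain c d] False by auto
    ultimately have "d = a \<or> d = a + 1" by linarith
    then show ?thesis using d by blast
  qed
qed

lemma column_convex:
  assumes "(a, x) \<in> P" "(a, z) \<in> P" "x \<le> y" "y \<le> z"
  shows "(a, y) \<in> P"
proof -
  have "y \<le> m" using fullD(2)[OF full assms(2)] assms(4) by simp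
  then obtain d where d: "(d, y) \<in> P" using full_row[OF full] by blast
  consider "d < a" | "d = a" | "a < d" by linarith
  then show ?thesis
  proof cases
    case 1
    then have "y = x" using chainD[OF chain d assms(1)] assms(3) by simp
    then show ?thesis using assms(1) by simp
  next
    case 3
    then have "y = z" using chainD[OF chain assms(2) d] assms(4) by simp
    then show ?thesis using assms(2) by simp
  qed (use d in simp)
qed

lemma not_badD:
  assumes "c < a" "a + 2 \<le> b" "(c, a + 1) \<in> P" "(a, b) \<in> P"
  shows "\<exists>d\<le>b. (a + 1, d) \<in> P"
  using not_bad assms unfolding bad_def by (metis not_less)

lemma boundary_at_cases:
  assumes "boundary_at P \<beta> b" "b < m"
  shows "\<beta> = Strong \<longleftrightarrow> (b, b) \<in> P" "(b, b) \<in> P \<or> (b, b + 1) \<in> P"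
  using assms by (cases \<beta>; simp add: boundary_at_simps)+

text \<open>An optional interval after the block lies in its last column \<open>e - 1\<close>,
  although \<open>struct_from\<close> charges it to the boundary before the next block; hence the
  exception in the description of the columns. The last clauses record what both neighbours need for
  \<open>boundary_allowed\<close>; in particular \<open>(e, e + 2) \<in> P\<close> keeps two blocks
  of type \<open>W\<close> from meeting at a weak boundary.\<close>

definition parses_as :: "boundary \<Rightarrow> nat \<Rightarrow> block \<Rightarrow> boundary \<Rightarrow> bool" where
  "parses_as \<beta> b A \<beta>' \<longleftrightarrow> (let e = b + subscript A in
     nontrivial_block A \<and> e \<le> m \<and> boundary_at P \<beta>' e \<and>
     (\<forall>x y. b \<le> x \<and> x < e \<longrightarrow> ((x, y) \<in> P \<longleftrightarrow>
        (x, y) \<in> open_block A b \<and> (\<beta> \<noteq> Strong \<longrightarrow> (x, y) \<noteq> (b, b)) \<or>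
        \<beta>' = Weak_Optional \<and> (x, y) = (e - 1, e + 1))) \<and>
     (A = BT1 \<longleftrightarrow> (b, b + 1) \<notin> P) \<and>
     (is_BW A \<longleftrightarrow> (b, b + 1) \<in> P \<and> (b, b + 2) \<notin> P) \<and>
     (\<beta> = Weak_Optional \<longrightarrow> is_BW A \<or> A = BC 2) \<and>
     (\<beta>' = Weak \<longrightarrow> A \<noteq> BT1 \<and> (is_BW A \<longrightarrow> (e, e + 2) \<in> P)) \<and>
     (\<beta>' = Weak_Optional \<longrightarrow> is_BC A \<or> is_BU A))"

lemma ex_parse_T1:
  assumes \<beta>: "boundary_at P \<beta> b" and b: "b < m" and "(b, b + 1) \<notin> P"
  shows "parses_as \<beta> b BT1 Strong"
proof -
  have bb: "(b, b) \<in> P" "\<beta> = Strong" using boundary_at_cases[OF \<beta> b] assms(3) by auto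
  have "y = b" if "(b, y) \<in> P" for y
  proof (rule ccontr)
    assume "y \<noteq> b"
    then have "b + 1 \<le> y" using fullD(1)[OF full that] by simp
    then show False using column_convex[OF bb(1) that, of "b + 1"] assms(3) by simp
  qed
  moreover have "(b + 1, b + 1) \<in> P"
    using path_step[OF bb(1) b] assms(3) fullD(1)[OF full, of "b + 1" b] by auto
  ultimately show ?thesis
    unfolding parses_as_def Let_def using b bb assms(3)
    by (auto simp: boundary_at_simps open_block_iff le_less_Suc_eq)
qed

text \<open>The block is taken as long as possible, up to the first column \<open>e\<close> that
  does not consist of \<open>(e, e + 1)\<close> alone. By this maximality, if the corner at
  \<open>e\<close> is missing, column \<open>e\<close> reaches row \<open>e + 2\<close>, so the
  block after the weak boundary is not of type \<open>W\<close>.\<close>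

lemma ex_parse_W:
  assumes \<beta>: "boundary_at P \<beta> b" and b: "b < m" and b1: "(b, b + 1) \<in> P" and b2: "(b, b + 2) \<notin> P"
  shows "\<exists>A \<beta>'. parses_as \<beta> b A \<beta>'"
proof -
  note D = fullD[OF full]
  have top: "y \<le> b + 1" if "(b, y) \<in> P" for y
    using column_convex[OF b1 that, of "b + 2"] b2 by (cases "b + 2 \<le> y") auto
  define inner where "inner x \<longleftrightarrow> (x, x + 1) \<in> P \<and> (\<forall>y. (x, y) \<in> P \<longrightarrow> y = x + 1)" for x
  \<comment> \<open>The run of such columns must stop, since \<open>(m, m + 1)\<close> is off the
    path.\<close>
  have "b < m \<and> \<not> inner m" using b D(2)[of m "m + 1"] by (auto simp: inner_def)
  define e where "e = (LEAST x. b < x \<and> \<not> inner x)"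
  have e: "b < e" "\<not> inner e"
    using LeastI[of "\<lambda>x. b < x \<and> \<not> inner x", OF \<open>b < m \<and> \<not> inner m\<close>] by (auto simp: e_def)
  have em: "e \<le> m" unfolding e_def using \<open>b < m \<and> \<not> inner m\<close> by (rule Least_le)
  have inner: "inner x" if "b < x" "x < e" for x
    using not_less_Least[of x "\<lambda>x. b < x \<and> \<not> inner x"] that by (auto simp: e_def)
  define k where "k = e - b"
  have k: "1 \<le> k" "e = b + k" using e(1) by (auto simp: k_def)
  have col: "(x, y) \<in> P \<longleftrightarrow> y = x + 1 \<or> (x = b \<and> y = b \<and> \<beta> = Strong)" if "b \<le> x" "x < e" for x y
  proof (cases "x = b")
    case True
    show ?thesis
      using top[of y] D(1)[of b y] b1 boundary_at_cases(1)[OF \<beta> b] by (auto simp: True le_Suc_eq)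
  next
    case False
    then show ?thesis using inner[of x] that by (auto simp: inner_def)
  qed
  have end_P: "(e - 1, e) \<in> P" using col[of "e - 1" e] e(1) by simp
  have no_opt: "(e - 1, e + 1) \<notin> P" using col[of "e - 1" "e + 1"] e(1) by auto
  have blk: "(x, y) \<in> P \<longleftrightarrow> (x, y) \<in> open_block (BW k) b \<and> (\<beta> \<noteq> Strong \<longrightarrow> (x, y) \<noteq> (b, b))"
    if "b \<le> x" "x < e" for x y
    using col[OF that, of y] that k by (auto simp: open_block_BW)
  have "(e, e) \<in> P \<or> (e, e + 1) \<in> P"
    using path_step[OF end_P] em e(1) no_opt by auto
  then consider "(e, e) \<in> P" | "(e, e) \<notin> P" "(e, e + 1) \<in> P" by blast
  then show ?thesis
  proof cases
    case 1
    then have "parses_as \<beta> b (BW k) Strong"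
      unfolding parses_as_def Let_def using k em blk b1 b2
      by (simp add: boundary_at_simps)
    then show ?thesis by blast
  next
    case 2
    obtain y where y: "(e, y) \<in> P" "y \<noteq> e + 1" using e(2) 2 by (auto simp: inner_def)
    then have "e + 2 \<le> y" using D(1)[OF y(1)] 2(1) by (cases "y = e") auto
    then have "(e, e + 2) \<in> P" using column_convex[OF 2(2) y(1)] by simp
    then have "parses_as \<beta> b (BW k) Weak"
      unfolding parses_as_def Let_def using k em blk b1 b2 2 no_opt end_P e(1)
      by (simp add: boundary_at_simps)
    then show ?thesis by blast
  qed
qed

lemma ex_parse_UC:
  assumes \<beta>: "boundary_at P \<beta> b" and b: "b < m" and b1: "(b, b + 1) \<in> P" and b2: "(b, b + 2) \<in> P"
  shows "\<exists>A \<beta>'. parses_as \<beta> b A \<beta>'"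
proof -
  note D = fullD[OF full]
  define R where "R = (GREATEST y. (b, y) \<in> P)"
  have R: "(b, R) \<in> P" unfolding R_def
    by (rule GreatestI_nat[where P = "\<lambda>y. (b, y) \<in> P" and k = "b + 1" and b = m]) (use b1 D in blast)+
  have R_max: "y \<le> R" if "(b, y) \<in> P" for y
    unfolding R_def
    by (rule Greatest_le_nat[where P = "\<lambda>y. (b, y) \<in> P" and k = y and b = m]) (use that D in blast)+
  have R2: "b + 2 \<le> R" using R_max[OF b2] .
  have colb: "(b, y) \<in> P \<longleftrightarrow> b \<le> y \<and> y \<le> R \<and> (\<beta> \<noteq> Strong \<longrightarrow> y \<noteq> b)" for y
    using D(1)[of b y] R_max[of y] boundary_at_cases(1)[OF \<beta> b] column_convex[OF b1 R, of y]
    by (cases "y = b") auto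
  \<comment> \<open>The path leaves the top of column \<open>b\<close> by a step
    \<open>(1, 0)\<close>, giving a row at height \<open>R\<close> and type \<open>C\<close>, or by
    \<open>(1, 1)\<close>, giving a row one higher and type \<open>U\<close>.\<close>
  define e where "e = (if (b + 1, R) \<in> P then R else R + 1)"
  define A where "A = (if (b + 1, R) \<in> P then BC (e - b) else BU (e - b))"
  have "(b, R + 1) \<notin> P" using R_max by force
  then have e1: "(b + 1, e) \<in> P" using path_step[OF R b] by (auto simp: e_def)
  have em: "e \<le> m" using D(2)[OF e1] .
  have eR: "R \<le> e" "e \<le> R + 1" by (auto simp: e_def)
  have ge: "e \<le> y" if "(x, y) \<in> P" "b < x" for x y
  proof (cases "x = b + 1")
    case True
    then have "R \<le> y" using chainD[OF chain R that(1)] by simp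
    then show ?thesis using that(1) True by (cases "y = R") (auto simp: e_def)
  next
    case False
    then show ?thesis using chainD[OF chain e1 that(1)] that(2) by simp
  qed
  \<comment> \<open>Avoidance of the pattern straightens the row: \<open>(b, x + 1)\<close> on the
    column and \<open>(x, e)\<close> on the row force column \<open>x + 1\<close> to have a point no
    higher than \<open>e\<close>.\<close>
  have row: "(x, e) \<in> P" if "b + 1 \<le> x" "x < e" for x
    using that
  proof (induction x rule: dec_induct)
    case base
    then show ?case using e1 by simp
  next
    case (step x)
    have "(b, x + 1) \<in> P" using colb[of "x + 1"] step eR by simp
    then obtain d where d: "d \<le> e" "(x + 1, d) \<in> P"
      using not_badD[of b x e] step by auto
    then have "d = e" using ge[OF d(2)] step by simp
    then show ?case using d by simp
  qed
  have sub: "subscript A = e - b" "b + (e - b) = e" using eR R2 by (auto simp: A_def)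
  have nt: "nontrivial_block A" using R2 by (auto simp: A_def e_def)
  have kind: "is_BC A \<or> is_BU A" "A \<noteq> BT1" "\<not> is_BW A" by (auto simp: A_def)
  \<comment> \<open>The optional \<open>(b - 1, b + 1)\<close> together with
    \<open>(b, b + 2)\<close> forces a point of column \<open>b + 1\<close> at height at most
    \<open>b + 2\<close>, so column \<open>b\<close> stops at \<open>b + 2\<close> and the next step
    is horizontal.\<close>
  have opt: "A = BC 2" if "\<beta> = Weak_Optional"
  proof -
    have "1 \<le> b" "(b - 1, b + 1) \<in> P" using \<beta> that by (auto simp: boundary_at_simps)
    then obtain d where d: "d \<le> b + 2" "(b + 1, d) \<in> P"
      using not_badD[of "b - 1" b "b + 2"] b2 by auto
    have "R \<le> d" using chainD[OF chain R d(2)] by simp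
    then have "d = R" "R = b + 2" using d(1) R2 by auto
    then show ?thesis using d(2) by (simp add: A_def e_def)
  qed
  have open_A: "(x, y) \<in> open_block A b \<longleftrightarrow> (x = b \<and> b \<le> y \<and> y \<le> R) \<or> (y = e \<and> b < x \<and> x < e)" for x y
  proof (cases "(b + 1, R) \<in> P")
    case True
    then have "A = BC (e - b)" "e = R" by (simp_all add: A_def e_def)
    then show ?thesis using open_block_BC[of "e - b" x y b] R2 by auto
  next
    case False
    then have "A = BU (e - b)" "e = R + 1" by (simp_all add: A_def e_def)
    then show ?thesis using open_block_BU[of "e - b" x y b] R2 by auto
  qed
  have inner: "y = e" if "(x, y) \<in> P" "b < x" "x < e - 1" for x y
  proof -
    have "(x + 1, e) \<in> P" using row[of "x + 1"] that by simp
    then have "y \<le> e" using chainD[OF chain that(1)] by simp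
    then show ?thesis using ge[OF that(1,2)] by simp
  qed
  have last: "(e - 1, e) \<in> P" "b < e - 1" using row[of "e - 1"] R2 eR by auto
  have blk: "(x, y) \<in> P \<longleftrightarrow> (x, y) \<in> open_block A b \<and> (\<beta> \<noteq> Strong \<longrightarrow> (x, y) \<noteq> (b, b)) \<or> Q \<and> (x, y) = (e - 1, e + 1)"
    if xy: "b \<le> x" "x < e" and l: "\<And>y. (e - 1, y) \<in> P \<longleftrightarrow> y = e \<or> Q \<and> y = e + 1" for x y Q
  proof -
    consider "x = b" | "b < x" "x < e - 1" | "x = e - 1" using xy by linarith
    then show ?thesis
    proof cases
      case 1
      then show ?thesis using colb[of y] open_A[of x y] last(2) by auto
    next
      case 2
      then show ?thesis using inner[of x y] row[of x] open_A[of x y] by auto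
    next
      case 3
      then show ?thesis using l[of y] open_A[of x y] last(2) by auto
    qed
  qed
  have parse: "parses_as \<beta> b A \<beta>'"
    if "boundary_at P \<beta>' e" "\<And>y. (e - 1, y) \<in> P \<longleftrightarrow> y = e \<or> \<beta>' = Weak_Optional \<and> y = e + 1" for \<beta>'
    unfolding parses_as_def Let_def sub
    using nt em that(1) blk[OF _ _ that(2)] kind opt b1 b2 by blast
  consider "(e, e) \<in> P" | "(e, e) \<notin> P" "(e - 1, e + 1) \<in> P" | "(e, e) \<notin> P" "(e - 1, e + 1) \<notin> P" by blast
  then show ?thesis
  proof cases
    case 1
    have "(e - 1, y) \<in> P \<longleftrightarrow> y = e" for y
      using last ge[of "e - 1" y] chainD[OF chain, of "e - 1" y e e] 1 by fastforce
    then have "parses_as \<beta> b A Strong" using 1 by (intro parse) (auto simp: boundary_at_simps)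
    then show ?thesis by blast
  next
    case 2
    \<comment> \<open>This point makes avoidance applicable to column \<open>e - 1\<close>; if
      \<open>e = b + 2\<close>, it is the top of the block, otherwise it lies on the row.\<close>
    have "(e - 2, e) \<in> P"
    proof (cases "b + 1 \<le> e - 2")
      case True then show ?thesis using row by simp
    next
      case False
      then have "e = b + 2" using last(2) by simp
      then have "R = e" using R2 eR by simp
      then show ?thesis using R \<open>e = b + 2\<close> by simp
    qed
    then have "\<exists>d\<le>e + 1. (e - 1 + 1, d) \<in> P"
      using last 2(2) by (intro not_badD[of "e - 2"]) auto
    then obtain d where d: "d \<le> e + 1" "(e, d) \<in> P" using last(2) by auto
    have "e + 1 \<le> d" using chainD[OF chain 2(2) d(2)] last(2) by simp
    then have e2: "(e, e + 1) \<in> P" using d by simp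
    have "(e - 1, y) \<in> P \<longleftrightarrow> y = e \<or> y = e + 1" for y
      using last ge[of "e - 1" y] chainD[OF chain, of "e - 1" y e "e + 1"] e2 2(2) by (fastforce simp: le_Suc_eq)
    then have "parses_as \<beta> b A Weak_Optional"
      using 2 e2 last by (intro parse) (auto simp: boundary_at_simps)
    then show ?thesis by blast
  next
    case 3
    have "e - 1 < m" using em last(2) by simp
    then have e2: "(e, e + 1) \<in> P" using path_step[OF last(1)] 3 last(2) by auto
    have "(e - 1, y) \<in> P \<longleftrightarrow> y = e" for y
      using last ge[of "e - 1" y] column_convex[OF last(1), of y "e + 1"] 3(2) by (cases "y \<le> e") auto
    then have "parses_as \<beta> b A Weak"
      using 3 e2 last by (intro parse) (auto simp: boundary_at_simps)
    then show ?thesis by blast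
  qed
qed

lemma ex_parse:
  assumes "boundary_at P \<beta> b" "b < m"
  shows "\<exists>A \<beta>'. parses_as \<beta> b A \<beta>'"
  using assms ex_parse_T1 ex_parse_W ex_parse_UC by blast

text \<open>An optional interval at boundary \<open>b\<close> sits in column \<open>b - 1\<close>,
  outside the columns parsed here, which explains the added set. The clauses on \<open>A\<close> let
  the preceding block verify \<open>boundary_allowed\<close>.\<close>

lemma ex_struct_from:
  assumes "boundary_at P \<beta> b" "b < m"
  shows "\<exists>A zs. struct_from b ((\<beta>, A) # zs) =
      {p \<in> P. b \<le> fst p} \<union> (if \<beta> = Weak_Optional then {(b - 1, b + 1)} else {}) \<and>
    (\<forall>z\<in>set ((\<beta>, A) # zs). nontrivial_block (snd z)) \<and> linked ((\<beta>, A) # zs) \<and>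
    (A = BT1 \<longleftrightarrow> (b, b + 1) \<notin> P) \<and> (is_BW A \<longleftrightarrow> (b, b + 1) \<in> P \<and> (b, b + 2) \<notin> P) \<and>
    (\<beta> = Weak_Optional \<longrightarrow> is_BW A \<or> A = BC 2)"
  using assms
proof (induction "m - b" arbitrary: b \<beta> rule: less_induct)
  case less
  obtain A \<beta>' where parse: "parses_as \<beta> b A \<beta>'" using ex_parse less.prems by blast
  define e where "e = b + subscript A"
  have A: "nontrivial_block A" "e \<le> m" "boundary_at P \<beta>' e"
    "\<And>x y. b \<le> x \<Longrightarrow> x < e \<Longrightarrow> (x, y) \<in> P \<longleftrightarrow>
        (x, y) \<in> open_block A b \<and> (\<beta> \<noteq> Strong \<longrightarrow> (x, y) \<noteq> (b, b)) \<or>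
        \<beta>' = Weak_Optional \<and> (x, y) = (e - 1, e + 1)"
    "A = BT1 \<longleftrightarrow> (b, b + 1) \<notin> P" "is_BW A \<longleftrightarrow> (b, b + 1) \<in> P \<and> (b, b + 2) \<notin> P"
    "\<beta> = Weak_Optional \<longrightarrow> is_BW A \<or> A = BC 2"
    "\<beta>' = Weak \<Longrightarrow> A \<noteq> BT1 \<and> (is_BW A \<longrightarrow> (e, e + 2) \<in> P)"
    "\<beta>' = Weak_Optional \<Longrightarrow> is_BC A \<or> is_BU A"
    using parse unfolding parses_as_def Let_def e_def[symmetric] by blast+
  have be: "b < e" using subscript_pos[OF A(1)] by (simp add: e_def)
  have split: "(open_block A b - (if \<beta> = Strong then {} else {(b, b)})) \<union> S = {p \<in> P. b \<le> fst p}"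
    if "S = {p \<in> P. e \<le> fst p} \<union> (if \<beta>' = Weak_Optional then {(e - 1, e + 1)} else {})" for S
  proof (rule set_eqI)
    fix p :: "nat \<times> nat"
    obtain x y where p: "p = (x, y)" by fastforce
    let ?O = "open_block A b - (if \<beta> = Strong then {} else {(b, b)})"
    have e1: "e - 1 < e" "b \<le> e - 1" using be by auto
    have O: "p \<in> ?O \<longleftrightarrow> (x, y) \<in> open_block A b \<and> (\<beta> \<noteq> Strong \<longrightarrow> (x, y) \<noteq> (b, b))" by (simp add: p)
    have S: "p \<in> S \<longleftrightarrow> (x, y) \<in> P \<and> e \<le> x \<or> \<beta>' = Weak_Optional \<and> (x, y) = (e - 1, e + 1)"
      by (auto simp: that p)
    have "p \<in> ?O \<union> S \<longleftrightarrow> (x, y) \<in> P \<and> b \<le> x"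
    proof (cases "b \<le> x \<and> x < e")
      case True
      then show ?thesis using A(4)[of x y] O S by auto
    next
      case False
      then have "p \<notin> ?O" using O open_block_bounds(1,2)[OF A(1), of x y b] by (auto simp: e_def)
      moreover have "(x, y) \<noteq> (e - 1, e + 1)" using False e1 by auto
      ultimately show ?thesis using S False be by auto
    qed
    then show "p \<in> ?O \<union> S \<longleftrightarrow> p \<in> {p \<in> P. b \<le> fst p}" by (simp add: p)
  qed
  show ?case
  proof (cases "e = m")
    case True
    have "\<beta>' = Strong" using A(3) fullD(2)[OF full, of m "m + 1"]
      by (cases \<beta>') (auto simp: True boundary_at_simps)
    have "{(e, e)} = {p \<in> P. e \<le> fst p} \<union> (if \<beta>' = Weak_Optional then {(e - 1, e + 1)} else {})"
    proof -
      have "p = (m, m)" if "p \<in> P" "m \<le> fst p" for p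
        using fullD[OF full, of "fst p" "snd p"] that by (auto simp: prod_eq_iff)
      then have "{p \<in> P. m \<le> fst p} \<subseteq> {(m, m)}" by blast
      then have "{p \<in> P. m \<le> fst p} = {(m, m)}" using full_diag[OF full] by fastforce
      then show ?thesis using \<open>\<beta>' = Strong\<close> True by simp
    qed
    from split[OF this] have "struct_from b [(\<beta>, A)] =
        {p \<in> P. b \<le> fst p} \<union> (if \<beta> = Weak_Optional then {(b - 1, b + 1)} else {})"
      unfolding struct_from.simps e_def[symmetric] by blast
    then show ?thesis using A(1,5-7) by (intro exI[of _ A] exI[of _ "[]"]) simp
  next
    case False
    then have em: "e < m" using A(2) by simp
    then have dec: "m - e < m - b" using be by linarith
    obtain A' zs where IH: "struct_from e ((\<beta>', A') # zs) =
      {p \<in> P. e \<le> fst p} \<union> (if \<beta>' = Weak_Optional then {(e - 1, e + 1)} else {})"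
      "\<forall>z\<in>set ((\<beta>', A') # zs). nontrivial_block (snd z)" "linked ((\<beta>', A') # zs)"
      "A' = BT1 \<longleftrightarrow> (e, e + 1) \<notin> P" "is_BW A' \<longleftrightarrow> (e, e + 1) \<in> P \<and> (e, e + 2) \<notin> P"
      "\<beta>' = Weak_Optional \<longrightarrow> is_BW A' \<or> A' = BC 2"
      using less.hyps[OF dec A(3) em] by (elim exE conjE)
    have "boundary_allowed A \<beta>' A'"
      using A(3,8,9) IH(4-6) by (cases \<beta>') (auto simp: boundary_at_simps)
    then have "linked ((\<beta>, A) # (\<beta>', A') # zs)" using IH(3) by simp
    moreover have "struct_from b ((\<beta>, A) # (\<beta>', A') # zs) =
        {p \<in> P. b \<le> fst p} \<union> (if \<beta> = Weak_Optional then {(b - 1, b + 1)} else {})"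
      unfolding struct_from.simps(2)[of b \<beta>] e_def[symmetric] using split[OF IH(1)] by blast
    ultimately show ?thesis
      using A(1,5-7) IH(2) by (intro exI[of _ A] exI[of _ "(\<beta>', A') # zs"]) auto
  qed
qed

lemma ex_block_struct: "\<exists>S. valid_block_struct S \<and> struct_intervals S = P"
proof (cases "m = 0")
  case True
  have "P = {(0, 0)}"
    using full_diag[OF full] fullD[OF full] by (auto simp: True)
  then show ?thesis by (intro exI[of _ "([BT0], [])"]) (auto simp: superscript_def)
next
  case False
  obtain a where "(a, 0) \<in> P" "a \<le> 0" using full_row[OF full, of 0] by auto
  then have "boundary_at P Strong 0" by (simp add: boundary_at_simps)
  then obtain A zs where zs: "struct_from 0 ((Strong, A) # zs) = {p \<in> P. 0 \<le> fst p}"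
    "\<forall>z\<in>set ((Strong, A) # zs). nontrivial_block (snd z)" "linked ((Strong, A) # zs)"
    using ex_struct_from[of Strong 0] False by auto
  let ?zs = "(Strong, A) # zs"
  let ?S = "(map snd ?zs, map fst (tl ?zs))"
  have "struct_intervals ?S = P"
    using struct_intervals_eq_struct_from[OF zs(2)] zs(1) by simp
  moreover have "valid_block_struct ?S"
  proof -
    have "boundary_allowed (map snd ?zs ! j) (map fst zs ! j) (map snd ?zs ! Suc j)" if "j < length zs" for j
      using zs(3) that by (auto simp: successively_conv_nth nth_Cons split: nat.splits)
    then show ?thesis using zs(2) by auto
  qed
  ultimately show ?thesis by blast
qed

end

theorem theorem3p7:
  fixes X :: "'a set" and r :: "'a rel"
  assumes "finite X" and "X \<noteq> {}" and "semiorder_on X r"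
  shows "order_dim X r \<le> 2 \<longleftrightarrow>
           hereditary X r \<and>
           no_optional_elements (block_structure X r) \<and>
           inner_C_next_to_T1 (block_structure X r)"
proof -
  let ?P = "set_mset (min_endpoint_rep X r)" and ?S = "block_structure X r"
  note her = hereditary_iff_not_bad[OF assms]
  have P: "?P = (\<lambda>x. (left_endpoint X r x, right_endpoint X r x)) ` X"
    by (rule set_min_endpoint_rep[OF assms(1)])
  interpret interval_poset X r "left_endpoint X r" "right_endpoint X r"
    by (rule semiorder_min_endpoint_rep(1)[OF assms])
  obtain m where full: "full ?P m" using semiorder_min_endpoint_rep(2)[OF assms] by blast
  have chain: "chain ?P" by (rule semiorder_min_endpoint_rep(3)[OF assms])
  \<comment> \<open>The choice made by \<open>block_structure\<close> enters only through validity
    and the interval set, and existence of a structure secures both.\<close>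
  have S: "valid_block_struct ?S" "struct_intervals ?S = ?P" if "\<not> bad ?P"
    using someI_ex[OF ex_block_struct[OF full chain that]] unfolding block_structure_def by blast+
  show ?thesis
  proof
    assume "order_dim X r \<le> 2"
    then have ori: "orientable ?P" unfolding P by (rule orientable_of_order_dim_le_2)
    then have nb: "\<not> bad ?P" using bad_not_orientable[OF full chain] by blast
    have "no_optional_elements ?S"
      using optional_not_orientable[of ?S m] S[OF nb] full chain ori by auto
    moreover have "inner_C_next_to_T1 ?S"
      using inner_C_struct_not_orientable[of ?S m] S[OF nb] full ori by auto
    ultimately show "hereditary X r \<and> no_optional_elements ?S \<and> inner_C_next_to_T1 ?S"
      using her nb by simp
  next
    assume R: "hereditary X r \<and> no_optional_elements ?S \<and> inner_C_next_to_T1 ?S"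
    then have "\<not> bad ?P" using her by simp
    note S = S[OF this]
    obtain As Bs where S': "?S = (As, Bs)" by fastforce
    \<comment> \<open>Weak boundaries only delete corners, and in the absence of optional elements
      nothing is added to the union of the blocks.\<close>
    have "?P \<subseteq> (\<Union>j<length As. block_intervals (As ! j) (superscript As j))"
      using S(2) R by (auto simp: S' no_optional_elements_def in_set_conv_nth)
    moreover have "\<exists>\<kappa>. clustering \<kappa> (\<Union>j<length As. block_intervals (As ! j) (superscript As j))"
    proof (cases "As = [BT0]")
      case True
      then show ?thesis by (intro exI[of _ "\<lambda>_. 0"]) (simp add: clustering_def)
    next
      case False
      then have nt: "\<forall>A\<in>set As. nontrivial_block A" using S(1) by (auto simp: S')
      have "C_ok True As"
      proof (rule C_okI)
        fix j assume "j < length As" "is_BC (As ! j)"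
        then show "(j = 0 \<and> True) \<or> (0 < j \<and> As ! (j - 1) = BT1) \<or> Suc j = length As \<or> As ! Suc j = BT1"
          using R by (cases "j = 0"; cases "Suc j = length As") (auto simp: S' inner_C_next_to_T1_def)
      qed
      then obtain \<kappa> where "clustering \<kappa> (blocks_from 0 As)" using ex_clustering[OF nt] by blast
      moreover have "(\<Union>j<length As. block_intervals (As ! j) (superscript As j)) \<subseteq> blocks_from 0 As"
        using blocks_subset_blocks_from[OF nt, of _ 0] by auto
      ultimately show ?thesis using clustering_mono by blast
    qed
    ultimately obtain \<kappa> where "clustering \<kappa> ?P" using clustering_mono by blast
    then show "order_dim X r \<le> 2" unfolding P by (rule order_dim_le_2_of_clustering)
  qed
qed

end
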